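(* Let $t\ge1$ and $2\le k_1\le k_2\le\cdots\le k_t$ be integers and $\kappa:=\sum_{i=1}^t(k_i-1)$. There is $n_0$ such that for every $n\ge n_0$, the set of $n$-vertex graphs that are $C_{2k_1,\ldots,2k_t}$-minor-free and have maximum adjacency spectral radius among all $n$-vertex $C_{2k_1,\ldots,2k_t}$-minor-free graphs coincides with $\mathrm{SPEX}(n,C_{2k_1,\ldots,2k_t})$, and consists of a single graph $G$, where $G=F_{n,t}$ if $k_t=2$, and $G=S_{n,\kappa}^+$ if $k_t\ge 3$.
   Context: $C_{2k_1,\ldots,2k_t}$ is the graph obtained from cycles $C_{2k_1},\ldots,C_{2k_t}$ intersecting in exactly one common vertex. $\mathrm{SPEX}(n,F)$ is the set of $n$-vertex graphs containing no subgraph isomorphic to $F$ whose adjacency spectral radius is maximum among all such graphs. A graph is $H$-minor-free if no sequence of vertex deletions, edge deletions and edge contractions yields a graph isomorphic to $H$. $S_{n,k}:=K_k\vee(n-k)K_1$; $S_{n,k}^+$ is $S_{n,k}$ with one edge added inside the independent set; $M_m:=\lfloor m/2\rfloor K_2\cup\gamma K_1$ with $\gamma=m\bmod2$; $F_{n,k}:=K_k\vee M_{n-k}$. Graphs are identified up to isomorphism. *)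

theory Defs
  imports
    "Graph_Theory.Graph_Theory"
    "Jordan_Normal_Form.Spectral_Radius"
begin

text \<open>
  A finite simple graph is a value satisfying the predicate \<^const>\<open>pair_graph\<close> (finite, symmetric,
  loop-free): the edge between \<open>u\<close> and \<open>v\<close> is the pair of arcs \<open>(u, v)\<close>, \<open>(v, u)\<close>.
\<close>

abbreviation graph_iso :: "'a pair_pre_digraph \<Rightarrow> 'b pair_pre_digraph \<Rightarrow> bool" (infix \<open>\<simeq>\<^sub>g\<close> 50) where
  "G \<simeq>\<^sub>g H \<equiv> digraph_iso (with_proj G) (with_proj H)"

definition add_edge :: "'a pair_pre_digraph \<Rightarrow> 'a \<Rightarrow> 'a \<Rightarrow> 'a pair_pre_digraph" where
  "add_edge G u v = \<lparr>pverts = pverts G, parcs = parcs G \<union> {(u, v), (v, u)}\<rparr>"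

definition complete_graph :: "nat \<Rightarrow> nat pair_pre_digraph" where
  "complete_graph m = \<lparr>pverts = {..<m}, parcs = {(u, v). u < m \<and> v < m \<and> u \<noteq> v}\<rparr>"

definition disjoint_union ::
    "'a pair_pre_digraph \<Rightarrow> 'b pair_pre_digraph \<Rightarrow> ('a + 'b) pair_pre_digraph" where
  "disjoint_union G H =
    \<lparr>pverts = pverts G <+> pverts H,
     parcs = {(Inl u, Inl v) | u v. (u, v) \<in> parcs G} \<union> {(Inr u, Inr v) | u v. (u, v) \<in> parcs H}\<rparr>"

definition join :: "'a pair_pre_digraph \<Rightarrow> 'b pair_pre_digraph \<Rightarrow> ('a + 'b) pair_pre_digraph" where
  "join G H =
    \<lparr>pverts = pverts (disjoint_union G H),
     parcs = parcs (disjoint_union G H)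
       \<union> {(Inl u, Inr v) | u v. u \<in> pverts G \<and> v \<in> pverts H}
       \<union> {(Inr v, Inl u) | u v. u \<in> pverts G \<and> v \<in> pverts H}\<rparr>"

text \<open>The disjoint union of \<open>m\<close> copies of \<open>G\<close>.\<close>

definition copies :: "nat \<Rightarrow> 'a pair_pre_digraph \<Rightarrow> (nat \<times> 'a) pair_pre_digraph" where
  "copies m G =
    \<lparr>pverts = {..<m} \<times> pverts G,
     parcs = {((i, u), (i, v)) | i u v. i < m \<and> (u, v) \<in> parcs G}\<rparr>"

definition S_graph :: "nat \<Rightarrow> nat \<Rightarrow> (nat + nat \<times> nat) pair_pre_digraph" where
  "S_graph n k = join (complete_graph k) (copies (n - k) (complete_graph 1))"

text \<open>
  Meaningful for \<open>k + 2 \<le> n\<close>; up to isomorphism it does not matter which two vertices of the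
  independent set are joined.
\<close>

definition S_plus_graph :: "nat \<Rightarrow> nat \<Rightarrow> (nat + nat \<times> nat) pair_pre_digraph" where
  "S_plus_graph n k = add_edge (S_graph n k) (Inr (0, 0)) (Inr (1, 0))"

definition M_graph :: "nat \<Rightarrow> (nat \<times> nat + nat \<times> nat) pair_pre_digraph" where
  "M_graph m =
    disjoint_union (copies (m div 2) (complete_graph 2)) (copies (m mod 2) (complete_graph 1))"

definition F_graph :: "nat \<Rightarrow> nat \<Rightarrow> (nat + nat \<times> nat + nat \<times> nat) pair_pre_digraph" where
  "F_graph n k = join (complete_graph k) (M_graph (n - k))"

text \<open>
  Cycles of lengths \<open>l 1, \<dots>, l t\<close> (each at least 3) sharing exactly one vertex: the \<open>i\<close>-th cycle runs
  through \<open>(0, 0), (i, 1), \<dots>, (i, l i - 1)\<close>, and \<open>(0, 0)\<close> is the common vertex.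
\<close>

definition cycle_vertex :: "nat \<Rightarrow> nat \<Rightarrow> nat \<times> nat" where
  "cycle_vertex i j = (if j = 0 then (0, 0) else (i, j))"

definition intersecting_cycles :: "nat \<Rightarrow> (nat \<Rightarrow> nat) \<Rightarrow> (nat \<times> nat) pair_pre_digraph" where
  "intersecting_cycles t l =
    \<lparr>pverts = {cycle_vertex i j | i j. i \<in> {1..t} \<and> j < l i},
     parcs =
       {(cycle_vertex i j, cycle_vertex i (Suc j mod l i)) | i j. i \<in> {1..t} \<and> j < l i}
       \<union> {(cycle_vertex i (Suc j mod l i), cycle_vertex i j) | i j. i \<in> {1..t} \<and> j < l i}\<rparr>"

definition contains_subgraph :: "'a pair_pre_digraph \<Rightarrow> 'b pair_pre_digraph \<Rightarrow> bool" where
  "contains_subgraph G F \<longleftrightarrow>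
    (\<exists>H :: 'a pair_pre_digraph. subgraph (with_proj H) (with_proj G) \<and> H \<simeq>\<^sub>g F)"

definition delete_vertex :: "'a pair_pre_digraph \<Rightarrow> 'a \<Rightarrow> 'a pair_pre_digraph" where
  "delete_vertex G v =
    \<lparr>pverts = pverts G - {v}, parcs = {(x, y) \<in> parcs G. x \<noteq> v \<and> y \<noteq> v}\<rparr>"

definition delete_edge :: "'a pair_pre_digraph \<Rightarrow> 'a \<Rightarrow> 'a \<Rightarrow> 'a pair_pre_digraph" where
  "delete_edge G u v = \<lparr>pverts = pverts G, parcs = parcs G - {(u, v), (v, u)}\<rparr>"

text \<open>
  Contraction of the edge \<open>uv\<close>: \<open>v\<close> is identified with \<open>u\<close>; the loop at \<open>u\<close> is discarded, and parallel
  edges merge because arcs form a set.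
\<close>

definition contract_edge :: "'a pair_pre_digraph \<Rightarrow> 'a \<Rightarrow> 'a \<Rightarrow> 'a pair_pre_digraph" where
  "contract_edge G u v =
    (let f = (\<lambda>x. if x = v then u else x) in
     \<lparr>pverts = f ` pverts G, parcs = {(f x, f y) | x y. (x, y) \<in> parcs G \<and> f x \<noteq> f y}\<rparr>)"

inductive minor_step :: "'a pair_pre_digraph \<Rightarrow> 'a pair_pre_digraph \<Rightarrow> bool" where
  "v \<in> pverts G \<Longrightarrow> minor_step G (delete_vertex G v)"
| "(u, v) \<in> parcs G \<Longrightarrow> minor_step G (delete_edge G u v)"
| "(u, v) \<in> parcs G \<Longrightarrow> minor_step G (contract_edge G u v)"

definition minor_free :: "'a pair_pre_digraph \<Rightarrow> 'b pair_pre_digraph \<Rightarrow> bool" where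
  "minor_free G H \<longleftrightarrow> \<not> (\<exists>G'. minor_step\<^sup>*\<^sup>* G G' \<and> G' \<simeq>\<^sub>g H)"

text \<open>
  The \<open>n\<close>-vertex graphs are represented by all labelled graphs on \<open>{0, \<dots>, n - 1}\<close>. Sets of
  \<open>n\<close>-vertex graphs up to isomorphism then correspond to isomorphism-closed subsets, and a single
  graph \<open>G\<close> corresponds to \<open>iso_class n G\<close>.
\<close>

definition graphs :: "nat \<Rightarrow> nat pair_pre_digraph set" where
  "graphs n = {G. pair_graph G \<and> pverts G = {..<n}}"

definition iso_class :: "nat \<Rightarrow> 'a pair_pre_digraph \<Rightarrow> nat pair_pre_digraph set" where
  "iso_class n G = {H \<in> graphs n. H \<simeq>\<^sub>g G}"

definition adjacency_matrix :: "nat \<Rightarrow> nat pair_pre_digraph \<Rightarrow> complex mat" where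
  "adjacency_matrix n G = mat n n (\<lambda>(i, j). if (i, j) \<in> parcs G then 1 else 0)"

definition spectral_maximisers ::
    "nat \<Rightarrow> (nat pair_pre_digraph \<Rightarrow> bool) \<Rightarrow> nat pair_pre_digraph set" where
  "spectral_maximisers n P =
    {G \<in> graphs n. P G \<and>
      (\<forall>H \<in> graphs n. P H \<longrightarrow>
        spectral_radius (adjacency_matrix n H) \<le> spectral_radius (adjacency_matrix n G))}"

definition SPEX :: "nat \<Rightarrow> 'a pair_pre_digraph \<Rightarrow> nat pair_pre_digraph set" where
  "SPEX n F = spectral_maximisers n (\<lambda>G. \<not> contains_subgraph G F)"

definition SPEX_minor :: "nat \<Rightarrow> 'a pair_pre_digraph \<Rightarrow> nat pair_pre_digraph set" where
  "SPEX_minor n F = spectral_maximisers n (\<lambda>G. minor_free G F)"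

end

theory Submission
  imports Defs "HOL-Analysis.Function_Topology" "HOL-Number_Theory.Cong"
begin

text \<open>
  Let \<open>F\<close> be the graph of intersecting cycles and \<open>x\<close> the Perron vector, with maximal entry 1, of an
  extremal graph on \<open>n\<close> vertices, whose spectral radius \<open>\<lambda>\<close> satisfies \<open>\<lambda>\<^sup>2 \<ge> \<kappa>(n - \<kappa>)\<close>.

  Let \<open>\<kappa> \<ge> 2\<close> and let \<open>B\<close> be the set of vertices of degree at least \<open>\<delta>n\<close>; as \<open>F\<close> is a subgraph of a
  complete bipartite graph with \<open>\<kappa> + 1\<close> vertices on one side, \<open>B\<close> has bounded size and all but
  boundedly many vertices have at most \<open>\<kappa>\<close> neighbours in \<open>B\<close>. Paths between neighbours of \<open>v\<close> bound the
  number of walks of length two from \<open>v\<close> that avoid \<open>B\<close>, so that expanding \<open>\<lambda>\<^sup>2 x\<^sub>v\<close> at the largest entry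
  outside \<open>B\<close> shows that all entries outside \<open>B\<close> are small. Expanding at the largest entry then
  produces a set \<open>R\<close> of \<open>\<kappa>\<close> vertices of weight almost 1 and degree almost \<open>n\<close>. The vertices that are not
  adjacent to all of \<open>R\<close> form a small set; since joining such a vertex to exactly \<open>R\<close> creates no \<open>F\<close> and
  must not increase \<open>\<lambda>\<close>, this set would induce a graph of spectral radius comparable to \<open>\<lambda>\<close>, which
  is too large for its size, hence it is empty.

  If \<open>\<kappa> = 1\<close>, i.e. \<open>F\<close> is the 4-cycle, let \<open>m\<^sub>u\<close> be the number of vertices without a common neighbour with
  \<open>u\<close>. Then \<open>\<Sum>\<^sub>u m\<^sub>u x\<^sub>u = (n - 1 - \<lambda>\<^sup>2 + \<lambda>) \<Sum>\<^sub>u x\<^sub>u\<close>. For odd \<open>n\<close> comparison with the friendship graph makes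
  all \<open>m\<^sub>u\<close> vanish and the friendship theorem applies. For even \<open>n\<close> a parity argument gives
  \<open>\<lambda> \<Sum>\<^sub>u m\<^sub>u x\<^sub>u \<ge> \<Sum>\<^sub>u x\<^sub>u\<close>, with equality only if some vertex is adjacent to all others.

  In both cases the graph outside \<open>R\<close> is a matching, or a single edge if some cycle is longer than 4.
  Having \<open>\<kappa>\<close> vertices whose removal leaves such a graph is inherited by minors and fails for \<open>F\<close>.
\<close>

section \<open>Paths and flowers\<close>

text \<open>The case \<kappa> = 1 is proved separately because there is no stability: polarity
  graphs contain no 4-cycle and have spectral radius asymptotic to sqrt n, like the star, but no
  vertex of linear degree. The comparison with the friendship graph therefore has to be exact, and
  the final exclusion of competitors is arithmetic (parity, walks modulo a prime). For \<kappa> at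
  least 2 the delicate quantity is the coefficient of n in the bound for walks avoiding
  \<open>B\<close>, since it competes with the coefficient \<kappa> in the lower bound for the
  squared spectral radius. A crude count gives a multiple of \<open>order_F\<close>, which is
  useless for the main term; the sharp count gives the maximum of \<open>k i - 1\<close>, which is
  below \<kappa> exactly when there are at least two cycles. The constants are fixed in the order
  \<open>\<delta>\<close>, \<open>b\<close>, \<open>n\<close>: \<open>\<delta>\<close> is small in
  terms of \<kappa> and \<open>order_F\<close>, \<open>b\<close> is about
  \<open>(\<kappa> + 1) / \<delta>\<close>, and \<open>n\<close> is so large that all bounded
  quantities and those of order sqrt n are absorbed by \<open>\<delta> * n\<close>.\<close>

definition is_path :: "('a \<Rightarrow> 'a \<Rightarrow> bool) \<Rightarrow> 'a list \<Rightarrow> bool" where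
  "is_path E p \<longleftrightarrow> distinct p \<and> successively E p"

text \<open>Cycle \<open>i\<close> without the centre \<open>v\<close> is a path on
  \<open>2 * k i - 1\<close> vertices. This number is odd, so both ends can lie on the same side of
  a bipartition.\<close>

definition petals :: "('a \<Rightarrow> 'a \<Rightarrow> bool) \<Rightarrow> 'a \<Rightarrow> nat set \<Rightarrow> (nat \<Rightarrow> nat) \<Rightarrow> (nat \<Rightarrow> 'a list) \<Rightarrow> bool" where
  "petals E v I k p \<longleftrightarrow>
    (\<forall>i\<in>I. is_path E (p i) \<and> length (p i) = 2 * k i - 1 \<and> E v (hd (p i)) \<and> E v (last (p i)) \<and>
      v \<notin> set (p i)) \<and>
    (\<forall>i\<in>I. \<forall>j\<in>I. i \<noteq> j \<longrightarrow> set (p i) \<inter> set (p j) = {})"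

definition flower :: "('a \<Rightarrow> 'a \<Rightarrow> bool) \<Rightarrow> nat set \<Rightarrow> (nat \<Rightarrow> nat) \<Rightarrow> bool" where
  "flower E I k \<longleftrightarrow> (\<exists>v p. petals E v I k p)"

text \<open>The sides may overlap: what is counted are ordered pairs, the edges of the bipartite
  double cover.\<close>

definition edge_count :: "('a \<Rightarrow> 'a \<Rightarrow> bool) \<Rightarrow> 'a set \<Rightarrow> 'a set \<Rightarrow> nat" where
  "edge_count E A W = (\<Sum>u\<in>A. card {w \<in> W. E u w})"

lemma card_petals_le:
  assumes "petals E v I k p" "finite I"
  shows "card (\<Union>i\<in>I. set (p i)) \<le> (\<Sum>i\<in>I. 2 * k i - 1)"
proof -
  have "card (\<Union>i\<in>I. set (p i)) \<le> (\<Sum>i\<in>I. card (set (p i)))"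
    using assms(2) by (rule card_UN_le)
  also have "\<dots> \<le> (\<Sum>i\<in>I. 2 * k i - 1)"
    using assms(1) by (intro sum_mono) (metis card_length petals_def)
  finally show ?thesis .
qed

lemma petals_insert:
  assumes "petals E v I k p" "i \<notin> I" "is_path E q" "length q = 2 * k i - 1"
    "E v (hd q)" "E v (last q)" "v \<notin> set q" "set q \<inter> (\<Union>j\<in>I. set (p j)) = {}"
  shows "petals E v (insert i I) k (p(i := q))"
  using assms unfolding petals_def by (auto 0 3)

lemma obtain_outside:
  assumes "card (S \<inter> Z) < card S"
  obtains w where "w \<in> S" "w \<notin> Z"
  using assms by (metis Int_absorb2 less_irrefl subsetI)

lemma is_path_snoc2:
  assumes "is_path E p" "p \<noteq> []" "E (last p) w" "E w u" "w \<notin> set p" "u \<notin> set p" "u \<noteq> w"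
  shows "is_path E (p @ [w, u])"
  using assms by (auto simp: is_path_def successively_append_iff)

text \<open>A path that ends in \<open>A\<close> has used one vertex fewer of \<open>W\<close> than
  of \<open>A\<close>, so \<open>K - 1\<close> neighbours in \<open>W\<close> are enough for the
  next step. The numbers of vertices used on each side are recorded because in the applications with
  hubs one side is scarce.\<close>

lemma alternating_path:
  assumes fin: "finite A" "finite W" and dis: "A \<inter> W = {}" and u0: "u0 \<in> A"
    and dA: "\<And>u. u \<in> A \<Longrightarrow> K - 1 \<le> card {w \<in> W. E u w}"
    and dW: "\<And>w. w \<in> W \<Longrightarrow> K \<le> card {u \<in> A. E w u}"
    and j: "1 \<le> j" "j \<le> K"
  shows "\<exists>p. is_path E p \<and> length p = 2 * j - 1 \<and> hd p = u0 \<and> last p \<in> A \<and> set p \<subseteq> A \<union> W \<and>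
    card (set p \<inter> A) = j \<and> card (set p \<inter> W) = j - 1"
  using j
proof (induction j rule: nat_induct_at_least)
  case base
  show ?case
    using u0 dis by (intro exI[of _ "[u0]"]) (auto simp: is_path_def)
next
  case (Suc j)
  then obtain p where p: "is_path E p" "length p = 2 * j - 1" "hd p = u0" "last p \<in> A" "set p \<subseteq> A \<union> W"
    "card (set p \<inter> A) = j" "card (set p \<inter> W) = j - 1" by auto
  have ne: "p \<noteq> []" using p(2) Suc(1) by auto
  have "card ({w \<in> W. E (last p) w} \<inter> set p) \<le> card (set p \<inter> W)"
    by (intro card_mono) auto
  also have "\<dots> < card {w \<in> W. E (last p) w}" using dA[OF p(4)] p(7) Suc.prems Suc(1) by auto
  finally obtain w where w: "w \<in> W" "E (last p) w" "w \<notin> set p" by (auto elim!: obtain_outside)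
  have "card ({u \<in> A. E w u} \<inter> set p) \<le> card (set p \<inter> A)"
    by (intro card_mono) auto
  also have "\<dots> < card {u \<in> A. E w u}" using dW[OF w(1)] p(6) Suc.prems by auto
  finally obtain u where u: "u \<in> A" "E w u" "u \<notin> set p" by (auto elim!: obtain_outside)
  have uw: "u \<noteq> w" "u \<notin> W" "w \<notin> A" using u w dis by auto
  have 1: "set (p @ [w, u]) \<inter> A = insert u (set p \<inter> A)" "set (p @ [w, u]) \<inter> W = insert w (set p \<inter> W)"
    using u w uw by auto
  have "card (set (p @ [w, u]) \<inter> A) = Suc j" "card (set (p @ [w, u]) \<inter> W) = Suc j - 1"
    unfolding 1 using u w p(6,7) Suc(1) by (subst card_insert_disjoint, auto)+
  then show ?case
    using p u w uw ne Suc(1) is_path_snoc2[OF p(1) ne w(2) u(2) w(3) u(3) uw(1)]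
    by (intro exI[of _ "p @ [w, u]"]) auto
qed

text \<open>Here the sides may overlap, so every vertex used so far can block both of them; hence
  the generous bound \<open>card Z + 2 * j\<close>.\<close>

lemma greedy_path:
  assumes fin: "finite A" "finite W" "finite Z" and u0: "u0 \<in> A" "u0 \<notin> Z"
    and dA: "\<And>u. u \<in> A \<Longrightarrow> D \<le> card {w \<in> W. E u w}"
    and dW: "\<And>w. w \<in> W \<Longrightarrow> D \<le> card {u \<in> A. E w u}"
    and irr: "\<And>u. \<not> E u u"
    and j: "1 \<le> j" and D: "card Z + 2 * j \<le> D"
  shows "\<exists>p. is_path E p \<and> length p = 2 * j - 1 \<and> hd p = u0 \<and> last p \<in> A \<and> set p \<subseteq> (A \<union> W) - Z"
  using j D
proof (induction j rule: nat_induct_at_least)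
  case base
  show ?case
    using u0 by (intro exI[of _ "[u0]"]) (auto simp: is_path_def)
next
  case (Suc j)
  then obtain p where p: "is_path E p" "length p = 2 * j - 1" "hd p = u0" "last p \<in> A" "set p \<subseteq> (A \<union> W) - Z"
    by auto
  have ne: "p \<noteq> []" using p(2) Suc(1) by auto
  have c: "card (S \<inter> (Z \<union> set p)) < D" for S
  proof -
    have "card (S \<inter> (Z \<union> set p)) \<le> card (Z \<union> set p)" using fin by (intro card_mono) auto
    also have "\<dots> \<le> card Z + card (set p)" by (rule card_Un_le)
    also have "\<dots> < D" using card_length[of p] p(2) Suc by auto
    finally show ?thesis .
  qed
  have "card ({w \<in> W. E (last p) w} \<inter> (Z \<union> set p)) < card {w \<in> W. E (last p) w}"
    using c dA[OF p(4)] by (rule less_le_trans)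
  then obtain w where w: "w \<in> W" "E (last p) w" "w \<notin> set p" "w \<notin> Z" by (auto elim!: obtain_outside)
  have "card ({u \<in> A. E w u} \<inter> (Z \<union> set p)) < card {u \<in> A. E w u}"
    using c dW[OF w(1)] by (rule less_le_trans)
  then obtain u where u: "u \<in> A" "E w u" "u \<notin> set p" "u \<notin> Z" by (auto elim!: obtain_outside)
  have uw: "u \<noteq> w" using u irr by auto
  then show ?case
    using p u w uw ne Suc(1) is_path_snoc2[OF p(1) ne w(2) u(2) w(3) u(3) uw(1)]
    by (intro exI[of _ "p @ [w, u]"]) auto
qed

lemma edge_count_flip:
  assumes "finite A" "finite W" and sym: "symp E"
  shows "edge_count E A W = edge_count E W A"
proof -
  have "edge_count E A W = (\<Sum>u\<in>A. \<Sum>w\<in>W. if E u w then 1 else 0)"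
    unfolding edge_count_def using assms by (intro sum.cong refl) (simp flip: sum.inter_filter)
  also have "\<dots> = (\<Sum>w\<in>W. \<Sum>u\<in>A. if E w u then 1 else 0)"
    by (subst sum.swap) (intro sum.cong refl, use sympD[OF sym] in metis)
  also have "\<dots> = edge_count E W A"
    unfolding edge_count_def using assms by (intro sum.cong refl) (simp flip: sum.inter_filter)
  finally show ?thesis .
qed

lemma edge_count_remove1:
  assumes "finite A" "u \<in> A"
  shows "edge_count E A W = edge_count E (A - {u}) W + card {w \<in> W. E u w}"
  using assms unfolding edge_count_def by (simp add: sum.remove)

text \<open>Deleting a vertex of degree at most \<open>c\<close> removes at most \<open>c\<close>
  edges and lowers \<open>c * (card A + card W)\<close> by \<open>c\<close>, so the hypothesis
  survives. The process stops before \<open>A\<close> is empty because some edge always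
  remains.\<close>

lemma dense_core:
  assumes "finite A" "finite W" and sym: "symp E"
    and "c * (card A + card W) < edge_count E A W"
  shows "\<exists>A' W'. A' \<subseteq> A \<and> W' \<subseteq> W \<and> A' \<noteq> {} \<and> (\<forall>u\<in>A'. c < card {w \<in> W'. E u w}) \<and>
    (\<forall>w\<in>W'. c < card {u \<in> A'. E w u})"
  using assms(1,2,4)
proof (induction "card A + card W" arbitrary: A W rule: less_induct)
  case less
  consider (1) u where "u \<in> A" "card {w \<in> W. E u w} \<le> c"
    | (2) w where "w \<in> W" "card {u \<in> A. E w u} \<le> c"
    | (3) "\<forall>u\<in>A. c < card {w \<in> W. E u w}" "\<forall>w\<in>W. c < card {u \<in> A. E w u}"
    by (meson not_le)
  then show ?case
  proof cases
    case 1
    have A: "card A = Suc (card (A - {u}))" using 1(1) less.prems(1) by (metis card.remove)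
    have "c * (card (A - {u}) + card W) < edge_count E (A - {u}) W"
      using edge_count_remove1[OF less.prems(1) 1(1), of E W] 1(2) less.prems(3) A by (simp add: algebra_simps)
    then have "\<exists>A' W'. A' \<subseteq> A - {u} \<and> W' \<subseteq> W \<and> A' \<noteq> {} \<and> (\<forall>u\<in>A'. c < card {w \<in> W'. E u w}) \<and>
        (\<forall>w\<in>W'. c < card {u \<in> A'. E w u})"
      using A less.prems by (intro less.hyps) auto
    then obtain A' W' where "A' \<subseteq> A - {u} \<and> W' \<subseteq> W \<and> A' \<noteq> {} \<and> (\<forall>u\<in>A'. c < card {w \<in> W'. E u w}) \<and>
        (\<forall>w\<in>W'. c < card {u \<in> A'. E w u})" by (elim exE)
    then show ?thesis by (intro exI[of _ A'] exI[of _ W']) auto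
  next
    case 2
    have W: "card W = Suc (card (W - {w}))" using 2(1) less.prems(2) by (metis card.remove)
    have "c * (card A + card (W - {w})) < edge_count E A (W - {w})"
      using edge_count_remove1[OF less.prems(2) 2(1), of E A] 2(2) less.prems(3) W
        edge_count_flip[OF less.prems(1,2) sym] edge_count_flip[OF less.prems(1) finite_Diff[OF less.prems(2), of "{w}"] sym]
      by (simp add: algebra_simps)
    then have "\<exists>A' W'. A' \<subseteq> A \<and> W' \<subseteq> W - {w} \<and> A' \<noteq> {} \<and> (\<forall>u\<in>A'. c < card {w \<in> W'. E u w}) \<and>
        (\<forall>w\<in>W'. c < card {u \<in> A'. E w u})"
      using W less.prems by (intro less.hyps) auto
    then obtain A' W' where "A' \<subseteq> A \<and> W' \<subseteq> W - {w} \<and> A' \<noteq> {} \<and> (\<forall>u\<in>A'. c < card {w \<in> W'. E u w}) \<and>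
        (\<forall>w\<in>W'. c < card {u \<in> A'. E w u})" by (elim exE)
    then show ?thesis by (intro exI[of _ A'] exI[of _ W']) auto
  next
    case 3
    have "A \<noteq> {}" using less.prems(3) by (auto simp: edge_count_def)
    then show ?thesis using 3 by (intro exI[of _ A] exI[of _ W]) auto
  qed
qed

lemma greedy_petals:
  assumes "finite I" and fin: "finite A" "finite W" and A: "A \<noteq> {}"
    and dA: "\<And>u. u \<in> A \<Longrightarrow> D \<le> card {w \<in> W. E u w}"
    and dW: "\<And>w. w \<in> W \<Longrightarrow> D \<le> card {u \<in> A. E w u}"
    and irr: "\<And>u. \<not> E u u" and v: "\<And>u. u \<in> A \<Longrightarrow> E v u" "v \<notin> W"
    and k: "\<And>i. i \<in> I \<Longrightarrow> 1 \<le> k i" and D: "(\<Sum>i\<in>I. 2 * k i) \<le> D"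
  shows "\<exists>p. petals E v I k p \<and> (\<forall>i\<in>I. set (p i) \<subseteq> A \<union> W)"
  using assms(1) k D
proof (induction I rule: finite_induct)
  case empty
  show ?case by (auto simp: petals_def)
next
  case (insert i I)
  then obtain p where p: "petals E v I k p" "\<forall>i\<in>I. set (p i) \<subseteq> A \<union> W" by auto
  define Z where "Z = (\<Union>i\<in>I. set (p i))"
  have Z: "finite Z" using insert(1) by (auto simp: Z_def)
  have "card Z \<le> (\<Sum>i\<in>I. 2 * k i - 1)"
    unfolding Z_def using card_petals_le[OF p(1) insert(1)] .
  also have "\<dots> \<le> (\<Sum>i\<in>I. 2 * k i)" by (intro sum_mono) auto
  finally have D: "card Z + 2 * k i \<le> D" using insert by auto
  have ki: "1 \<le> k i" using insert by auto
  obtain u where "u \<in> A" using A by auto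
  then have "card {w \<in> W. E u w} > 0" using dA[of u] D ki by auto
  then have "W \<noteq> {}" by (metis (no_types, lifting) Collect_empty_eq card.empty empty_iff less_irrefl)
  then obtain w where w: "w \<in> W" by auto
  have "card (A \<inter> Z) \<le> card Z" using Z by (intro card_mono) auto
  also have "\<dots> < D" using D ki by auto
  also have "D \<le> card {u \<in> A. E w u}" using dW w by auto
  also have "\<dots> \<le> card A" using fin by (intro card_mono) auto
  finally obtain u0 where u0: "u0 \<in> A" "u0 \<notin> Z" by (auto elim!: obtain_outside)
  obtain q where q: "is_path E q" "length q = 2 * k i - 1" "hd q = u0" "last q \<in> A" "set q \<subseteq> (A \<union> W) - Z"
    using greedy_path[OF fin Z u0 dA dW irr ki D] by blast
  have "v \<notin> A" using v irr by auto
  then have "petals E v (insert i I) k (p(i := q))"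
    using p q insert u0 v by (intro petals_insert) (auto simp: Z_def)
  moreover have "\<forall>j\<in>insert i I. set ((p(i := q)) j) \<subseteq> A \<union> W" using p(2) q by auto
  ultimately show ?case by blast
qed

text \<open>Inside the dense core all petals can be grown greedily. The constant is wasteful, but
  overlapping sides are allowed; this suffices for lower-order terms.\<close>

lemma edge_count_le_if_no_flower:
  assumes "finite I" "\<And>i. i \<in> I \<Longrightarrow> 1 \<le> k i" and nf: "\<not> flower E I k" and fin: "finite A" "finite W"
    and sym: "symp E" and irr: "\<And>u. \<not> E u u"
    and v: "\<And>u. u \<in> A \<Longrightarrow> E v u" "v \<notin> W"
  shows "edge_count E A W \<le> (\<Sum>i\<in>I. 2 * k i) * (card A + card W)"
proof (rule ccontr)
  assume "\<not> ?thesis"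
  then have "(\<Sum>i\<in>I. 2 * k i) * (card A + card W) < edge_count E A W" by simp
  from dense_core[OF fin sym this] obtain A' W' where A': "A' \<subseteq> A" "W' \<subseteq> W" "A' \<noteq> {}"
    and d: "\<forall>u\<in>A'. (\<Sum>i\<in>I. 2 * k i) < card {w \<in> W'. E u w}" "\<forall>w\<in>W'. (\<Sum>i\<in>I. 2 * k i) < card {u \<in> A'. E w u}"
    by (elim exE conjE)
  have "\<exists>p. petals E v I k p \<and> (\<forall>i\<in>I. set (p i) \<subseteq> A' \<union> W')"
    using A' d v irr assms(1,2) finite_subset[OF A'(1) fin(1)] finite_subset[OF A'(2) fin(2)]
    by (intro greedy_petals[where D = "\<Sum>i\<in>I. 2 * k i"]) (auto intro: less_imp_le)
  then show False using nf by (auto simp: flower_def)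
qed

lemma edge_count_Diff:
  assumes fin: "finite A" "finite W" "finite Z" and dis: "A \<inter> W = {}" and sym: "symp E"
    and dA: "\<And>u. u \<in> A \<Longrightarrow> card {w \<in> W. E u w} \<le> d"
    and dW: "\<And>w. w \<in> W \<Longrightarrow> card {u \<in> A. E w u} \<le> d"
  shows "edge_count E A W \<le> edge_count E (A - Z) (W - Z) + card Z * d"
  using fin(3)
proof (induction Z rule: finite_induct)
  case empty
  show ?case by simp
next
  case (insert z Z)
  let ?A = "A - Z" and ?W = "W - Z"
  have "edge_count E ?A ?W \<le> edge_count E (A - insert z Z) (W - insert z Z) + d"
  proof -
    consider "z \<in> ?A" | "z \<in> ?W" | "z \<notin> A \<union> W" using insert(2) by auto
    then show ?thesis
    proof cases
      case 1
      have "card {w \<in> ?W. E z w} \<le> card {w \<in> W. E z w}" using fin by (intro card_mono) auto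
      moreover have "W - insert z Z = ?W" "A - insert z Z = ?A - {z}" using 1 dis by auto
      ultimately show ?thesis using edge_count_remove1[of ?A z E ?W] 1 dA[of z] fin by auto
    next
      case 2
      have "card {w \<in> ?A. E z w} \<le> card {w \<in> A. E z w}" using fin by (intro card_mono) auto
      moreover have "A - insert z Z = ?A" "W - insert z Z = ?W - {z}" using 2 dis by auto
      moreover have "edge_count E ?A ?W = edge_count E ?W ?A"
        "edge_count E ?A (?W - {z}) = edge_count E (?W - {z}) ?A"
        using fin sym by (intro edge_count_flip; simp)+
      ultimately show ?thesis using edge_count_remove1[of ?W z E ?A] 2 dW[of z] fin by auto
    next
      case 3
      then have "A - insert z Z = ?A" "W - insert z Z = ?W" by auto
      then show ?thesis by simp
    qed
  qed
  then show ?case using insert by simp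
qed

text \<open>The core has minimum degree at least \<open>K\<close> on both sides, which is what an
  alternating path with \<open>K\<close> vertices in \<open>A\<close> consumes.\<close>

lemma alternating_path_if_dense:
  assumes fin: "finite A" "finite W" and dis: "A \<inter> W = {}" and sym: "symp E"
    and e: "(K - 1) * (card A + card W) < edge_count E A W" and j: "1 \<le> j" "j \<le> K"
  shows "\<exists>p. is_path E p \<and> length p = 2 * j - 1 \<and> hd p \<in> A \<and> last p \<in> A \<and> set p \<subseteq> A \<union> W"
proof -
  from dense_core[OF fin sym e] obtain A' W' where A': "A' \<subseteq> A" "W' \<subseteq> W" "A' \<noteq> {}"
    and d: "\<forall>u\<in>A'. K - 1 < card {w \<in> W'. E u w}" "\<forall>w\<in>W'. K - 1 < card {u \<in> A'. E w u}"
    by (elim exE conjE)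
  obtain u0 where u0: "u0 \<in> A'" using A' by auto
  have "\<exists>p. is_path E p \<and> length p = 2 * j - 1 \<and> hd p = u0 \<and> last p \<in> A' \<and> set p \<subseteq> A' \<union> W' \<and>
    card (set p \<inter> A') = j \<and> card (set p \<inter> W') = j - 1"
  proof (rule alternating_path[where K = K])
    show "finite A'" "finite W'" "A' \<inter> W' = {}" using A' fin dis by (auto intro: finite_subset)
    show "K - 1 \<le> card {w \<in> W'. E u w}" if "u \<in> A'" for u using d(1) that by (auto intro: less_imp_le)
    show "K \<le> card {u \<in> A'. E w u}" if "w \<in> W'" for w using d(2) that by fastforce
  qed (use u0 j in auto)
  then show ?thesis using A' u0 by blast
qed

text \<open>The leading factor \<open>K - 1\<close> depends only on the longest cycle, not on the
  sum of all lengths. Petals already found are deleted, at a cost of at most \<open>d\<close> edges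
  per vertex; this is affordable outside \<open>B\<close>, where degrees are at most
  \<open>\<delta> * n\<close>.\<close>

lemma sharp_petals:
  assumes "finite I" and fin: "finite A" "finite W" and dis: "A \<inter> W = {}" and sym: "symp E"
    and dA: "\<And>u. u \<in> A \<Longrightarrow> card {w \<in> W. E u w} \<le> d"
    and dW: "\<And>w. w \<in> W \<Longrightarrow> card {u \<in> A. E w u} \<le> d"
    and v: "\<And>u. u \<in> A \<Longrightarrow> E v u" "v \<notin> A" "v \<notin> W"
    and k: "\<And>i. i \<in> I \<Longrightarrow> 1 \<le> k i \<and> k i \<le> K"
    and e: "(K - 1) * (card A + card W) + (\<Sum>i\<in>I. 2 * k i - 1) * d < edge_count E A W"
  shows "\<exists>p. petals E v I k p \<and> (\<forall>i\<in>I. set (p i) \<subseteq> A \<union> W)"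
  using assms(1) k e
proof (induction I rule: finite_induct)
  case empty
  show ?case by (auto simp: petals_def)
next
  case (insert i I)
  have 1: "(\<Sum>i\<in>I. 2 * k i - 1) * d \<le> (\<Sum>i\<in>insert i I. 2 * k i - 1) * d"
    using insert(1) by (intro mult_le_mono1 sum_mono2) auto
  have "(K - 1) * (card A + card W) + (\<Sum>i\<in>I. 2 * k i - 1) * d < edge_count E A W"
    using insert.prems(2) 1 by linarith
  moreover have "1 \<le> k j \<and> k j \<le> K" if "j \<in> I" for j using insert.prems(1) that by auto
  ultimately obtain p where p: "petals E v I k p" "\<forall>i\<in>I. set (p i) \<subseteq> A \<union> W" using insert.IH by blast
  define Z where "Z = (\<Union>i\<in>I. set (p i))"
  have Z: "finite Z" using insert(1) by (auto simp: Z_def)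
  have "card Z \<le> (\<Sum>i\<in>I. 2 * k i - 1)"
    unfolding Z_def using card_petals_le[OF p(1) insert(1)] .
  then have "card Z * d \<le> (\<Sum>i\<in>I. 2 * k i - 1) * d" by (rule mult_le_mono1)
  moreover have "card (A - Z) \<le> card A" "card (W - Z) \<le> card W" using fin by (auto intro: card_mono)
  then have "(K - 1) * (card (A - Z) + card (W - Z)) \<le> (K - 1) * (card A + card W)"
    by (intro mult_le_mono2 add_mono)
  ultimately have "(K - 1) * (card (A - Z) + card (W - Z)) < edge_count E (A - Z) (W - Z)"
    using edge_count_Diff[OF fin Z dis sym dA dW] insert.prems(2) 1 by linarith
  moreover have "1 \<le> k i" "k i \<le> K" using insert.prems by auto
  moreover have "finite (A - Z)" "finite (W - Z)" "(A - Z) \<inter> (W - Z) = {}" using fin dis by auto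
  ultimately obtain q where q: "is_path E q" "length q = 2 * k i - 1" "hd q \<in> A - Z" "last q \<in> A - Z"
      "set q \<subseteq> (A - Z) \<union> (W - Z)"
    using alternating_path_if_dense[where A = "A - Z" and W = "W - Z" and j = "k i", OF _ _ _ sym] by blast
  have "petals E v (insert i I) k (p(i := q))"
    using p q insert v by (intro petals_insert) (auto simp: Z_def)
  moreover have "\<forall>j\<in>insert i I. set ((p(i := q)) j) \<subseteq> A \<union> W" using p(2) q by auto
  ultimately show ?case by blast
qed

section \<open>Flowers spanned by hubs and their common neighbours\<close>

lemma complete_petals:
  assumes "finite I" and fin: "finite A" "finite W" and dis: "A \<inter> W = {}"
    and complete: "\<And>a w. a \<in> A \<Longrightarrow> w \<in> W \<Longrightarrow> E a w \<and> E w a"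
    and v: "\<And>u. u \<in> A \<Longrightarrow> E v u" "v \<notin> A" "v \<notin> W"
    and k: "\<And>i. i \<in> I \<Longrightarrow> 1 \<le> k i"
    and c: "(\<Sum>i\<in>I. k i) \<le> card A" "(\<Sum>i\<in>I. k i - 1) \<le> card W"
  shows "\<exists>p. petals E v I k p \<and> (\<forall>i\<in>I. set (p i) \<subseteq> A \<union> W) \<and>
    card ((\<Union>i\<in>I. set (p i)) \<inter> A) = (\<Sum>i\<in>I. k i) \<and>
    card ((\<Union>i\<in>I. set (p i)) \<inter> W) = (\<Sum>i\<in>I. k i - 1)"
  using assms(1) k c
proof (induction I rule: finite_induct)
  case empty
  show ?case by (auto simp: petals_def)
next
  case (insert i I)
  have "(\<Sum>i\<in>I. k i) \<le> card A" "(\<Sum>i\<in>I. k i - 1) \<le> card W" "\<And>j. j \<in> I \<Longrightarrow> 1 \<le> k j"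
    using insert.prems insert.hyps by (auto intro: le_trans[OF sum_mono2[of "insert i I" I]] simp del: sum.insert)
  then obtain p where p: "petals E v I k p" "\<forall>i\<in>I. set (p i) \<subseteq> A \<union> W"
    "card ((\<Union>i\<in>I. set (p i)) \<inter> A) = (\<Sum>i\<in>I. k i)"
    "card ((\<Union>i\<in>I. set (p i)) \<inter> W) = (\<Sum>i\<in>I. k i - 1)" using insert.IH by blast
  define Z where "Z = (\<Union>i\<in>I. set (p i))"
  have Z: "finite Z" using insert(1) by (auto simp: Z_def)
  have cA: "k i \<le> card (A - Z)" using card_Diff_subset_Int[of A Z] p(3) Z insert by (auto simp: Z_def Int_commute)
  have cW: "k i - 1 \<le> card (W - Z)" using card_Diff_subset_Int[of W Z] p(4) Z insert by (auto simp: Z_def Int_commute)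
  have ki: "1 \<le> k i" using insert by auto
  have "A - Z \<noteq> {}" using cA ki by (metis card.empty not_one_le_zero order_trans)
  then obtain u0 where u0: "u0 \<in> A - Z" by auto
  have "\<exists>q. is_path E q \<and> length q = 2 * k i - 1 \<and> hd q = u0 \<and> last q \<in> A - Z \<and> set q \<subseteq> (A - Z) \<union> (W - Z) \<and>
    card (set q \<inter> (A - Z)) = k i \<and> card (set q \<inter> (W - Z)) = k i - 1"
  proof (rule alternating_path[where K = "k i"])
    show "k i - 1 \<le> card {w \<in> W - Z. E u w}" if "u \<in> A - Z" for u
    proof -
      have "{w \<in> W - Z. E u w} = W - Z" using that complete by auto
      then show ?thesis using cW by simp
    qed
    show "k i \<le> card {u \<in> A - Z. E w u}" if "w \<in> W - Z" for w
    proof -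
      have "{u \<in> A - Z. E w u} = A - Z" using that complete by auto
      then show ?thesis using cA by simp
    qed
  qed (use u0 fin dis ki in auto)
  then obtain q where q: "is_path E q" "length q = 2 * k i - 1" "hd q = u0" "last q \<in> A - Z"
    "set q \<subseteq> (A - Z) \<union> (W - Z)" "card (set q \<inter> (A - Z)) = k i" "card (set q \<inter> (W - Z)) = k i - 1"
    by blast
  have "set ((p(i := q)) j) = set (p j)" if "j \<in> I" for j using that insert(2) by auto
  then have U: "(\<Union>j\<in>insert i I. set ((p(i := q)) j)) = set q \<union> Z" by (simp add: Z_def)
  have "(set q \<union> Z) \<inter> A = (set q \<inter> (A - Z)) \<union> (Z \<inter> A)" "(set q \<union> Z) \<inter> W = (set q \<inter> (W - Z)) \<union> (Z \<inter> W)"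
    using q(5) by auto
  moreover have "card ((set q \<inter> (A - Z)) \<union> (Z \<inter> A)) = k i + (\<Sum>i\<in>I. k i)"
    using q(6) p(3) Z by (subst card_Un_disjoint) (auto simp: Z_def)
  moreover have "card ((set q \<inter> (W - Z)) \<union> (Z \<inter> W)) = (k i - 1) + (\<Sum>i\<in>I. k i - 1)"
    using q(7) p(4) Z by (subst card_Un_disjoint) (auto simp: Z_def)
  ultimately have "card ((set q \<union> Z) \<inter> A) = k i + (\<Sum>i\<in>I. k i)" "card ((set q \<union> Z) \<inter> W) = (k i - 1) + (\<Sum>i\<in>I. k i - 1)"
    by simp_all
  moreover have "petals E v (insert i I) k (p(i := q))"
    using p q insert v u0 by (intro petals_insert) (auto simp: Z_def)
  moreover have "\<forall>j\<in>insert i I. set ((p(i := q)) j) \<subseteq> A \<union> W" using p(2) q by auto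
  ultimately show ?case unfolding U[symmetric] using insert(1,2) by (intro exI[of _ "p(i := q)"]) (simp del: fun_upd_apply)
qed

text \<open>One vertex of \<open>R\<close> serves as the centre, and the petals alternate between
  \<open>C\<close> and the rest of \<open>R\<close>, using \<open>k i - 1\<close> vertices of
  \<open>R\<close> each.\<close>

lemma flower_if_common_neighbours:
  assumes "finite I" "\<And>i. i \<in> I \<Longrightarrow> 1 \<le> k i" and fin: "finite R" "finite C" and sym: "symp E" and irr: "\<And>u. \<not> E u u"
    and RC: "\<And>r c. r \<in> R \<Longrightarrow> c \<in> C \<Longrightarrow> E r c"
    and card: "(\<Sum>i\<in>I. k i - 1) < card R" "(\<Sum>i\<in>I. k i) \<le> card C"
  shows "flower E I k"
proof -
  obtain v where v: "v \<in> R" using card by fastforce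
  have dis: "R \<inter> C = {}" using RC irr by blast
  have "\<exists>p. petals E v I k p \<and> (\<forall>i\<in>I. set (p i) \<subseteq> C \<union> (R - {v})) \<and>
    card ((\<Union>i\<in>I. set (p i)) \<inter> C) = (\<Sum>i\<in>I. k i) \<and> card ((\<Union>i\<in>I. set (p i)) \<inter> (R - {v})) = (\<Sum>i\<in>I. k i - 1)"
    using assms(1,2) fin dis v card RC by (intro complete_petals) (auto intro: sympD[OF sym])
  then show ?thesis by (auto simp: flower_def)
qed

text \<open>With only as many hubs as the petals need, and one of them spent on the centre, the
  standard embedding is one hub short. It is enough that the single petal \<open>q\<close> saves one
  by using at most \<open>k s - 2\<close> hubs.\<close>

lemma flower_if_special_petal:
  assumes I: "finite I" "s \<in> I" "\<And>i. i \<in> I \<Longrightarrow> 1 \<le> k i" and fin: "finite R" "finite C" and sym: "symp E"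
    and irr: "\<And>u. \<not> E u u" and RC: "\<And>r c. r \<in> R \<Longrightarrow> c \<in> C \<Longrightarrow> E r c"
    and card: "(\<Sum>i\<in>I. k i - 1) = card R" "(\<Sum>i\<in>I. 2 * k i) \<le> card C"
    and z: "z \<in> R" and q: "is_path E q" "length q = 2 * k s - 1" "set q \<subseteq> (R - {z}) \<union> C" "hd q \<in> C" "last q \<in> C"
      "card (set q \<inter> R) + 2 \<le> k s"
  shows "flower E I k"
proof -
  have dis: "R \<inter> C = {}" using RC irr by blast
  have "(\<Sum>i\<in>I. k i - 1) = (k s - 1) + (\<Sum>i\<in>I - {s}. k i - 1)" using I by (simp add: sum.remove)
  moreover have "card (R - {z} - set q) = card (R - {z}) - card (set q \<inter> R)"
  proof -
    have "(R - {z}) \<inter> set q = set q \<inter> R" using q(3) dis z by auto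
    then show ?thesis using card_Diff_subset_Int[of "R - {z}" "set q"] by simp
  qed
  ultimately have cR: "(\<Sum>i\<in>I - {s}. k i - 1) \<le> card (R - {z} - set q)" using card(1) q(6) z fin by simp
  have "(\<Sum>i\<in>I. 2 * k i) = 2 * k s + (\<Sum>i\<in>I - {s}. 2 * k i)" using I by (simp add: sum.remove)
  moreover have "(\<Sum>i\<in>I - {s}. k i) \<le> (\<Sum>i\<in>I - {s}. 2 * k i)" by (intro sum_mono) auto
  moreover have "card C - card (set q) \<le> card (C - set q)" by (intro diff_card_le_card_Diff) auto
  moreover have "card (set q) \<le> 2 * k s - 1" using q(2) card_length by metis
  ultimately have cC: "(\<Sum>i\<in>I - {s}. k i) \<le> card (C - set q)" using card(2) by linarith
  have "\<exists>p. petals E z (I - {s}) k p \<and> (\<forall>i\<in>I - {s}. set (p i) \<subseteq> (C - set q) \<union> (R - {z} - set q)) \<and>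
    card ((\<Union>i\<in>I - {s}. set (p i)) \<inter> (C - set q)) = (\<Sum>i\<in>I - {s}. k i) \<and>
    card ((\<Union>i\<in>I - {s}. set (p i)) \<inter> (R - {z} - set q)) = (\<Sum>i\<in>I - {s}. k i - 1)"
    using I fin dis z cC cR RC by (intro complete_petals) (auto intro: sympD[OF sym])
  then obtain p where p: "petals E z (I - {s}) k p" "\<forall>i\<in>I - {s}. set (p i) \<subseteq> (C - set q) \<union> (R - {z} - set q)" by blast
  have "petals E z (insert s (I - {s})) k (p(s := q))"
    using p q z RC dis by (intro petals_insert) auto
  then show ?thesis unfolding flower_def using I(2) insert_Diff by metis
qed

text \<open>In the petal \<open>a, b, d, ...\<close>, which alternates from \<open>d\<close> on, the
  vertex \<open>b\<close> takes the place of a hub.\<close>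

lemma flower_if_path3:
  assumes I: "finite I" "s \<in> I" "\<And>i. i \<in> I \<Longrightarrow> 1 \<le> k i" and fin: "finite R" "finite C" and sym: "symp E"
    and irr: "\<And>u. \<not> E u u" and RC: "\<And>r c. r \<in> R \<Longrightarrow> c \<in> C \<Longrightarrow> E r c"
    and card: "(\<Sum>i\<in>I. k i - 1) = card R" "(\<Sum>i\<in>I. 2 * k i) \<le> card C" and ks: "2 \<le> k s"
    and abd: "a \<in> C" "b \<in> C" "d \<in> C" "E a b" "E b d" "a \<noteq> d"
  shows "flower E I k"
proof -
  have dis: "R \<inter> C = {}" using RC irr by blast
  have neq: "a \<noteq> b" "b \<noteq> d" using abd irr by auto
  have R: "k s - 1 \<le> card R" unfolding card(1)[symmetric] using I member_le_sum[of s I "\<lambda>i. k i - 1"] by simp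
  have C: "2 * k s \<le> card C" using I member_le_sum[of s I "\<lambda>i. 2 * k i"] card(2) by simp
  obtain r0 where r0: "r0 \<in> R" using R ks by fastforce
  have cR: "card (R - {r0}) = card R - 1" using r0 fin by simp
  have cC: "k s - 1 \<le> card (C - {a, b})"
    using diff_card_le_card_Diff[of "{a, b}" C] C neq by simp
  have "\<exists>q. is_path E q \<and> length q = 2 * (k s - 1) - 1 \<and> hd q = d \<and> last q \<in> C - {a, b} \<and>
    set q \<subseteq> (C - {a, b}) \<union> (R - {r0}) \<and>
    card (set q \<inter> (C - {a, b})) = k s - 1 \<and> card (set q \<inter> (R - {r0})) = k s - 1 - 1"
  proof (rule alternating_path[where K = "k s - 1"])
    show "k s - 1 - 1 \<le> card {w \<in> R - {r0}. E u w}" if "u \<in> C - {a, b}" for u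
    proof -
      have "{w \<in> R - {r0}. E u w} = R - {r0}" using that RC by (auto intro: sympD[OF sym])
      then show ?thesis using cR R by simp
    qed
    show "k s - 1 \<le> card {u \<in> C - {a, b}. E w u}" if "w \<in> R - {r0}" for w
    proof -
      have "{u \<in> C - {a, b}. E w u} = C - {a, b}" using that RC by auto
      then show ?thesis using cC by simp
    qed
  qed (use fin dis abd neq ks in auto)
  then obtain q where q: "is_path E q" "length q = 2 * (k s - 1) - 1" "hd q = d" "last q \<in> C - {a, b}"
    "set q \<subseteq> (C - {a, b}) \<union> (R - {r0})" "card (set q \<inter> (R - {r0})) = k s - 1 - 1" by blast
  have ne: "q \<noteq> []" using q(2) ks by auto
  have ab: "a \<notin> R" "b \<notin> R" using abd dis by auto
  show ?thesis
  proof (rule flower_if_special_petal[where s = s and z = r0 and q = "a # b # q" and R = R and C = C])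
    show "is_path E (a # b # q)" using q(1,3,5) abd neq ne ab by (auto simp: is_path_def successively_Cons)
    show "length (a # b # q) = 2 * k s - 1" using q(2) ks by auto
    have "set (a # b # q) \<inter> R = set q \<inter> (R - {r0})" using q(5) ab r0 dis by auto
    then show "card (set (a # b # q) \<inter> R) + 2 \<le> k s" using q(6) ks by simp
  qed (use I fin sym irr RC card r0 q abd ne in auto)
qed

text \<open>The petal starts with \<open>a, b, r1, c, d\<close>: five vertices with one hub instead
  of two. It needs at least five vertices, hence \<open>3 \<le> k s\<close>.\<close>

lemma flower_if_two_edges:
  assumes I: "finite I" "s \<in> I" "\<And>i. i \<in> I \<Longrightarrow> 1 \<le> k i" and fin: "finite R" "finite C" and sym: "symp E"
    and irr: "\<And>u. \<not> E u u" and RC: "\<And>r c. r \<in> R \<Longrightarrow> c \<in> C \<Longrightarrow> E r c"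
    and card: "(\<Sum>i\<in>I. k i - 1) = card R" "(\<Sum>i\<in>I. 2 * k i) \<le> card C" and ks: "3 \<le> k s"
    and abcd: "a \<in> C" "b \<in> C" "c \<in> C" "d \<in> C" "E a b" "E c d" "{a, b} \<inter> {c, d} = {}"
  shows "flower E I k"
proof -
  have dis: "R \<inter> C = {}" using RC irr by blast
  have neq: "a \<noteq> b" "c \<noteq> d" "a \<noteq> c" "a \<noteq> d" "b \<noteq> c" "b \<noteq> d" using abcd irr by auto
  have R: "k s - 1 \<le> card R" unfolding card(1)[symmetric] using I member_le_sum[of s I "\<lambda>i. k i - 1"] by simp
  have C: "2 * k s \<le> card C" using I member_le_sum[of s I "\<lambda>i. 2 * k i"] card(2) by simp
  obtain r0 where r0: "r0 \<in> R" using R ks by fastforce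
  have "card (R - {r0}) \<noteq> 0" using r0 fin R ks by simp
  then have "R - {r0} \<noteq> {}" by (metis card.empty)
  then obtain r1 where r1: "r1 \<in> R" "r1 \<noteq> r0" by auto
  have cR: "card (R - {r0, r1}) = card R - 2" using r0 r1 fin by simp
  have cC: "k s - 2 \<le> card (C - {a, b, c})"
    using diff_card_le_card_Diff[of "{a, b, c}" C] C neq by simp
  have "\<exists>q. is_path E q \<and> length q = 2 * (k s - 2) - 1 \<and> hd q = d \<and> last q \<in> C - {a, b, c} \<and>
    set q \<subseteq> (C - {a, b, c}) \<union> (R - {r0, r1}) \<and>
    card (set q \<inter> (C - {a, b, c})) = k s - 2 \<and> card (set q \<inter> (R - {r0, r1})) = k s - 2 - 1"
  proof (rule alternating_path[where K = "k s - 2"])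
    show "k s - 2 - 1 \<le> card {w \<in> R - {r0, r1}. E u w}" if "u \<in> C - {a, b, c}" for u
    proof -
      have "{w \<in> R - {r0, r1}. E u w} = R - {r0, r1}" using that RC by (auto intro: sympD[OF sym])
      then show ?thesis using cR R by simp
    qed
    show "k s - 2 \<le> card {u \<in> C - {a, b, c}. E w u}" if "w \<in> R - {r0, r1}" for w
    proof -
      have "{u \<in> C - {a, b, c}. E w u} = C - {a, b, c}" using that RC by auto
      then show ?thesis using cC by simp
    qed
  qed (use fin dis abcd neq ks in auto)
  then obtain q where q: "is_path E q" "length q = 2 * (k s - 2) - 1" "hd q = d" "last q \<in> C - {a, b, c}"
    "set q \<subseteq> (C - {a, b, c}) \<union> (R - {r0, r1})" "card (set q \<inter> (R - {r0, r1})) = k s - 2 - 1" by blast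
  have ne: "q \<noteq> []" using q(2) ks by auto
  have abc: "a \<notin> R" "b \<notin> R" "c \<notin> R" "r1 \<notin> C" using abcd dis r1 by auto
  have Eb: "E b r1" "E r1 c" using RC r1 abcd by (auto intro: sympD[OF sym])
  show ?thesis
  proof (rule flower_if_special_petal[where s = s and z = r0 and q = "a # b # r1 # c # q" and R = R and C = C])
    show "is_path E (a # b # r1 # c # q)" using q(1,3,5) abcd neq ne abc Eb r1 by (auto simp: is_path_def successively_Cons)
    show "length (a # b # r1 # c # q) = 2 * k s - 1" using q(2) ks by auto
    have "set (a # b # r1 # c # q) \<inter> R = insert r1 (set q \<inter> (R - {r0, r1}))" using q(5) abc r0 r1 dis by auto
    then show "card (set (a # b # r1 # c # q) \<inter> R) + 2 \<le> k s" using q(6) ks by simp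
  qed (use I fin sym irr RC card r0 r1 q abcd ne in auto)
qed

section \<open>Isomorphism, subgraphs and minors\<close>

text \<open>A digraph isomorphism also carries an arc map and new head and tail functions; for pair
  digraphs all of them are induced by the vertex map.\<close>

lemma graph_isoI:
  assumes "pair_wf_digraph G" "inj_on f (pverts G)" "pverts H = f ` pverts G" "parcs H = map_prod f f ` parcs G"
  shows "G \<simeq>\<^sub>g H"
proof -
  interpret pair_wf_digraph G by fact
  let ?h = "\<lparr>iso_verts = f, iso_arcs = map_prod f f, iso_head = snd, iso_tail = fst\<rparr>"
  have "inj_on (map_prod f f) (parcs G)"
    by (rule inj_onI, clarsimp) (metis assms(2) in_arcsD1 in_arcsD2 inj_onD)
  then have "pre_digraph.digraph_isomorphism (with_proj G) ?h"
    using assms unfolding pre_digraph.digraph_isomorphism_def by (auto simp: wf_digraph_wp_iff)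
  moreover have "with_proj H = app_iso ?h (with_proj G)"
    using assms by (auto simp: app_iso_def with_proj_def)
  ultimately show ?thesis unfolding digraph_iso_def by blast
qed

lemma graph_isoE:
  assumes "G \<simeq>\<^sub>g H"
  obtains f where "pair_wf_digraph G" "inj_on f (pverts G)" "pverts H = f ` pverts G" "parcs H = map_prod f f ` parcs G"
proof -
  obtain h where h: "pre_digraph.digraph_isomorphism (with_proj G) h" and H: "with_proj H = app_iso h (with_proj G)"
    using assms unfolding digraph_iso_def by blast
  have eqs: "pverts H = iso_verts h ` pverts G" "parcs H = iso_arcs h ` parcs G" "fst = iso_tail h" "snd = iso_head h"
    using H by (auto simp: app_iso_def with_proj_def)
  have "iso_arcs h a = map_prod (iso_verts h) (iso_verts h) a" if "a \<in> parcs G" for a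
    using h that eqs(3,4)[symmetric] unfolding pre_digraph.digraph_isomorphism_def
    by (cases a) (auto simp: prod_eq_iff)
  then have "parcs H = map_prod (iso_verts h) (iso_verts h) ` parcs G" unfolding eqs(2) by (rule image_cong[OF refl])
  then show thesis using that[of "iso_verts h"] h eqs(1)
    unfolding pre_digraph.digraph_isomorphism_def by (auto simp: wf_digraph_wp_iff)
qed

lemma graph_iso_sym:
  assumes "G \<simeq>\<^sub>g H" shows "H \<simeq>\<^sub>g G"
proof -
  obtain f where wf: "pair_wf_digraph G" and f: "inj_on f (pverts G)" "pverts H = f ` pverts G" "parcs H = map_prod f f ` parcs G"
    using assms by (rule graph_isoE)
  interpret pair_wf_digraph G by fact
  let ?g = "the_inv_into (pverts G) f"
  have g: "?g (f v) = v" if "v \<in> pverts G" for v using the_inv_into_f_f[OF f(1) that] .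
  show ?thesis
  proof (rule graph_isoI)
    show "pair_wf_digraph H"
      by unfold_locales (use f in \<open>auto dest: in_arcsD1 in_arcsD2\<close>)
    show "inj_on ?g (pverts H)" unfolding f(2) by (intro inj_onI) (auto simp: g)
    show "pverts G = ?g ` pverts H" unfolding f(2) by (auto simp: g image_image)
    have "map_prod ?g ?g ` parcs H = (\<lambda>a. a) ` parcs G" unfolding f(3) image_image
      by (rule image_cong, simp, clarsimp) (meson g in_arcsD1 in_arcsD2)
    then show "parcs G = map_prod ?g ?g ` parcs H" by simp
  qed
qed

lemma graph_iso_trans:
  assumes "G \<simeq>\<^sub>g H" "H \<simeq>\<^sub>g K" shows "G \<simeq>\<^sub>g K"
proof -
  obtain f where f: "pair_wf_digraph G" "inj_on f (pverts G)" "pverts H = f ` pverts G" "parcs H = map_prod f f ` parcs G"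
    using assms(1) by (rule graph_isoE)
  obtain g where g: "pair_wf_digraph H" "inj_on g (pverts H)" "pverts K = g ` pverts H" "parcs K = map_prod g g ` parcs H"
    using assms(2) by (rule graph_isoE)
  show ?thesis
  proof (rule graph_isoI[where f = "g \<circ> f"])
    show "inj_on (g \<circ> f) (pverts G)" using f g by (auto intro: comp_inj_on)
  qed (use f g in \<open>auto simp: image_image map_prod_def split_beta\<close>)
qed

lemma contains_subgraph_iff:
  assumes "pair_wf_digraph F" "pair_wf_digraph G"
  shows "contains_subgraph G F \<longleftrightarrow>
    (\<exists>f. inj_on f (pverts F) \<and> f ` pverts F \<subseteq> pverts G \<and> (\<forall>a b. (a, b) \<in> parcs F \<longrightarrow> (f a, f b) \<in> parcs G))"
    (is "?L \<longleftrightarrow> (\<exists>f. ?P f)")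
proof
  assume ?L
  then obtain H where H: "subgraph (with_proj H) (with_proj G)" "H \<simeq>\<^sub>g F" unfolding contains_subgraph_def by blast
  obtain f where f: "inj_on f (pverts F)" "pverts H = f ` pverts F" "parcs H = map_prod f f ` parcs F"
    using graph_iso_sym[OF H(2)] by (rule graph_isoE)
  have "pverts H \<subseteq> pverts G" "parcs H \<subseteq> parcs G" using H(1) by (auto simp: subgraph_def)
  then have "?P f" using f by auto
  then show "\<exists>f. ?P f" by blast
next
  assume "\<exists>f. ?P f"
  then obtain f where f: "?P f" by blast
  interpret F: pair_wf_digraph F by fact
  interpret G: pair_wf_digraph G by fact
  let ?H = "\<lparr>pverts = f ` pverts F, parcs = map_prod f f ` parcs F\<rparr>"
  have "pair_wf_digraph ?H" by unfold_locales (auto dest: F.in_arcsD1 F.in_arcsD2)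
  then have "subgraph (with_proj ?H) (with_proj G)"
    using f assms(2) unfolding subgraph_def by (auto simp: wf_digraph_wp_iff compatible_def)
  moreover have "?H \<simeq>\<^sub>g F" by (rule graph_iso_sym, rule graph_isoI[where f = f]) (use f assms(1) in auto)
  ultimately show ?L unfolding contains_subgraph_def by blast
qed

lemma wf_intersecting_cycles: "pair_wf_digraph (intersecting_cycles t l)"
proof unfold_locales
  fix e assume "e \<in> parcs (intersecting_cycles t l)"
  then obtain i j where e: "i \<in> {1..t}" "j < l i"
      "e = (cycle_vertex i j, cycle_vertex i (Suc j mod l i)) \<or> e = (cycle_vertex i (Suc j mod l i), cycle_vertex i j)"
    unfolding intersecting_cycles_def by auto
  have "cycle_vertex i j' \<in> pverts (intersecting_cycles t l)" if "j' < l i" for j'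
    unfolding intersecting_cycles_def using e(1) that by (simp, intro exI[of _ i] exI[of _ j']) simp
  moreover have "Suc j mod l i < l i" using e(2) by auto
  ultimately show "fst e \<in> pverts (intersecting_cycles t l)" "snd e \<in> pverts (intersecting_cycles t l)"
    using e by auto
qed

lemma sym_intersecting_cycles: "sym (parcs (intersecting_cycles t l))"
  unfolding intersecting_cycles_def by (auto simp: sym_def)

lemma cycle_vertex_0 [simp]: "cycle_vertex i 0 = (0, 0)" and cycle_vertex_pos: "0 < j \<Longrightarrow> cycle_vertex i j = (i, j)"
  by (auto simp: cycle_vertex_def)

lemma contains_if_flower:
  assumes G: "pair_graph G" and fl: "flower (\<lambda>u v. (u, v) \<in> parcs G) {1..t} k"
    and t: "1 \<le> t" and k: "\<And>i. i \<in> {1..t} \<Longrightarrow> 2 \<le> k i"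
  shows "contains_subgraph G (intersecting_cycles t (\<lambda>i. 2 * k i))"
proof -
  interpret pair_graph G by fact
  have sym: "(v, u) \<in> parcs G" if "(u, v) \<in> parcs G" for u v
    using that sym_arcs by (simp add: symmetric_def symD)
  let ?F = "intersecting_cycles t (\<lambda>i. 2 * k i)"
  obtain v p where p: "petals (\<lambda>u v. (u, v) \<in> parcs G) v {1..t} k p" using fl unfolding flower_def by blast
  have pi: "distinct (p i)" "successively (\<lambda>u v. (u, v) \<in> parcs G) (p i)" "length (p i) = 2 * k i - 1"
    "(v, hd (p i)) \<in> parcs G" "(v, last (p i)) \<in> parcs G" "v \<notin> set (p i)" if "i \<in> {1..t}" for i
    using p that unfolding petals_def is_path_def by auto
  have disj: "set (p i) \<inter> set (p j) = {}" if "i \<in> {1..t}" "j \<in> {1..t}" "i \<noteq> j" for i j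
    using p that unfolding petals_def by blast
  \<comment> \<open>Lists are indexed from 0, whereas the vertices of a cycle other than the centre
    start at 1; hence \<open>j - 1\<close>.\<close>
  define f where "f = (\<lambda>(i, j). if j = 0 then v else p i ! (j - 1))"
  have f0: "f (cycle_vertex i 0) = v" for i by (simp add: f_def)
  have fpos: "f (cycle_vertex i j) = p i ! (j - 1)" if "0 < j" for i j using that by (simp add: f_def cycle_vertex_pos)
  have arc: "(f (cycle_vertex i j), f (cycle_vertex i (Suc j mod (2 * k i)))) \<in> parcs G"
    if i: "i \<in> {1..t}" and j: "j < 2 * k i" for i j
  proof -
    have ki: "2 \<le> k i" using k i by auto
    have ne: "p i \<noteq> []" using pi(3)[OF i] ki by auto
    consider "j = 0" | "j = 2 * k i - 1" | "0 < j" "Suc j < 2 * k i" using j by linarith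
    then show ?thesis
    proof cases
      case 1
      then have "Suc j mod (2 * k i) = 1" using ki by auto
      then show ?thesis using 1 f0 fpos[of 1 i] pi(4)[OF i] ne by (simp add: hd_conv_nth)
    next
      case 2
      have "p i ! (j - 1) = last (p i)" using ne 2 pi(3)[OF i] by (simp add: last_conv_nth)
      moreover have "Suc j mod (2 * k i) = 0" "0 < j" using 2 ki by auto
      ultimately show ?thesis using f0 fpos[of j i] sym[OF pi(5)[OF i]] by simp
    next
      case 3
      have "(p i ! (j - 1), p i ! Suc (j - 1)) \<in> parcs G"
        using 3 pi(2,3)[OF i] successively_nth[of "\<lambda>u v. (u, v) \<in> parcs G" "p i" "j - 1"] by simp
      then show ?thesis using 3 fpos[of j i] fpos[of "Suc j" i] by simp
    qed
  qed
  have f_mem: "p i ! (j - 1) \<in> set (p i)" if "i \<in> {1..t}" "0 < j" "j < 2 * k i" for i j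
    using pi(3)[OF that(1)] that by (intro nth_mem) auto
  have "inj_on f (pverts ?F)"
  proof (rule inj_onI)
    fix a b assume a: "a \<in> pverts ?F" and b: "b \<in> pverts ?F" and ab: "f a = f b"
    obtain i j where i: "i \<in> {1..t}" "j < 2 * k i" "a = cycle_vertex i j" using a by (auto simp: intersecting_cycles_def)
    obtain i' j' where i': "i' \<in> {1..t}" "j' < 2 * k i'" "b = cycle_vertex i' j'" using b by (auto simp: intersecting_cycles_def)
    show "a = b"
    proof (cases "j = 0")
      case True
      then have "j' = 0" using ab i i' f0 fpos[of j' i'] f_mem[of i' j'] pi(6)[OF i'(1)] by (cases "j' = 0") auto
      then show ?thesis using True i i' by simp
    next
      case False
      then have j': "j' \<noteq> 0" using ab i i' f0 fpos[of j i] f_mem[of i j] pi(6)[OF i(1)] by (cases "j' = 0") auto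
      have eq: "p i ! (j - 1) = p i' ! (j' - 1)" using ab i i' fpos False j' by simp
      then have "i = i'" using disj[OF i(1) i'(1)] f_mem[of i j] f_mem[of i' j'] i i' False j' by fastforce
      then have "j - 1 = j' - 1" using eq pi(1,3)[OF i(1)] i i' False j' nth_eq_iff_index_eq[of "p i" "j - 1" "j' - 1"] by simp
      then have "j = j'" using False j' by simp
      then show ?thesis using \<open>i = i'\<close> i i' by simp
    qed
  qed
  moreover have "f ` pverts ?F \<subseteq> pverts G"
    using in_arcsD1[OF arc] by (auto simp: intersecting_cycles_def)
  moreover have "(f a, f b) \<in> parcs G" if "(a, b) \<in> parcs ?F" for a b
    using that arc sym[OF arc] by (auto simp: intersecting_cycles_def)
  ultimately show ?thesis
    unfolding contains_subgraph_iff[OF wf_intersecting_cycles pair_wf_digraph] by blast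
qed

section \<open>Near covers and their inheritance by minors\<close>

text \<open>
  The flag \<open>single\<close> selects the variant for \<open>k t \<ge> 3\<close>, where at most one edge may avoid \<open>X\<close>; without it the
  edges avoiding \<open>X\<close> only have to form a matching.
\<close>

definition near_cover :: "bool \<Rightarrow> nat \<Rightarrow> 'a pair_pre_digraph \<Rightarrow> bool" where
  "near_cover single m G \<longleftrightarrow> sym (parcs G) \<and> (\<exists>X. finite X \<and> card X \<le> m \<and>
    (\<forall>u v w. u \<notin> X \<and> v \<notin> X \<and> w \<notin> X \<and> (u, v) \<in> parcs G \<and> (u, w) \<in> parcs G \<longrightarrow> v = w) \<and>
    (single \<longrightarrow> (\<exists>a b. \<forall>u v. u \<notin> X \<and> v \<notin> X \<and> (u, v) \<in> parcs G \<longrightarrow> (u, v) \<in> {(a, b), (b, a)})))"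

lemma near_coverE:
  assumes "near_cover single m G"
  obtains X where "sym (parcs G)" "finite X" "card X \<le> m"
    "\<And>u v w. u \<notin> X \<Longrightarrow> v \<notin> X \<Longrightarrow> w \<notin> X \<Longrightarrow> (u, v) \<in> parcs G \<Longrightarrow> (u, w) \<in> parcs G \<Longrightarrow> v = w"
    "single \<Longrightarrow> \<exists>a b. \<forall>u v. u \<notin> X \<and> v \<notin> X \<and> (u, v) \<in> parcs G \<longrightarrow> (u, v) \<in> {(a, b), (b, a)}"
proof -
  obtain X where "sym (parcs G)" "finite X" "card X \<le> m"
    and match: "\<forall>u v w. u \<notin> X \<and> v \<notin> X \<and> w \<notin> X \<and> (u, v) \<in> parcs G \<and> (u, w) \<in> parcs G \<longrightarrow> v = w"
    and s: "single \<longrightarrow> (\<exists>a b. \<forall>u v. u \<notin> X \<and> v \<notin> X \<and> (u, v) \<in> parcs G \<longrightarrow> (u, v) \<in> {(a, b), (b, a)})"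
    using assms unfolding near_cover_def by (elim conjE exE)
  show thesis
    by (rule that[of X]) (fact, fact, fact, use match in metis, use s in metis)
qed

lemma near_coverI:
  assumes "sym (parcs G)" "finite X" "card X \<le> m"
    "\<And>u v w. u \<notin> X \<Longrightarrow> v \<notin> X \<Longrightarrow> w \<notin> X \<Longrightarrow> (u, v) \<in> parcs G \<Longrightarrow> (u, w) \<in> parcs G \<Longrightarrow> v = w"
    "single \<Longrightarrow> \<exists>a b. \<forall>u v. u \<notin> X \<and> v \<notin> X \<and> (u, v) \<in> parcs G \<longrightarrow> (u, v) \<in> {(a, b), (b, a)}"
  shows "near_cover single m G"
  unfolding near_cover_def
  by (intro conjI exI[of _ X] allI impI, fact, fact, fact, elim conjE, rule assms(4), assumption+, rule assms(5))

lemma near_cover_subgraph: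
  assumes "near_cover single m G" "sym (parcs G')" "parcs G' \<subseteq> parcs G"
  shows "near_cover single m G'"
proof -
  obtain X where X: "finite X" "card X \<le> m"
    and match: "\<And>u v w. u \<notin> X \<Longrightarrow> v \<notin> X \<Longrightarrow> w \<notin> X \<Longrightarrow> (u, v) \<in> parcs G \<Longrightarrow> (u, w) \<in> parcs G \<Longrightarrow> v = w"
    and single: "single \<Longrightarrow> \<exists>a b. \<forall>u v. u \<notin> X \<and> v \<notin> X \<and> (u, v) \<in> parcs G \<longrightarrow> (u, v) \<in> {(a, b), (b, a)}"
    using near_coverE[OF assms(1)] by metis
  have "\<exists>a b. \<forall>u v. u \<notin> X \<and> v \<notin> X \<and> (u, v) \<in> parcs G' \<longrightarrow> (u, v) \<in> {(a, b), (b, a)}" if o: single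
    using single[OF o] assms(3) by (meson subsetD)
  moreover have "v = w" if "u \<notin> X" "v \<notin> X" "w \<notin> X" "(u, v) \<in> parcs G'" "(u, w) \<in> parcs G'" for u v w
    using match that assms(3) by (meson subsetD)
  ultimately show ?thesis using near_coverI[OF assms(2) X] by metis
qed

text \<open>Only contraction can create edges. With the image of \<open>X\<close> as new cover, an
  edge avoiding it was present before: if it came from an edge at \<open>v\<close>, then
  \<open>u\<close> and \<open>v\<close> are outside \<open>X\<close>, and \<open>v\<close> had two
  neighbours outside \<open>X\<close>.\<close>

lemma near_cover_minor_step:
  assumes "minor_step G G'" "near_cover single m G"
  shows "near_cover single m G'"
  using assms
proof (cases rule: minor_step.cases)
  case (1 v)
  have "sym (parcs G')" "parcs G' \<subseteq> parcs G"
    using assms(2) 1 by (auto simp: near_cover_def delete_vertex_def sym_def)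
  then show ?thesis by (rule near_cover_subgraph[OF assms(2)])
next
  case (2 u v)
  have "sym (parcs G')" "parcs G' \<subseteq> parcs G"
    using assms(2) 2 by (auto simp: near_cover_def delete_edge_def sym_def)
  then show ?thesis by (rule near_cover_subgraph[OF assms(2)])
next
  case (3 u v)
  define f where "f = (\<lambda>x. if x = v then u else x)"
  have arcs: "parcs G' = {(f x, f y) | x y. (x, y) \<in> parcs G \<and> f x \<noteq> f y}"
    unfolding 3 contract_edge_def f_def by (simp add: Let_def)
  obtain X where sym: "sym (parcs G)" and X: "finite X" "card X \<le> m"
    and match: "\<And>u v w. u \<notin> X \<Longrightarrow> v \<notin> X \<Longrightarrow> w \<notin> X \<Longrightarrow> (u, v) \<in> parcs G \<Longrightarrow> (u, w) \<in> parcs G \<Longrightarrow> v = w"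
    and single: "single \<Longrightarrow> \<exists>a b. \<forall>u v. u \<notin> X \<and> v \<notin> X \<and> (u, v) \<in> parcs G \<longrightarrow> (u, v) \<in> {(a, b), (b, a)}"
    using near_coverE[OF assms(2)] by metis
  have sym': "sym (parcs G')"
  proof (rule symI)
    fix a b assume "(a, b) \<in> parcs G'"
    then obtain x y where "a = f x" "b = f y" "(x, y) \<in> parcs G" "f x \<noteq> f y" unfolding arcs by auto
    then show "(b, a) \<in> parcs G'" unfolding arcs using symD[OF sym, of x y] by (intro CollectI exI[of _ y] exI[of _ x]) simp
  qed
  define X' where "X' = f ` X"
  have X': "finite X'" "card X' \<le> m" using X card_image_le[OF X(1), of f] by (auto simp: X'_def)
  have sub: "(x, y) \<in> parcs G" if xyG: "(x, y) \<in> parcs G'" "x \<notin> X'" "y \<notin> X'" for x y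
  proof -
    obtain x' y' where xy: "x = f x'" "y = f y'" "(x', y') \<in> parcs G" "f x' \<noteq> f y'" using xyG arcs by auto
    have nX: "x' \<notin> X" "y' \<notin> X" using xyG xy by (auto simp: X'_def)
    have uv: "(u, v) \<in> parcs G" "(v, u) \<in> parcs G" using 3 symD[OF sym] by auto
    have *: False if w: "w \<notin> X" "(v, w) \<in> parcs G" "w \<noteq> u" "u \<notin> X'" "v \<notin> X" for w
    proof -
      have "f u = u" by (simp add: f_def)
      then have "u \<notin> X" using that(4) unfolding X'_def by (metis imageI)
      then show False using match[of v w u] w uv by auto
    qed
    have "x' \<noteq> v"
    proof
      assume v: "x' = v"
      then have "x = u" "y' \<noteq> u" using xy by (auto simp: f_def)
      then show False using *[of y'] xy(3) nX xyG(2) v by blast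
    qed
    moreover have "y' \<noteq> v"
    proof
      assume v: "y' = v"
      then have "y = u" "x' \<noteq> u" using xy by (auto simp: f_def)
      then show False using *[of x'] symD[OF sym xy(3)] nX xyG(3) v by blast
    qed
    ultimately show ?thesis using xy by (simp add: f_def)
  qed
  \<comment> \<open>An endpoint of an arc of \<open>G'\<close> lies in the range of \<open>f\<close>
    and is therefore fixed by \<open>f\<close>; lying in \<open>X\<close> would put it into
    \<open>X'\<close>.\<close>
  have XX: "x \<notin> X" if x: "x \<notin> X'" "(x, y) \<in> parcs G'" for x y
  proof
    assume "x \<in> X"
    moreover have "f x = x"
    proof -
      have "f (f a) = f a" for a by (simp add: f_def)
      moreover obtain a where "x = f a" using x(2) unfolding arcs by auto
      ultimately show ?thesis by simp
    qed
    ultimately show False using x(1) unfolding X'_def by (metis imageI)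
  qed
  have "a = b" if "c \<notin> X'" "a \<notin> X'" "b \<notin> X'" "(c, a) \<in> parcs G'" "(c, b) \<in> parcs G'" for a b c
  proof -
    have "c \<notin> X" "a \<notin> X" "b \<notin> X" using that XX symD[OF sym'] by blast+
    then show ?thesis using match sub that by blast
  qed
  moreover have "\<exists>a b. \<forall>u v. u \<notin> X' \<and> v \<notin> X' \<and> (u, v) \<in> parcs G' \<longrightarrow> (u, v) \<in> {(a, b), (b, a)}" if o: single
  proof -
    obtain a b where "\<And>u v. u \<notin> X \<Longrightarrow> v \<notin> X \<Longrightarrow> (u, v) \<in> parcs G \<Longrightarrow> (u, v) \<in> {(a, b), (b, a)}" using single[OF o] by blast
    moreover have "u \<notin> X" "v \<notin> X" if "u \<notin> X'" "v \<notin> X'" "(u, v) \<in> parcs G'" for u v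
      using that XX symD[OF sym'] by blast+
    ultimately have "(u, v) \<in> {(a, b), (b, a)}" if "u \<notin> X'" "v \<notin> X'" "(u, v) \<in> parcs G'" for u v
      using sub that by metis
    then show ?thesis by metis
  qed
  ultimately show ?thesis using near_coverI[OF sym' X'] by metis
qed

lemma near_cover_iso:
  assumes "G \<simeq>\<^sub>g H" "near_cover single m G"
  shows "near_cover single m H"
proof -
  obtain f where wf: "pair_wf_digraph G" and f: "inj_on f (pverts G)" "pverts H = f ` pverts G" "parcs H = map_prod f f ` parcs G"
    using assms(1) by (rule graph_isoE)
  interpret pair_wf_digraph G by fact
  obtain X where sym: "sym (parcs G)" and X: "finite X" "card X \<le> m"
    and match: "\<And>u v w. u \<notin> X \<Longrightarrow> v \<notin> X \<Longrightarrow> w \<notin> X \<Longrightarrow> (u, v) \<in> parcs G \<Longrightarrow> (u, w) \<in> parcs G \<Longrightarrow> v = w"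
    and single: "single \<Longrightarrow> \<exists>a b. \<forall>u v. u \<notin> X \<and> v \<notin> X \<and> (u, v) \<in> parcs G \<longrightarrow> (u, v) \<in> {(a, b), (b, a)}"
    using near_coverE[OF assms(2)] by metis
  have X': "finite (f ` X)" "card (f ` X) \<le> m" using X card_image_le[OF X(1), of f] by auto
  have arcE: "\<exists>a b. u = f a \<and> v = f b \<and> (a, b) \<in> parcs G \<and> a \<in> pverts G \<and> b \<in> pverts G \<and> (u \<notin> f ` X \<longrightarrow> a \<notin> X) \<and> (v \<notin> f ` X \<longrightarrow> b \<notin> X)"
    if "(u, v) \<in> parcs H" for u v using that f(3) by (auto dest: in_arcsD1 in_arcsD2)
  have symH: "sym (parcs H)" using symD[OF sym] f(3) by (auto simp: sym_def)
  have "v = w" if uvw: "u \<notin> f ` X" "v \<notin> f ` X" "w \<notin> f ` X" "(u, v) \<in> parcs H" "(u, w) \<in> parcs H" for u v w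
  proof -
    obtain a b where ab: "u = f a" "v = f b" "(a, b) \<in> parcs G" "a \<in> pverts G" "a \<notin> X" "b \<notin> X" using arcE[OF uvw(4)] uvw by auto
    obtain a' c where ac: "u = f a'" "w = f c" "(a', c) \<in> parcs G" "a' \<in> pverts G" "c \<notin> X" using arcE[OF uvw(5)] uvw by auto
    have "a' = a" using ab ac f(1) by (auto dest: inj_onD)
    then show ?thesis using match[of a b c] ab ac by auto
  qed
  moreover have "\<exists>a b. \<forall>u v. u \<notin> f ` X \<and> v \<notin> f ` X \<and> (u, v) \<in> parcs H \<longrightarrow> (u, v) \<in> {(a, b), (b, a)}" if o: single
  proof -
    obtain a b where ab: "\<And>u v. u \<notin> X \<Longrightarrow> v \<notin> X \<Longrightarrow> (u, v) \<in> parcs G \<Longrightarrow> (u, v) \<in> {(a, b), (b, a)}" using single[OF o] by blast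
    have "(u, v) \<in> {(f a, f b), (f b, f a)}" if uv: "u \<notin> f ` X" "v \<notin> f ` X" "(u, v) \<in> parcs H" for u v
    proof -
      obtain x y where "u = f x" "v = f y" "(x, y) \<in> parcs G" "x \<notin> X" "y \<notin> X" using arcE[OF uv(3)] uv by auto
      then show ?thesis using ab[of x y] by auto
    qed
    then show ?thesis by blast
  qed
  ultimately show ?thesis using near_coverI[OF symH X'] by metis
qed

lemma near_cover_minor:
  assumes "minor_step\<^sup>*\<^sup>* G G'" "near_cover single m G"
  shows "near_cover single m G'"
  using assms by (induction rule: rtranclp_induct) (auto intro: near_cover_minor_step)

lemma minor_free_if_near_cover:
  assumes "near_cover single m G" "\<not> near_cover single m F"
  shows "minor_free G F"
  unfolding minor_free_def
proof (intro notI, elim exE conjE)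
  fix G' assume "minor_step\<^sup>*\<^sup>* G G'" "G' \<simeq>\<^sub>g F"
  then have "near_cover single m F" by (intro near_cover_iso[OF _ near_cover_minor[OF _ assms(1)]])
  then show False using assms(2) by simp
qed

lemma minor_of_subgraph:
  assumes "finite (pverts G)" "finite (parcs G)" "pair_wf_digraph H" "sym (parcs H)"
    "pverts H \<subseteq> pverts G" "parcs H \<subseteq> parcs G"
  shows "minor_step\<^sup>*\<^sup>* G H"
  using assms
proof (induction "card (pverts G - pverts H) + card (parcs G - parcs H)" arbitrary: G rule: less_induct)
  case less
  interpret H: pair_wf_digraph H by fact
  consider (1) v where "v \<in> pverts G" "v \<notin> pverts H" | (2) u v where "(u, v) \<in> parcs G" "(u, v) \<notin> parcs H"
    | (3) "pverts G = pverts H" "parcs G = parcs H" using less.prems(5,6) by (metis subsetI subset_antisym subrelI)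
  then show ?case
  proof cases
    case 1
    let ?G = "delete_vertex G v"
    have G: "pverts ?G = pverts G - {v}" "parcs ?G \<subseteq> parcs G" by (auto simp: delete_vertex_def)
    have "pverts ?G - pverts H = (pverts G - pverts H) - {v}" using G by auto
    moreover have "card ((pverts G - pverts H) - {v}) < card (pverts G - pverts H)"
      using 1 less.prems(1) by (intro card_Diff1_less) auto
    ultimately have "card (pverts ?G - pverts H) < card (pverts G - pverts H)" by simp
    moreover have "card (parcs ?G - parcs H) \<le> card (parcs G - parcs H)"
      using G less.prems by (intro card_mono) auto
    moreover have "parcs H \<subseteq> parcs ?G" using less.prems 1 by (auto simp: delete_vertex_def dest: H.in_arcsD1 H.in_arcsD2)
    ultimately have "minor_step\<^sup>*\<^sup>* ?G H"
      using G(1) less.prems 1 finite_subset[OF G(2) less.prems(2)] by (intro less.hyps) auto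
    moreover have "minor_step G ?G" using 1 by (intro minor_step.intros)
    ultimately show ?thesis by (rule converse_rtranclp_into_rtranclp[rotated])
  next
    case 2
    let ?G = "delete_edge G u v"
    have G: "pverts ?G = pverts G" "parcs ?G = parcs G - {(u, v), (v, u)}" by (auto simp: delete_edge_def)
    have "(v, u) \<notin> parcs H" using 2 less.prems(4) by (auto dest: symD)
    then have s: "parcs H \<subseteq> parcs ?G" using G less.prems 2 by auto
    have "card (parcs ?G - parcs H) < card (parcs G - parcs H)"
      using 2 less.prems(2) G by (intro psubset_card_mono) auto
    then have "minor_step\<^sup>*\<^sup>* ?G H"
      using G less.prems s by (intro less.hyps) auto
    moreover have "minor_step G ?G" using 2 by (intro minor_step.intros)
    ultimately show ?thesis by (rule converse_rtranclp_into_rtranclp[rotated])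
  next
    case 3
    then have "G = H" by simp
    then show ?thesis by simp
  qed
qed

lemma not_contains_if_minor_free:
  assumes G: "pair_graph G" and "sym (parcs F)" "minor_free G F"
  shows "\<not> contains_subgraph G F"
proof
  assume "contains_subgraph G F"
  then obtain H where H: "subgraph (with_proj H) (with_proj G)" "H \<simeq>\<^sub>g F" unfolding contains_subgraph_def by blast
  obtain f where f: "parcs H = map_prod f f ` parcs F" using graph_iso_sym[OF H(2)] by (rule graph_isoE)
  interpret pair_graph G by fact
  have "sym (parcs H)" using f assms(2) by (auto simp: sym_def)
  then have "minor_step\<^sup>*\<^sup>* G H"
    using H(1) pair_finite_verts pair_finite_arcs by (intro minor_of_subgraph) (auto simp: subgraph_def wf_digraph_wp_iff)
  then show False using assms(3) H(2) unfolding minor_free_def by blast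
qed

text \<open>A set that meets \<open>k\<close> disjoint pairs has at least \<open>k\<close> elements.
  Packing both families into \<open>case_sum\<close> states their disjointness as a single
  injectivity.\<close>

lemma unhit_pair:
  assumes "finite X" "card X < k" "inj_on (case_sum c d) ({..<k} <+> {..<(k::nat)})"
  shows "\<exists>j<k. c j \<notin> X \<and> d j \<notin> X"
proof (rule ccontr)
  assume "\<not> ?thesis"
  then have hit: "c j \<in> X \<or> d j \<in> X" if "j < k" for j using that by blast
  define g where "g j = (if c j \<in> X then c j else d j)" for j
  have "inj_on g {..<k}"
  proof (rule inj_onI)
    fix i j assume ij: "i \<in> {..<k}" "j \<in> {..<k}" "g i = g j"
    let ?s = "\<lambda>j. if c j \<in> X then Inl j else Inr j"
    have "case_sum c d (?s i) = case_sum c d (?s j)" using ij(3) by (auto simp: g_def split: if_splits)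
    then have "?s i = ?s j" using ij(1,2) assms(3) by (elim inj_onD) auto
    then show "i = j" by (auto split: if_splits)
  qed
  then have "k \<le> card X" using hit assms(1) by (intro card_inj_on_le[of g "{..<k}" X, simplified]) (auto simp: g_def)
  then show False using assms(2) by simp
qed

lemma inj_on_cycle_vertex:
  assumes "1 \<le> i" shows "inj_on (cycle_vertex i) S"
  using assms by (auto simp: inj_on_def cycle_vertex_def)

text \<open>
  Some cycle of length \<open>2 * k i\<close> meets \<open>X\<close> in fewer than \<open>k i\<close> vertices, so each of its two perfect
  matchings has an edge that avoids \<open>X\<close>.
\<close>

lemma not_near_cover_intersecting_cycles:
  assumes t: "1 \<le> t" and k: "\<And>i. i \<in> {1..t} \<Longrightarrow> 2 \<le> k i" and single: "single \<or> (\<forall>i\<in>{1..t}. k i = 2)"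
  shows "\<not> near_cover single (\<Sum>i = 1..t. k i - 1) (intersecting_cycles t (\<lambda>i. 2 * k i))"
    (is "\<not> near_cover single ?m ?F")
proof
  assume "near_cover single ?m ?F"
  from near_coverE[OF this] obtain X where X: "finite X" "card X \<le> ?m"
    and match: "\<And>u v w. u \<notin> X \<Longrightarrow> v \<notin> X \<Longrightarrow> w \<notin> X \<Longrightarrow> (u, v) \<in> parcs ?F \<Longrightarrow> (u, w) \<in> parcs ?F \<Longrightarrow> v = w"
    and on: "single \<Longrightarrow> \<exists>a b. \<forall>u v. u \<notin> X \<and> v \<notin> X \<and> (u, v) \<in> parcs ?F \<longrightarrow> (u, v) \<in> {(a, b), (b, a)}"
    by metis
  define Y where "Y i = X \<inter> {cycle_vertex i j | j. j < 2 * k i}" for i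
  \<comment> \<open>If every cycle met \<open>X\<close> in \<open>k i\<close> vertices,
    \<open>X\<close> would be too large: with the shared centre in \<open>X\<close> it has
    \<open>k i - 1\<close> further vertices on each cycle and thus \<open>?m + 1\<close> in all,
    otherwise even \<open>k i\<close> on each cycle.\<close>
  have "\<exists>i\<in>{1..t}. card (Y i) < k i"
  proof (rule ccontr)
    assume "\<not> ?thesis"
    then have ge: "k i \<le> card (Y i)" if "i \<in> {1..t}" for i using that by (meson not_le)
    define Z where "Z i = Y i - {(0, 0)}" for i
    have finZ: "finite (Z i)" for i using X by (auto simp: Z_def Y_def)
    have sub: "(\<Union>i\<in>{1..t}. Z i) \<subseteq> X - {(0, 0)}" by (auto simp: Z_def Y_def)
    have "card (\<Union>i\<in>{1..t}. Z i) = (\<Sum>i = 1..t. card (Z i))"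
      using finZ by (intro card_UN_disjoint) (auto simp: Z_def Y_def cycle_vertex_def split: if_splits)
    moreover have "card (\<Union>i\<in>{1..t}. Z i) \<le> card (X - {(0, 0)})" using sub X by (intro card_mono) auto
    ultimately have le: "(\<Sum>i = 1..t. card (Z i)) \<le> card (X - {(0, 0)})" by simp
    show False
    proof (cases "(0, 0) \<in> X")
      case True
      have "k i - 1 \<le> card (Z i)" if "i \<in> {1..t}" for i
      proof -
        have "card (Y i) - 1 \<le> card (Z i)" unfolding Z_def using diff_card_le_card_Diff[of "{(0, 0)}" "Y i"] by simp
        then show ?thesis using ge[OF that] by simp
      qed
      then have "?m \<le> (\<Sum>i = 1..t. card (Z i))" by (intro sum_mono) auto
      moreover have "card (X - {(0, 0)}) = card X - 1" "card X \<noteq> 0" using True X by auto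
      ultimately show False using le X(2) by linarith
    next
      case False
      have "Z i = Y i" "X - {(0, 0)} = X" for i using False by (auto simp: Z_def Y_def)
      then have "(\<Sum>i = 1..t. card (Y i)) \<le> ?m" using le X(2) by simp
      moreover have "(\<Sum>i = 1..t. k i) \<le> (\<Sum>i = 1..t. card (Y i))" using ge by (intro sum_mono) auto
      moreover have "?m < (\<Sum>i = 1..t. k i)"
      proof (rule sum_strict_mono)
        show "k i - 1 < k i" if "i \<in> {1..t}" for i using k[OF that] by simp
      qed (use t in auto)
      ultimately show False by simp
    qed
  qed
  then obtain i where i: "i \<in> {1..t}" "card (Y i) < k i" by blast
  have ki: "2 \<le> k i" using k i by auto
  have finY: "finite (Y i)" using X by (auto simp: Y_def)
  let ?c = "cycle_vertex i"
  have inj: "?c a = ?c b \<longleftrightarrow> a = b" for a b using inj_on_cycle_vertex[of i UNIV] i by (auto dest: inj_onD)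
  have arc: "(?c j, ?c (Suc j mod (2 * k i))) \<in> parcs ?F" "(?c (Suc j mod (2 * k i)), ?c j) \<in> parcs ?F" if "j < 2 * k i" for j
    using that i unfolding intersecting_cycles_def by auto
  have nX: "?c j \<notin> X" if "?c j \<notin> Y i" "j < 2 * k i" for j using that by (auto simp: Y_def)
  have "\<exists>j<k i. ?c (2 * j) \<notin> Y i \<and> ?c (2 * j + 1) \<notin> Y i"
  proof (rule unhit_pair[OF finY i(2)], rule inj_onI)
    fix x y assume "x \<in> {..<k i} <+> {..<k i}" "y \<in> {..<k i} <+> {..<k i}"
      "case_sum (\<lambda>j. ?c (2 * j)) (\<lambda>j. ?c (2 * j + 1)) x = case_sum (\<lambda>j. ?c (2 * j)) (\<lambda>j. ?c (2 * j + 1)) y"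
    then show "x = y" by (cases x; cases y) (simp_all only: inj sum.case, auto, presburger+)
  qed
  then obtain a where a: "a < k i" "?c (2 * a) \<notin> X" "?c (2 * a + 1) \<notin> X" using nX by auto
  \<comment> \<open>\<open>d j\<close> is the successor of \<open>2 * j + 1\<close> on the cycle;
    the last one wraps around to the centre. These edges form the second perfect matching.\<close>
  define d where "d j = (2 * j + 2) mod (2 * k i)" for j
  have m: "d j = (if j = k i - 1 then 0 else 2 * j + 2)" if "j < k i" for j
  proof (cases "j = k i - 1")
    case True
    then have "2 * j + 2 = 2 * k i" using that by simp
    then show ?thesis using True by (simp add: d_def)
  qed (use that in \<open>simp add: d_def\<close>)
  have d_inj: "a = b" if "d a = d b" "a < k i" "b < k i" for a b
    using that(1) unfolding m[OF that(2)] m[OF that(3)] by (auto split: if_splits)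
  have d_even: "2 * a + 1 \<noteq> d b" if "b < k i" for a b
    unfolding m[OF that] by (simp split: if_split) presburger
  have "\<exists>j<k i. ?c (2 * j + 1) \<notin> Y i \<and> ?c (d j) \<notin> Y i"
  proof (rule unhit_pair[OF finY i(2)], rule inj_onI)
    fix x y assume "x \<in> {..<k i} <+> {..<k i}" "y \<in> {..<k i} <+> {..<k i}"
      "case_sum (\<lambda>j. ?c (2 * j + 1)) (\<lambda>j. ?c (d j)) x = case_sum (\<lambda>j. ?c (2 * j + 1)) (\<lambda>j. ?c (d j)) y"
    then show "x = y" using d_inj d_even by (cases x; cases y) (simp_all only: inj sum.case, auto, metis)
  qed
  then obtain b where b: "b < k i" "?c (2 * b + 1) \<notin> X" "?c (d b) \<notin> X"
    using nX ki by (auto simp: d_def)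
  have ea: "(?c (2 * a), ?c (2 * a + 1)) \<in> parcs ?F" "(?c (2 * a + 1), ?c (2 * a)) \<in> parcs ?F" using arc[of "2 * a"] a ki by auto
  have eb: "(?c (2 * b + 1), ?c (d b)) \<in> parcs ?F"
    "(?c (d b), ?c (2 * b + 1)) \<in> parcs ?F" using arc[of "2 * b + 1"] b by (auto simp: d_def)
  have neq: "2 * a \<noteq> d b \<or> a \<noteq> b" using m[OF b(1)] ki by (auto split: if_splits)
  show False
  proof (cases single)
    case True
    then obtain x y where xy: "\<And>u v. u \<notin> X \<Longrightarrow> v \<notin> X \<Longrightarrow> (u, v) \<in> parcs ?F \<Longrightarrow> (u, v) \<in> {(x, y), (y, x)}" using on by blast
    have "{?c (2 * a), ?c (2 * a + 1)} = {?c (2 * b + 1), ?c (d b)}"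
      using xy[OF a(2,3) ea(1)] xy[OF b(2,3) eb(1)] by auto
    then have "2 * a = 2 * b + 1 \<or> 2 * a = d b \<and> 2 * a + 1 = 2 * b + 1"
      unfolding doubleton_eq_iff inj by blast
    then show False using neq by presburger
  next
    case False
    \<comment> \<open>In a 4-cycle two edges from different perfect matchings share a vertex, and
      this vertex violates \<open>match\<close>.\<close>
    then have k2: "k i = 2" using single i by auto
    consider "a = b" | "b = 0" "a = 1" | "b = 1" "a = 0" using a b k2 by linarith
    then show False
    proof cases
      case 1
      have "(?c (2 * a + 1), ?c (d b)) \<in> parcs ?F" unfolding 1 by (rule eb(1))
      then have "?c (2 * a) = ?c (d b)" by (rule match[OF a(3) a(2) b(3) ea(2)])
      then show False using neq 1 unfolding inj by blast
    next
      case 2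
      then have "d b = 2 * a" using k2 by (simp add: d_def)
      then have "?c (2 * a + 1) = ?c (2 * b + 1)" using match[OF a(2) a(3) b(2) ea(1)] eb(2) by metis
      then show False using 2 unfolding inj by simp
    next
      case 3
      then have "d b = 2 * a" using k2 by (simp add: d_def)
      then have "?c (2 * a + 1) = ?c (2 * b + 1)" using match[OF a(2) a(3) b(2) ea(1)] eb(2) by metis
      then show False using 3 unfolding inj by simp
    qed
  qed
qed

section \<open>The Perron vector\<close>

definition simple_rel :: "nat \<Rightarrow> (nat \<Rightarrow> nat \<Rightarrow> bool) \<Rightarrow> bool" where
  "simple_rel n E \<longleftrightarrow> symp E \<and> (\<forall>u. \<not> E u u) \<and> (\<forall>u v. E u v \<longrightarrow> u < n \<and> v < n)"

definition graph_of :: "nat \<Rightarrow> (nat \<Rightarrow> nat \<Rightarrow> bool) \<Rightarrow> nat pair_pre_digraph" where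
  "graph_of n E = \<lparr>pverts = {..<n}, parcs = {(u, v). E u v}\<rparr>"

definition adj_sum :: "nat \<Rightarrow> (nat \<Rightarrow> nat \<Rightarrow> bool) \<Rightarrow> (nat \<Rightarrow> real) \<Rightarrow> nat \<Rightarrow> real" where
  "adj_sum n E x i = (\<Sum>j<n. if E i j then x j else 0)"

definition qform :: "nat \<Rightarrow> (nat \<Rightarrow> nat \<Rightarrow> bool) \<Rightarrow> (nat \<Rightarrow> real) \<Rightarrow> real" where
  "qform n E x = (\<Sum>i<n. x i * adj_sum n E x i)"

definition rho :: "nat \<Rightarrow> (nat \<Rightarrow> nat \<Rightarrow> bool) \<Rightarrow> real" where
  "rho n E = spectral_radius (adjacency_matrix n (graph_of n E))"

lemma graph_of_simps [simp]: "pverts (graph_of n E) = {..<n}" "parcs (graph_of n E) = {(u, v). E u v}"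
  by (simp_all add: graph_of_def)

lemma pair_graph_graph_of:
  assumes "simple_rel n E" shows "pair_graph (graph_of n E)"
proof -
  have E: "E u v \<Longrightarrow> E v u" "\<not> E u u" "E u v \<Longrightarrow> u < n" "E u v \<Longrightarrow> v < n" for u v
    using assms unfolding simple_rel_def by (auto dest: sympD)
  have "parcs (graph_of n E) \<subseteq> {..<n} \<times> {..<n}" using E by auto
  then have "finite (parcs (graph_of n E))" by (rule finite_subset) auto
  then show ?thesis
    by unfold_locales (use E in \<open>auto simp: symmetric_def sym_def\<close>)
qed

lemma graph_of_in_graphs: "simple_rel n E \<Longrightarrow> graph_of n E \<in> graphs n"
  by (auto simp: graphs_def pair_graph_graph_of)

lemma graphsE:
  assumes "G \<in> graphs n"
  obtains E where "simple_rel n E" "G = graph_of n E"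
proof -
  interpret pair_graph G using assms by (simp add: graphs_def)
  have V: "pverts G = {..<n}" using assms by (simp add: graphs_def)
  have "simple_rel n (\<lambda>u v. (u, v) \<in> parcs G)"
    unfolding simple_rel_def using V sym_arcs in_arcsD1 in_arcsD2
    by (auto simp: symmetric_def sym_def symp_def dest: no_loops')
  moreover have "G = graph_of n (\<lambda>u v. (u, v) \<in> parcs G)" using V by (simp add: graph_of_def)
  ultimately show thesis by (rule that)
qed

context
  fixes n :: nat and E :: "nat \<Rightarrow> nat \<Rightarrow> bool"
  assumes E: "simple_rel n E"
begin

lemma simple_rel_sym: "E u v \<Longrightarrow> E v u" and simple_rel_symp: "symp E" and simple_rel_irrefl: "\<not> E u u"
  and simple_rel_less: "E u v \<Longrightarrow> u < n" "E u v \<Longrightarrow> v < n"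
  using E unfolding simple_rel_def by (auto dest: sympD)

lemma adj_sum_eq: "adj_sum n E x i = (\<Sum>j | E i j. x j)"
proof -
  have "{j. E i j} = {j \<in> {..<n}. E i j}" using simple_rel_less by auto
  then show ?thesis unfolding adj_sum_def by (simp only: sum.inter_filter[OF finite_lessThan])
qed

lemma adj_sum_swap: "(\<Sum>i<n. y i * adj_sum n E x i) = (\<Sum>i<n. x i * adj_sum n E y i)"
proof -
  have "(\<Sum>i<n. y i * adj_sum n E x i) = (\<Sum>i<n. \<Sum>j<n. if E i j then y i * x j else 0)"
    unfolding adj_sum_def by (intro sum.cong refl) (auto simp: sum_distrib_left intro!: sum.cong)
  also have "\<dots> = (\<Sum>j<n. \<Sum>i<n. if E i j then y i * x j else 0)" by (rule sum.swap)
  also have "\<dots> = (\<Sum>j<n. x j * adj_sum n E y j)"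
    unfolding adj_sum_def sum_distrib_left using simple_rel_sym by (intro sum.cong refl) auto
  finally show ?thesis .
qed

lemma adj_sum_add: "adj_sum n E (\<lambda>j. x j + y j) i = adj_sum n E x i + adj_sum n E y i"
  unfolding adj_sum_def sum.distrib[symmetric] by (intro sum.cong) auto

lemma qform_shift:
  assumes "v < n"
  shows "qform n E (\<lambda>j. x j + (if j = v then h else 0)) = qform n E x + 2 * h * adj_sum n E x v"
proof -
  let ?d = "\<lambda>j. if j = v then h else (0::real)"
  have d: "adj_sum n E ?d v = 0" unfolding adj_sum_def using simple_rel_irrefl by (intro sum.neutral) auto
  have D: "(\<Sum>i<n. ?d i * f i) = h * f v" for f :: "nat \<Rightarrow> real"
    using assms by (simp add: if_distrib[of "\<lambda>a. a * _"] sum.delta cong: if_cong)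
  have "qform n E (\<lambda>j. x j + ?d j) = (\<Sum>i<n. x i * adj_sum n E x i) + (\<Sum>i<n. x i * adj_sum n E ?d i)
      + (\<Sum>i<n. ?d i * adj_sum n E x i) + (\<Sum>i<n. ?d i * adj_sum n E ?d i)"
    unfolding qform_def adj_sum_add by (simp add: algebra_simps sum.distrib)
  also have "(\<Sum>i<n. x i * adj_sum n E ?d i) = (\<Sum>i<n. ?d i * adj_sum n E x i)" by (rule adj_sum_swap)
  finally show ?thesis unfolding D d by (simp add: qform_def)
qed

lemma qform_abs: "qform n E x \<le> qform n E (\<lambda>i. \<bar>x i\<bar>)"
  unfolding qform_def adj_sum_def sum_distrib_left
proof (intro sum_mono)
  fix i j show "x i * (if E i j then x j else 0) \<le> \<bar>x i\<bar> * (if E i j then \<bar>x j\<bar> else 0)"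
    using abs_ge_self[of "x i * x j"] by (simp add: abs_mult)
qed

lemma qform_cong: "(\<And>i. i < n \<Longrightarrow> x i = y i) \<Longrightarrow> qform n E x = qform n E y"
  unfolding qform_def adj_sum_def by (intro sum.cong arg_cong2[where f = times] refl) auto

lemma qform_scale: "qform n E (\<lambda>i. c * x i) = c\<^sup>2 * qform n E x"
  unfolding qform_def adj_sum_def sum_distrib_left
  by (intro sum.cong refl) (simp add: power2_eq_square)

text \<open>The quadratic form attains its maximum on the unit sphere. Absolute values keep a
  maximiser maximal because the adjacency entries are nonnegative, and stationarity in each
  coordinate is the eigenvalue equation.\<close>

lemma rayleigh_max:
  assumes "0 < n"
  shows "\<exists>x M. (\<forall>i. 0 \<le> x i) \<and> (\<Sum>i<n. (x i)\<^sup>2) = 1 \<and> (\<forall>y. qform n E y \<le> M * (\<Sum>i<n. (y i)\<^sup>2)) \<and>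
    (\<forall>i<n. adj_sum n E x i = M * x i)"
proof -
  \<comment> \<open>Vectors are functions on all of \<open>nat\<close>; forcing the value 0 beyond
    \<open>n\<close> makes the cube compact by Tychonoff's theorem.\<close>
  define S where "S i = (if i < n then {-1..1} else {0::real})" for i
  define K where "K = PiE UNIV S \<inter> {y. (\<Sum>i<n. (y i)\<^sup>2) = 1}"
  have "compactin euclidean (S i)" for i by (auto simp: S_def)
  then have "compactin (product_topology (\<lambda>i. euclidean) UNIV) (PiE UNIV S)" by (simp add: compactin_PiE)
  then have "compact (PiE UNIV S)" by (simp add: euclidean_product_topology)
  moreover have "closed {y :: nat \<Rightarrow> real. (\<Sum>i<n. (y i)\<^sup>2) = 1}"
    by (intro closed_Collect_eq continuous_intros continuous_on_product_coordinates)
  ultimately have K: "compact K" unfolding K_def by (rule compact_Int_closed)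
  have "(\<lambda>i. if i = 0 then 1 else 0) \<in> K"
    using assms by (auto simp: K_def S_def PiE_iff if_distrib[of "\<lambda>a. a\<^sup>2"] sum.delta cong: if_cong)
  then have ne: "K \<noteq> {}" by auto
  have "continuous_on K (qform n E)"
  proof -
    have c: "continuous_on K (\<lambda>y. if E i j then y j else (0::real))" for i j
      by (cases "E i j") (auto intro: continuous_on_subset[OF continuous_on_product_coordinates])
    show ?thesis unfolding qform_def adj_sum_def
      by (intro continuous_intros c continuous_on_subset[OF continuous_on_product_coordinates]) auto
  qed
  then obtain y where y: "y \<in> K" "\<And>y'. y' \<in> K \<Longrightarrow> qform n E y' \<le> qform n E y"
    using continuous_attains_sup[OF K ne] by blast
  define M where "M = qform n E y"
  have R: "qform n E w \<le> M * (\<Sum>i<n. (w i)\<^sup>2)" for w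
  proof (cases "(\<Sum>i<n. (w i)\<^sup>2) = 0")
    case True
    then have "w i = 0" if "i < n" for i using that by (subst (asm) sum_nonneg_eq_0_iff) auto
    then have "qform n E w = 0" by (auto simp: qform_def intro!: sum.neutral)
    then show ?thesis using True by simp
  next
    case False
    define N where "N = (\<Sum>i<n. (w i)\<^sup>2)"
    have N: "N > 0" using False by (auto simp: N_def intro!: order.not_eq_order_implies_strict sum_nonneg)
    define w' where "w' i = (if i < n then w i / sqrt N else 0)" for i
    have s: "(\<Sum>i<n. (w' i)\<^sup>2) = 1"
      using N by (simp add: w'_def power_divide sum_divide_distrib[symmetric] N_def[symmetric])
    have "w' i \<in> S i" for i
    proof (cases "i < n")
      case True
      have "(w' i)\<^sup>2 \<le> (\<Sum>i<n. (w' i)\<^sup>2)" using True by (intro member_le_sum) auto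
      then have "\<bar>w' i\<bar> \<le> 1" using s by (simp add: abs_le_square_iff[of _ 1, simplified])
      then show ?thesis using True by (auto simp: S_def)
    qed (simp add: w'_def S_def)
    then have "w' \<in> K" using s by (auto simp: K_def)
    then have "qform n E w' \<le> M" unfolding M_def by (rule y(2))
    moreover have "qform n E w' = qform n E (\<lambda>i. 1 / sqrt N * w i)" by (rule qform_cong) (simp add: w'_def)
    moreover have "\<dots> = qform n E w / N" unfolding qform_scale using N by (simp add: power_divide)
    ultimately show ?thesis using N by (simp add: N_def[symmetric] pos_divide_le_eq)
  qed
  define x where "x i = \<bar>y i\<bar>" for i
  have x1: "(\<Sum>i<n. (x i)\<^sup>2) = 1" using y(1) by (simp add: x_def K_def)
  have "qform n E x = qform n E (\<lambda>i. \<bar>y i\<bar>)" by (simp add: x_def[abs_def])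
  then have Mx: "qform n E x = M" using R[of x] qform_abs[of y] x1 by (simp add: M_def)
  have "adj_sum n E x v = M * x v" if v: "v < n" for v
  proof -
    define c where "c = adj_sum n E x v - M * x v"
    have *: "2 * h * c \<le> M * h\<^sup>2" for h
    proof -
      let ?w = "\<lambda>j. x j + (if j = v then h else 0)"
      have "(\<Sum>i<n. (?w i)\<^sup>2) = (\<Sum>i<n. (x i)\<^sup>2 + (if i = v then 2 * h * x i + h\<^sup>2 else 0))"
        by (intro sum.cong) (auto simp: power2_sum)
      also have "\<dots> = 1 + (2 * h * x v + h\<^sup>2)" using x1 v by (simp add: sum.distrib sum.delta)
      finally have "M + 2 * h * adj_sum n E x v \<le> M * (1 + (2 * h * x v + h\<^sup>2))"
        using R[of ?w] qform_shift[OF v, of x h] Mx by simp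
      then show ?thesis by (simp add: c_def algebra_simps)
    qed
    \<comment> \<open>Inequality \<open>*\<close> holds for every \<open>h\<close>. For this small
      multiple of \<open>c\<close> the linear term would win against the quadratic one unless
      \<open>c = 0\<close>.\<close>
    define h where "h = c / (\<bar>M\<bar> + 1)"
    have "2 * (c * c) / (\<bar>M\<bar> + 1) \<le> M * h\<^sup>2" using *[of h] by (simp add: h_def)
    also have "\<dots> \<le> (\<bar>M\<bar> + 1) * h\<^sup>2" by (intro mult_right_mono) auto
    also have "\<dots> = c * c / (\<bar>M\<bar> + 1)" by (simp add: h_def power2_eq_square)
    finally have "2 * (c * c) \<le> c * c" by (simp add: divide_le_cancel)
    then have "c * c \<le> 0" by simp
    then have "c = 0" by (auto simp: mult_le_0_iff)
    then show ?thesis by (simp add: c_def)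
  qed
  then show ?thesis using R x1 by (intro exI[of _ x] exI[of _ M]) (auto simp: x_def)
qed

lemma adjacency_mult:
  assumes "dim_vec v = n" "i < n"
  shows "(adjacency_matrix n (graph_of n E) *\<^sub>v v) $ i = (\<Sum>j<n. if E i j then v $ j else 0)"
  using assms by (simp add: adjacency_matrix_def scalar_prod_def if_distrib[of "\<lambda>a. a * _"] lessThan_atLeast0 cong: if_cong)

text \<open>\<open>M\<close> is an eigenvalue, which gives one inequality. For the other, take an
  eigenvector for an eigenvalue of largest modulus: the vector of the moduli of its entries has
  Rayleigh quotient at least \<open>rho n E\<close>.\<close>

lemma rayleigh_max_eq_rho:
  assumes n: "0 < n" and x: "(\<Sum>i<n. (x i)\<^sup>2) = 1" and R: "\<And>y. qform n E y \<le> M * (\<Sum>i<n. (y i)\<^sup>2)"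
    and ev: "\<And>i. i < n \<Longrightarrow> adj_sum n E x i = M * x i"
  shows "M = rho n E"
proof (rule antisym)
  let ?A = "adjacency_matrix n (graph_of n E)"
  have A: "?A \<in> carrier_mat n n" by (simp add: adjacency_matrix_def)
  define v where "v = vec n (\<lambda>i. complex_of_real (x i))"
  have "?A *\<^sub>v v = complex_of_real M \<cdot>\<^sub>v v"
  proof (rule eq_vecI)
    fix i assume "i < dim_vec (complex_of_real M \<cdot>\<^sub>v v)"
    then have i: "i < n" by (simp add: v_def)
    have "(?A *\<^sub>v v) $ i = (\<Sum>j<n. if E i j then v $ j else 0)" using i by (intro adjacency_mult) (simp_all add: v_def)
    also have "\<dots> = (\<Sum>j<n. complex_of_real (if E i j then x j else 0))" by (intro sum.cong) (auto simp: v_def)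
    also have "\<dots> = complex_of_real (adj_sum n E x i)" by (simp add: adj_sum_def)
    finally show "(?A *\<^sub>v v) $ i = (complex_of_real M \<cdot>\<^sub>v v) $ i" using i ev by (simp add: v_def)
  qed (simp add: adjacency_matrix_def v_def)
  moreover have "v \<noteq> 0\<^sub>v n"
  proof
    assume v0: "v = 0\<^sub>v n"
    have "x i = 0" if "i < n" for i using arg_cong[OF v0, of "\<lambda>v. v $ i"] that by (simp add: v_def)
    then show False using x by simp
  qed
  ultimately have "eigenvalue ?A (complex_of_real M)"
    unfolding eigenvalue_def eigenvector_def using A by (intro exI[of _ v]) (auto simp: v_def)
  then have "\<bar>M\<bar> \<in> norm ` spectrum ?A" by (auto simp: spectrum_def image_iff intro!: exI[of _ "complex_of_real M"])
  then have "\<bar>M\<bar> \<le> rho n E" unfolding rho_def by (rule spectral_radius_mem_max(2)[OF A n])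
  then show "M \<le> rho n E" by simp
  obtain \<mu> where \<mu>: "eigenvalue ?A \<mu>" "rho n E = cmod \<mu>"
    using spectral_radius_mem_max(1)[OF A n] unfolding rho_def spectrum_def by auto
  obtain w where w: "dim_vec w = n" "w \<noteq> 0\<^sub>v n" "?A *\<^sub>v w = \<mu> \<cdot>\<^sub>v w"
    using \<mu>(1) A unfolding eigenvalue_def eigenvector_def by (auto dest: carrier_vecD)
  define y where "y i = cmod (w $ i)" for i
  have "rho n E * y i \<le> adj_sum n E y i" if "i < n" for i
  proof -
    have "rho n E * y i = cmod ((\<mu> \<cdot>\<^sub>v w) $ i)" using that w(1) \<mu>(2) by (simp add: y_def norm_mult)
    also have "\<dots> = cmod (\<Sum>j<n. if E i j then w $ j else 0)" unfolding w(3)[symmetric] using that w(1) by (simp add: adjacency_mult)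
    also have "\<dots> \<le> (\<Sum>j<n. cmod (if E i j then w $ j else 0))" by (rule norm_sum)
    also have "\<dots> = adj_sum n E y i" unfolding adj_sum_def y_def by (intro sum.cong) auto
    finally show ?thesis .
  qed
  then have "(\<Sum>i<n. y i * (rho n E * y i)) \<le> qform n E y" unfolding qform_def
    by (intro sum_mono mult_left_mono) (auto simp: y_def)
  then have "rho n E * (\<Sum>i<n. (y i)\<^sup>2) \<le> M * (\<Sum>i<n. (y i)\<^sup>2)"
    using R[of y] by (simp add: sum_distrib_left power2_eq_square algebra_simps)
  moreover have "(\<Sum>i<n. (y i)\<^sup>2) > 0"
  proof -
    obtain i where i: "i < n" "w $ i \<noteq> 0" using w(1,2) by (metis eq_vecI index_zero_vec(1) index_zero_vec(2))
    then have "0 < (y i)\<^sup>2" by (simp add: y_def)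
    also have "\<dots> \<le> (\<Sum>i<n. (y i)\<^sup>2)" using i by (intro member_le_sum) auto
    finally show ?thesis .
  qed
  ultimately show "rho n E \<le> M" by simp
qed

lemma rayleigh:
  assumes "0 < n"
  shows "qform n E y \<le> rho n E * (\<Sum>i<n. (y i)\<^sup>2)"
proof -
  obtain x M where x: "(\<Sum>i<n. (x i)\<^sup>2) = 1" "\<And>y. qform n E y \<le> M * (\<Sum>i<n. (y i)\<^sup>2)"
    "\<And>i. i < n \<Longrightarrow> adj_sum n E x i = M * x i" using rayleigh_max[OF assms] by blast
  have "M = rho n E" using rayleigh_max_eq_rho[OF assms x] .
  then show ?thesis using x(2) by simp
qed

lemma perron:
  assumes "0 < n"
  shows "\<exists>x. (\<forall>i. 0 \<le> x i) \<and> (\<forall>i<n. x i \<le> 1) \<and> (\<exists>z<n. x z = 1) \<and>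
    (\<forall>i<n. (\<Sum>j | E i j. x j) = rho n E * x i)"
proof -
  obtain x M where x: "\<And>i. 0 \<le> x i" "(\<Sum>i<n. (x i)\<^sup>2) = 1" "\<And>y. qform n E y \<le> M * (\<Sum>i<n. (y i)\<^sup>2)"
    "\<And>i. i < n \<Longrightarrow> adj_sum n E x i = M * x i" using rayleigh_max[OF assms] by blast
  have M: "M = rho n E" using rayleigh_max_eq_rho[OF assms x(2-)] .
  define m where "m = Max (x ` {..<n})"
  have "m \<in> x ` {..<n}" unfolding m_def using assms by (intro Max_in) auto
  then obtain z where z: "z < n" "x z = m" by auto
  have le: "x i \<le> m" if "i < n" for i unfolding m_def using that by (intro Max_ge) auto
  have "m \<noteq> 0"
  proof
    assume "m = 0"
    then have "x i = 0" if "i < n" for i using le[OF that] x(1)[of i] by simp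
    then show False using x(2) by simp
  qed
  then have m: "m > 0" using x(1)[of z] z by simp
  have "(\<Sum>j | E i j. x j / m) = rho n E * (x i / m)" if "i < n" for i
    using x(4)[OF that] M by (simp add: adj_sum_eq sum_divide_distrib[symmetric])
  then show ?thesis using x(1) le m z by (intro exI[of _ "\<lambda>i. x i / m"]) auto
qed

lemma rho_nonneg:
  assumes "0 < n" shows "0 \<le> rho n E"
proof -
  obtain x z where x: "\<forall>i. 0 \<le> x i" "z < n" "x z = 1" "\<forall>i<n. (\<Sum>j | E i j. x j) = rho n E * x i"
    using perron[OF assms] by blast
  then have "rho n E = (\<Sum>j | E z j. x j)" by simp
  then show ?thesis using x(1) by (simp add: sum_nonneg)
qed

text \<open>Raising the entry at \<open>v\<close> from 0 to \<open>h\<close> gains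
  \<open>2 * h * a\<close> in the form, with \<open>a\<close> the neighbour sum at \<open>v\<close>,
  but costs only \<open>c * h\<^sup>2\<close> on the other side. The choice
  \<open>h = a / (c + 1)\<close> makes the gain larger.\<close>

lemma rho_gt_if_new_vertex:
  assumes "0 < n" "0 \<le> c" "v < n" "x v = 0" "0 < adj_sum n E x v" "c * (\<Sum>i<n. (x i)\<^sup>2) \<le> qform n E x"
  shows "c < rho n E"
proof -
  define a where "a = adj_sum n E x v"
  define h where "h = a / (c + 1)"
  have h: "h > 0" using assms by (simp add: h_def a_def)
  let ?w = "\<lambda>j. x j + (if j = v then h else 0)"
  have "(\<Sum>i<n. (?w i)\<^sup>2) = (\<Sum>i<n. (x i)\<^sup>2 + (if i = v then h\<^sup>2 else 0))"
    using assms(4) by (intro sum.cong) auto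
  also have "\<dots> = (\<Sum>i<n. (x i)\<^sup>2) + h\<^sup>2" using assms(3) by (simp add: sum.distrib sum.delta)
  finally have s: "(\<Sum>i<n. (?w i)\<^sup>2) = (\<Sum>i<n. (x i)\<^sup>2) + h\<^sup>2" .
  have "c * (\<Sum>i<n. (?w i)\<^sup>2) = c * (\<Sum>i<n. (x i)\<^sup>2) + h * (c * h)" unfolding s by (simp add: algebra_simps power2_eq_square)
  also have "\<dots> < qform n E x + h * (2 * a)"
  proof -
    have "0 < a * c + a * 2" using assms by (intro add_nonneg_pos) (auto simp: a_def)
    then have "c * h < 2 * a" using assms by (simp add: h_def field_simps)
    then have "h * (c * h) < h * (2 * a)" using h by simp
    then show ?thesis using assms(6) by simp
  qed
  also have "\<dots> = qform n E ?w" using qform_shift[OF assms(3), of x h] by (simp add: a_def)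
  also have "\<dots> \<le> rho n E * (\<Sum>i<n. (?w i)\<^sup>2)" by (rule rayleigh[OF assms(1)])
  finally show ?thesis
    by (rule mult_right_less_imp_less) (auto intro: sum_nonneg)
qed

end

section \<open>Extremal graphs\<close>

text \<open>Rewiring the edges at one vertex affects only the terms that contain \<open>x v\<close>;
  this is the tool for all local switchings.\<close>

lemma qform_diff_at:
  assumes E: "simple_rel n E" "simple_rel n E'" and v: "v < n"
    and off: "\<And>u w. u \<noteq> v \<Longrightarrow> w \<noteq> v \<Longrightarrow> E u w \<longleftrightarrow> E' u w"
  shows "qform n E' x - qform n E x = 2 * x v * (adj_sum n E' x v - adj_sum n E x v)"
proof -
  define y where "y j = (if j = v then 0 else x j)" for j
  have xy: "x = (\<lambda>j. y j + (if j = v then x v else 0))" by (auto simp: y_def)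
  have adj: "adj_sum n D y v = adj_sum n D x v" if "simple_rel n D" for D
    unfolding adj_sum_def using simple_rel_irrefl[OF that] by (intro sum.cong) (auto simp: y_def)
  have "y i * adj_sum n E y i = y i * adj_sum n E' y i" for i
  proof (cases "i = v")
    case False
    then have "adj_sum n E y i = adj_sum n E' y i" unfolding adj_sum_def using off by (intro sum.cong) (auto simp: y_def)
    then show ?thesis by simp
  qed (simp add: y_def)
  then have "qform n E y = qform n E' y" unfolding qform_def by (intro sum.cong) auto
  moreover have "qform n E x = qform n E y + 2 * x v * adj_sum n E x v"
    using qform_shift[OF E(1) v, of y "x v"] adj[OF E(1)] xy by simp
  moreover have "qform n E' x = qform n E' y + 2 * x v * adj_sum n E' x v"
    using qform_shift[OF E(2) v, of y "x v"] adj[OF E(2)] xy by simp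
  ultimately show ?thesis by (simp add: algebra_simps)
qed

lemma qform_eigen:
  assumes "simple_rel n E" "\<And>i. i < n \<Longrightarrow> (\<Sum>j | E i j. x j) = c * x i"
  shows "qform n E x = c * (\<Sum>i<n. (x i)\<^sup>2)"
  unfolding qform_def sum_distrib_left
  by (intro sum.cong refl) (use assms in \<open>simp add: adj_sum_eq power2_eq_square\<close>)

locale intersecting_even_cycles =
  fixes t :: nat and k :: "nat \<Rightarrow> nat" and \<kappa> :: nat
  assumes t: "1 \<le> t" and k: "i \<in> {1..t} \<Longrightarrow> 2 \<le> k i" and \<kappa>: "\<kappa> = (\<Sum>i = 1..t. k i - 1)"
begin

abbreviation F :: "(nat \<times> nat) pair_pre_digraph" where "F \<equiv> intersecting_cycles t (\<lambda>i. 2 * k i)"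

text \<open>An upper bound for the number of vertices of \<open>F\<close>: the centre is counted
  once per cycle.\<close>

definition order_F :: nat where "order_F = (\<Sum>i = 1..t. 2 * k i)"

abbreviation free :: "nat \<Rightarrow> (nat \<Rightarrow> nat \<Rightarrow> bool) \<Rightarrow> bool" where
  "free n E \<equiv> \<not> contains_subgraph (graph_of n E) F"

lemma \<kappa>_pos: "1 \<le> \<kappa>"
proof -
  have "k 1 - 1 \<le> \<kappa>" unfolding \<kappa> using t member_le_sum[of 1 "{1..t}" "\<lambda>i. k i - 1"] by simp
  then show ?thesis using k[of 1] t by simp
qed

lemma contains_iff:
  assumes "simple_rel n E"
  shows "contains_subgraph (graph_of n E) F \<longleftrightarrow>
    (\<exists>f. inj_on f (pverts F) \<and> f ` pverts F \<subseteq> {..<n} \<and> (\<forall>a b. (a, b) \<in> parcs F \<longrightarrow> E (f a) (f b)))"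
proof -
  interpret pair_graph "graph_of n E" by (rule pair_graph_graph_of[OF assms])
  show ?thesis using contains_subgraph_iff[OF wf_intersecting_cycles pair_wf_digraph] by simp
qed

lemma no_flower_if_free:
  assumes "simple_rel n E" "free n E"
  shows "\<not> flower E {1..t} k"
  using contains_if_flower[OF pair_graph_graph_of[OF assms(1)] _ t k] assms(2) by auto

lemma finite_F: "finite (pverts F)" "card (pverts F) \<le> order_F"
proof -
  have sub: "pverts F \<subseteq> (\<Union>i\<in>{1..t}. cycle_vertex i ` {..<2 * k i})" by (auto simp: intersecting_cycles_def)
  then show "finite (pverts F)" by (rule finite_subset) auto
  have "card (pverts F) \<le> card (\<Union>i\<in>{1..t}. cycle_vertex i ` {..<2 * k i})" by (intro card_mono sub) auto
  also have "\<dots> \<le> (\<Sum>i = 1..t. card (cycle_vertex i ` {..<2 * k i}))" by (intro card_UN_le) auto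
  also have "\<dots> \<le> order_F" unfolding order_F_def by (intro sum_mono) (metis card_image_le card_lessThan finite_lessThan)
  finally show "card (pverts F) \<le> order_F" .
qed

text \<open>Serves to show that attaching a pendant vertex creates no copy of
  \<open>F\<close>.\<close>

lemma F_two_neighbours:
  assumes "a \<in> pverts F"
  obtains b c where "(a, b) \<in> parcs F" "(a, c) \<in> parcs F" "b \<noteq> c" "b \<in> pverts F" "c \<in> pverts F"
proof -
  interpret pair_wf_digraph F by (rule wf_intersecting_cycles)
  obtain i j where ij: "i \<in> {1..t}" "j < 2 * k i" "a = cycle_vertex i j" using assms by (auto simp: intersecting_cycles_def)
  have ki: "2 \<le> k i" using k ij by auto
  have inj: "cycle_vertex i p = cycle_vertex i q \<longleftrightarrow> p = q" for p q using inj_on_cycle_vertex[of i UNIV] ij(1) by (auto dest: inj_onD)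
  define j' where "j' = (if j = 0 then 2 * k i - 1 else j - 1)"
  have j': "j' < 2 * k i" "Suc j' mod (2 * k i) = j" using ij(2) by (auto simp: j'_def)
  have 1: "(a, cycle_vertex i (Suc j mod (2 * k i))) \<in> parcs F" unfolding ij(3) intersecting_cycles_def using ij(1,2) by auto
  have "(cycle_vertex i (Suc j' mod (2 * k i)), cycle_vertex i j') \<in> parcs F"
    unfolding intersecting_cycles_def using ij(1) j'(1) by auto
  then have 2: "(a, cycle_vertex i j') \<in> parcs F" unfolding j'(2) ij(3) .
  have "Suc j mod (2 * k i) \<noteq> j'"
  proof (cases "Suc j = 2 * k i")
    case True
    then show ?thesis using ki by (auto simp: j'_def)
  next
    case False
    then show ?thesis using ij(2) ki by (auto simp: j'_def)
  qed
  then show thesis using that[OF 1 2] inj in_arcsD2[OF 1] in_arcsD2[OF 2] by blast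
qed

lemma minor_free_if_cover:
  assumes E: "simple_rel n E" and X: "finite X" "card X \<le> \<kappa>" and s: "single \<or> (\<forall>i\<in>{1..t}. k i = 2)"
    and m: "\<And>u v w. u \<notin> X \<Longrightarrow> v \<notin> X \<Longrightarrow> w \<notin> X \<Longrightarrow> E u v \<Longrightarrow> E u w \<Longrightarrow> v = w"
    and o: "single \<Longrightarrow> \<exists>a b. \<forall>u v. u \<notin> X \<and> v \<notin> X \<and> E u v \<longrightarrow> (u, v) \<in> {(a, b), (b, a)}"
  shows "minor_free (graph_of n E) F"
proof (rule minor_free_if_near_cover)
  have "sym (parcs (graph_of n E))" using simple_rel_sym[OF E] by (auto simp: sym_def)
  then show "near_cover single \<kappa> (graph_of n E)" using X m o by (intro near_coverI) auto
  show "\<not> near_cover single \<kappa> F" unfolding \<kappa> by (rule not_near_cover_intersecting_cycles[OF t k s])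
qed

lemma free_if_minor_free:
  assumes "simple_rel n E" "minor_free (graph_of n E) F"
  shows "free n E"
  by (rule not_contains_if_minor_free[OF pair_graph_graph_of[OF assms(1)] sym_intersecting_cycles assms(2)])

text \<open>The basic competitor is the complete bipartite graph with parts of sizes \<kappa> and
  \<open>n - \<kappa>\<close>; it is free because the small part covers all its edges.\<close>

lemma rho_bipartite:
  assumes "\<kappa> < n"
  defines "B \<equiv> (\<lambda>u v. u < n \<and> v < n \<and> (u < \<kappa>) \<noteq> (v < \<kappa>))"
  shows "simple_rel n B" "free n B" "real \<kappa> * real (n - \<kappa>) \<le> (rho n B)\<^sup>2"
proof -
  show B: "simple_rel n B" by (auto simp: simple_rel_def B_def symp_def)
  have "minor_free (graph_of n B) F"
    by (rule minor_free_if_cover[OF B, of "{..<\<kappa>}" True]) (auto simp: B_def)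
  then show "free n B" by (rule free_if_minor_free[OF B])
  \<comment> \<open>Up to scaling, the Perron vector of the complete bipartite graph.\<close>
  define a b where "a = sqrt (real (n - \<kappa>))" and "b = sqrt (real \<kappa>)"
  define y where "y i = (if i < \<kappa> then a else b)" for i
  have ab: "a * a = real (n - \<kappa>)" "b * b = real \<kappa>" "0 < a" "0 < b" using assms(1) \<kappa>_pos by (auto simp: a_def b_def)
  have split: "(\<Sum>i<n. f i) = (\<Sum>i<\<kappa>. f i) + (\<Sum>i=\<kappa>..<n. f i)" for f :: "nat \<Rightarrow> real"
  proof -
    have "{..<n} = {..<\<kappa>} \<union> {\<kappa>..<n}" using assms(1) by auto
    then show ?thesis by (simp add: sum.union_disjoint ivl_disj_int)
  qed
  have 1: "adj_sum n B y i = real (n - \<kappa>) * b" if "i < \<kappa>" for i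
  proof -
    have "adj_sum n B y i = (\<Sum>j=\<kappa>..<n. b)" unfolding adj_sum_def split
      using that assms(1) by (auto simp: B_def y_def intro!: sum.neutral)
    then show ?thesis by simp
  qed
  have 2: "adj_sum n B y i = real \<kappa> * a" if "\<kappa> \<le> i" "i < n" for i
  proof -
    have "(\<Sum>j<\<kappa>. if B i j then y j else 0) = (\<Sum>j<\<kappa>. a)" using that assms(1) by (intro sum.cong) (auto simp: B_def y_def)
    moreover have "(\<Sum>j=\<kappa>..<n. if B i j then y j else 0) = 0" using that by (intro sum.neutral) (auto simp: B_def)
    ultimately show ?thesis unfolding adj_sum_def split by simp
  qed
  have "qform n B y = (\<Sum>i<\<kappa>. a * (real (n - \<kappa>) * b)) + (\<Sum>i=\<kappa>..<n. b * (real \<kappa> * a))"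
    unfolding qform_def split using 1 2 by (intro arg_cong2[where f = "(+)"] sum.cong) (auto simp: y_def)
  also have "\<dots> = 2 * (b * b) * (a * a) * (a * b)" using ab by simp
  finally have q: "qform n B y = 2 * (b * b) * (a * a) * (a * b)" .
  have "(\<Sum>i<n. (y i)\<^sup>2) = (\<Sum>i<\<kappa>. a * a) + (\<Sum>i=\<kappa>..<n. b * b)"
    unfolding split by (intro arg_cong2[where f = "(+)"] sum.cong) (auto simp: y_def power2_eq_square)
  also have "\<dots> = 2 * (b * b) * (a * a)" using ab by simp
  finally have N: "(\<Sum>i<n. (y i)\<^sup>2) = 2 * (b * b) * (a * a)" .
  have "2 * (b * b) * (a * a) * (a * b) \<le> rho n B * (2 * (b * b) * (a * a))"
    using rayleigh[OF B, of y] assms(1) unfolding q N by simp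
  then have "2 * (b * b) * (a * a) * (a * b) \<le> 2 * (b * b) * (a * a) * rho n B" by (simp only: mult.commute)
  then have "a * b \<le> rho n B" by (rule mult_left_le_imp_le) (use ab assms(1) \<kappa>_pos in auto)
  then have "(a * b)\<^sup>2 \<le> (rho n B)\<^sup>2" using ab by (intro power_mono) auto
  moreover have "(a * b)\<^sup>2 = (b * b) * (a * a)" by (simp add: power2_eq_square)
  ultimately show "real \<kappa> * real (n - \<kappa>) \<le> (rho n B)\<^sup>2" using ab by simp
qed

end

locale extremal_graph = intersecting_even_cycles +
  fixes n :: nat and E :: "nat \<Rightarrow> nat \<Rightarrow> bool" and x :: "nat \<Rightarrow> real" and z :: nat
  assumes simple: "simple_rel n E" and free: "free n E"
    and extremal: "simple_rel n E' \<Longrightarrow> free n E' \<Longrightarrow> rho n E' \<le> rho n E"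
    and x_nonneg: "0 \<le> x i" and x_le1: "i < n \<Longrightarrow> x i \<le> 1" and z: "z < n" "x z = 1"
    and eigen: "i < n \<Longrightarrow> (\<Sum>j | E i j. x j) = rho n E * x i"
begin

lemmas E_sym = simple_rel_sym[OF simple]
lemmas E_symp = simple_rel_symp[OF simple]
lemmas E_irrefl = simple_rel_irrefl[OF simple]
lemmas E_less = simple_rel_less[OF simple]

lemma finite_nbs [simp]: "finite {j. E i j}" "finite {j. E i j \<and> P j}" "finite {j. P j \<and> E i j}"
  by (rule finite_subset[of _ "{..<n}"]; use E_less in auto)+

lemma n_pos: "0 < n" using z by simp

lemma no_flower: "\<not> flower E {1..t} k" by (rule no_flower_if_free[OF simple free])

lemma rho_E_nonneg: "0 \<le> rho n E" by (rule rho_nonneg[OF simple n_pos])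

lemma rho_lower: "\<kappa> < n \<Longrightarrow> real \<kappa> * (real n - real \<kappa>) \<le> (rho n E)\<^sup>2"
proof -
  assume n: "\<kappa> < n"
  note B = rho_bipartite[OF n]
  have "rho n (\<lambda>u v. u < n \<and> v < n \<and> (u < \<kappa>) \<noteq> (v < \<kappa>)) \<le> rho n E" by (rule extremal[OF B(1,2)])
  then have "(rho n (\<lambda>u v. u < n \<and> v < n \<and> (u < \<kappa>) \<noteq> (v < \<kappa>)))\<^sup>2 \<le> (rho n E)\<^sup>2"
    by (intro power_mono rho_nonneg[OF B(1) n_pos])
  then show ?thesis using B(3) n by (simp add: of_nat_diff)
qed

lemma qform_x: "qform n E x = rho n E * (\<Sum>i<n. (x i)\<^sup>2)"
  by (rule qform_eigen[OF simple eigen])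

text \<open>If \<open>x v = 0\<close>, turning \<open>v\<close> into a pendant vertex at \<open>z\<close> would increase the spectral radius.\<close>

lemma x_pos:
  assumes v: "v < n" shows "0 < x v"
proof (rule ccontr)
  assume "\<not> 0 < x v"
  then have xv: "x v = 0" using x_nonneg[of v] by simp
  then have vz: "v \<noteq> z" using z by auto
  define E' where "E' u w \<longleftrightarrow> u \<noteq> v \<and> w \<noteq> v \<and> E u w \<or> u = v \<and> w = z \<or> u = z \<and> w = v" for u w
  have E': "simple_rel n E'" using E_sym E_irrefl E_less v z vz unfolding simple_rel_def symp_def E'_def by blast
  have "free n E'"
  proof
    assume "contains_subgraph (graph_of n E') F"
    then obtain f where f: "inj_on f (pverts F)" "f ` pverts F \<subseteq> {..<n}" "\<And>a b. (a, b) \<in> parcs F \<Longrightarrow> E' (f a) (f b)"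
      unfolding contains_iff[OF E'] by blast
    interpret F: pair_wf_digraph F by (rule wf_intersecting_cycles)
    have nv: "f a \<noteq> v" if a: "a \<in> pverts F" for a
    proof
      assume fa: "f a = v"
      obtain b c where bc: "(a, b) \<in> parcs F" "(a, c) \<in> parcs F" "b \<noteq> c" "b \<in> pverts F" "c \<in> pverts F"
        using F_two_neighbours[OF a] .
      have "f b = z" "f c = z" using f(3)[OF bc(1)] f(3)[OF bc(2)] fa vz by (auto simp: E'_def)
      then show False using f(1) bc by (auto dest: inj_onD)
    qed
    have "E (f a) (f b)" if "(a, b) \<in> parcs F" for a b
      using f(3)[OF that] nv F.in_arcsD1[OF that] F.in_arcsD2[OF that] by (auto simp: E'_def)
    then show False using free f(1,2) unfolding contains_iff[OF simple] by blast
  qed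
  then have "rho n E' \<le> rho n E" by (rule extremal[OF E'])
  moreover have "rho n E < rho n E'"
  proof (rule rho_gt_if_new_vertex[where x = x and v = v, OF E' n_pos rho_E_nonneg v xv])
    have "{j. E' v j} = {z}" using vz by (auto simp: E'_def)
    then show "0 < adj_sum n E' x v" using z by (simp add: adj_sum_eq[OF E'])
    have "qform n E' x - qform n E x = 2 * x v * (adj_sum n E' x v - adj_sum n E x v)"
      by (rule qform_diff_at[OF simple E' v]) (auto simp: E'_def)
    then show "rho n E * (\<Sum>i<n. (x i)\<^sup>2) \<le> qform n E' x" using xv qform_x by simp
  qed
  ultimately show False by simp
qed

text \<open>
  Replacing the neighbourhood of \<open>v\<close> by \<open>R\<close> creates no copy of \<open>F\<close>, since in such a copy \<open>v\<close> could be exchanged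
  for an unused common neighbour of \<open>R\<close>.
\<close>

lemma sum_le_neighbour_sum:
  assumes v: "v < n" and R: "R \<subseteq> {..<n}" "v \<notin> R" and C: "order_F < card {u. u < n \<and> u \<noteq> v \<and> (\<forall>r\<in>R. E r u)}"
  shows "(\<Sum>r\<in>R. x r) \<le> (\<Sum>j | E v j. x j)"
proof -
  define E' where "E' u w \<longleftrightarrow> u \<noteq> v \<and> w \<noteq> v \<and> E u w \<or> u = v \<and> w \<in> R \<or> u \<in> R \<and> w = v" for u w
  have E': "simple_rel n E'" using E_sym E_irrefl E_less v R unfolding simple_rel_def symp_def E'_def by blast
  have "free n E'"
  proof
    assume "contains_subgraph (graph_of n E') F"
    then obtain f where f: "inj_on f (pverts F)" "f ` pverts F \<subseteq> {..<n}" "\<And>a b. (a, b) \<in> parcs F \<Longrightarrow> E' (f a) (f b)"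
      unfolding contains_iff[OF E'] by blast
    interpret F: pair_wf_digraph F by (rule wf_intersecting_cycles)
    have "card (f ` pverts F) \<le> order_F" using card_image_le[OF finite_F(1), of f] finite_F(2) by simp
    moreover have "card {u. u < n \<and> u \<noteq> v \<and> (\<forall>r\<in>R. E r u)} \<le> card (f ` pverts F)"
      if "{u. u < n \<and> u \<noteq> v \<and> (\<forall>r\<in>R. E r u)} \<subseteq> f ` pverts F"
      using that by (rule card_mono[OF finite_imageI[OF finite_F(1)]])
    ultimately have "\<not> {u. u < n \<and> u \<noteq> v \<and> (\<forall>r\<in>R. E r u)} \<subseteq> f ` pverts F" using C by linarith
    then obtain u where u: "u < n" "u \<noteq> v" "\<forall>r\<in>R. E r u" "u \<notin> f ` pverts F" by blast
    define g where "g a = (if f a = v then u else f a)" for a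
    have "inj_on g (pverts F)"
    proof (rule inj_onI)
      fix a b assume ab: "a \<in> pverts F" "b \<in> pverts F" "g a = g b"
      then have "f a = f b" using u(4) unfolding g_def by (metis imageI)
      then show "a = b" using f(1) ab by (auto dest: inj_onD)
    qed
    moreover have "g ` pverts F \<subseteq> {..<n}" using f(2) u(1) by (auto simp: g_def)
    moreover have "E (g a) (g b)" if ab: "(a, b) \<in> parcs F" for a b
    proof -
      consider "f a \<noteq> v" "f b \<noteq> v" "E (f a) (f b)" | "f a = v" "f b \<in> R" | "f a \<in> R" "f b = v"
        using f(3)[OF ab] by (auto simp: E'_def)
      then show ?thesis using u(3) R(2) E_sym by cases (auto simp: g_def)
    qed
    ultimately show False using free unfolding contains_iff[OF simple] by blast
  qed
  then have "rho n E' \<le> rho n E" by (rule extremal[OF E'])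
  then have "rho n E' * (\<Sum>i<n. (x i)\<^sup>2) \<le> rho n E * (\<Sum>i<n. (x i)\<^sup>2)" by (intro mult_right_mono sum_nonneg) auto
  then have "qform n E' x \<le> qform n E x" using rayleigh[OF E' n_pos, of x] qform_x by simp
  moreover have "qform n E' x - qform n E x = 2 * x v * (adj_sum n E' x v - adj_sum n E x v)"
    by (rule qform_diff_at[OF simple E' v]) (auto simp: E'_def)
  ultimately have "2 * x v * (adj_sum n E' x v - adj_sum n E x v) \<le> 0" by simp
  then have "adj_sum n E' x v \<le> adj_sum n E x v" using x_pos[OF v] by (simp add: mult_le_0_iff)
  moreover have "{j. E' v j} = R" using R(2) by (auto simp: E'_def)
  ultimately show ?thesis by (simp add: adj_sum_eq[OF E'] adj_sum_eq[OF simple])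
qed

end

section \<open>Vertices of high degree\<close>

context intersecting_even_cycles
begin

lemma sum_k_le: "(\<Sum>i = 1..t. k i) \<le> order_F" unfolding order_F_def by (intro sum_mono) auto

lemma order_F_pos: "4 \<le> order_F"
proof -
  have "2 * k 1 \<le> order_F" unfolding order_F_def using t member_le_sum[of 1 "{1..t}" "\<lambda>i. 2 * k i"] by simp
  then show ?thesis using k[of 1] t by simp
qed

lemma k_ge1: "i \<in> {1..t} \<Longrightarrow> 1 \<le> k i" using k[of i] by simp

end

context extremal_graph
begin

abbreviation nb :: "nat \<Rightarrow> nat set" where "nb v \<equiv> {j. E v j}"

abbreviation lam :: real where "lam \<equiv> rho n E"

lemma nb_sub: "nb v \<subseteq> {..<n}" using E_less by auto

lemma card_nb_le: "card (nb v) \<le> n" using card_mono[OF _ nb_sub, of v] by simp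

lemma two_step:
  assumes "v < n" shows "lam\<^sup>2 * x v = (\<Sum>u\<in>nb v. \<Sum>w\<in>nb u. x w)"
proof -
  have "lam\<^sup>2 * x v = lam * (\<Sum>u\<in>nb v. x u)" using eigen[OF assms] by (simp add: power2_eq_square)
  also have "\<dots> = (\<Sum>u\<in>nb v. \<Sum>w\<in>nb u. x w)" unfolding sum_distrib_left
    by (intro sum.cong refl) (use eigen E_less in auto)
  finally show ?thesis .
qed

lemma edge_count_le:
  assumes "A \<subseteq> nb v" "finite W" "v \<notin> W"
  shows "edge_count E A W \<le> order_F * (card A + card W)"
  unfolding order_F_def
  by (rule edge_count_le_if_no_flower[where v = v, OF _ k_ge1 no_flower _ _ E_symp E_irrefl])
    (use assms finite_subset[OF assms(1)] in auto)

text \<open>\<open>edge_count_le\<close> keeps \<open>v\<close> out of the second side, so the walks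
  that return to \<open>v\<close> are counted separately, one for each neighbour.\<close>

lemma walks_le:
  assumes "S \<subseteq> {..<n}"
  shows "(\<Sum>u\<in>nb v \<inter> S. card (nb u \<inter> S)) \<le> (2 * order_F + 1) * card S"
proof -
  have fin: "finite S" using assms finite_subset by blast
  have "card (nb u \<inter> S) \<le> 1 + card {w \<in> S - {v}. E u w}" for u
  proof -
    have "nb u \<inter> S \<subseteq> insert v {w \<in> S - {v}. E u w}" by auto
    then have "card (nb u \<inter> S) \<le> card (insert v {w \<in> S - {v}. E u w})" using fin by (intro card_mono) auto
    also have "\<dots> \<le> Suc (card {w \<in> S - {v}. E u w})" by (rule card_insert_le_m1) auto
    finally show ?thesis by simp
  qed
  then have "(\<Sum>u\<in>nb v \<inter> S. card (nb u \<inter> S)) \<le> (\<Sum>u\<in>nb v \<inter> S. 1 + card {w \<in> S - {v}. E u w})" by (rule sum_mono)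
  also have "\<dots> = card (nb v \<inter> S) + edge_count E (nb v \<inter> S) (S - {v})" unfolding edge_count_def sum.distrib by simp
  also have "\<dots> \<le> card (nb v \<inter> S) + order_F * (card (nb v \<inter> S) + card (S - {v}))"
    using edge_count_le[of "nb v \<inter> S" v "S - {v}"] fin by simp
  also have "\<dots> \<le> card S + order_F * (card S + card S)"
    using fin by (intro add_mono mult_left_mono card_mono) auto
  finally show ?thesis by (simp add: algebra_simps)
qed

lemma walks_le_all: "(\<Sum>u\<in>nb v. card (nb u)) \<le> (2 * order_F + 1) * n"
proof -
  have "nb u \<inter> {..<n} = nb u" for u using nb_sub by blast
  then show ?thesis using walks_le[of "{..<n}" v] by simp
qed

lemma lam_upper: "lam\<^sup>2 \<le> (2 * order_F + 1) * n"
proof -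
  have "lam\<^sup>2 = (\<Sum>u\<in>nb z. \<Sum>w\<in>nb u. x w)" using two_step[OF z(1)] z(2) by simp
  also have "\<dots> \<le> (\<Sum>u\<in>nb z. \<Sum>w\<in>nb u. 1)" by (intro sum_mono x_le1) (use E_less in auto)
  also have "\<dots> = real (\<Sum>u\<in>nb z. card (nb u))" by simp
  also have "\<dots> \<le> real ((2 * order_F + 1) * n)" using walks_le_all[of z] of_nat_mono by blast
  finally show ?thesis by simp
qed

lemma common_neighbours_card:
  assumes "finite R" "\<kappa> < card R"
  shows "card {u. \<forall>r\<in>R. E r u} < order_F"
proof (rule ccontr)
  assume c: "\<not> ?thesis"
  obtain r where r: "r \<in> R" using assms by fastforce
  have "finite {u. \<forall>r\<in>R. E r u}" using finite_subset[of "{u. \<forall>r\<in>R. E r u}" "nb r"] r by auto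
  then have "flower E {1..t} k" using assms c sum_k_le k_ge1 E_irrefl
    by (intro flower_if_common_neighbours[where R = R and C = "{u. \<forall>r\<in>R. E r u}"] E_symp) (auto simp: \<kappa>)
  then show False using no_flower by simp
qed

text \<open>Such a vertex is a common neighbour of some subset of \<open>B\<close> with more than
  \<kappa> elements. There are at most \<open>2 ^ card B\<close> such subsets, each with fewer than
  \<open>order_F\<close> common neighbours.\<close>

lemma exceptional_card:
  assumes B: "finite B"
  shows "finite {u. \<kappa> < card (nb u \<inter> B)}" "card {u. \<kappa> < card (nb u \<inter> B)} \<le> 2 ^ card B * order_F"
proof -
  define I where "I = {S \<in> Pow B. \<kappa> < card S}"
  have I: "finite I" "card I \<le> 2 ^ card B"
    using B card_mono[of "Pow B" I] by (auto simp: I_def card_Pow)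
  have sub: "{u. \<kappa> < card (nb u \<inter> B)} \<subseteq> (\<Union>S\<in>I. {u. \<forall>r\<in>S. E r u})"
  proof
    fix u assume "u \<in> {u. \<kappa> < card (nb u \<inter> B)}"
    then have "nb u \<inter> B \<in> I" by (auto simp: I_def)
    moreover have "\<forall>r\<in>nb u \<inter> B. E r u" using E_sym by auto
    ultimately show "u \<in> (\<Union>S\<in>I. {u. \<forall>r\<in>S. E r u})" by blast
  qed
  have fS: "finite {u. \<forall>r\<in>S. E r u}" if "S \<in> I" for S
  proof -
    obtain r where "r \<in> S" using \<open>S \<in> I\<close> by (fastforce simp: I_def)
    then show ?thesis using finite_subset[of "{u. \<forall>r\<in>S. E r u}" "nb r"] by auto
  qed
  show "finite {u. \<kappa> < card (nb u \<inter> B)}" using sub I(1) fS by (auto intro: finite_subset)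
  have "card {u. \<kappa> < card (nb u \<inter> B)} \<le> card (\<Union>S\<in>I. {u. \<forall>r\<in>S. E r u})"
    using sub I(1) fS by (intro card_mono) auto
  also have "\<dots> \<le> (\<Sum>S\<in>I. card {u. \<forall>r\<in>S. E r u})" using I(1) by (rule card_UN_le)
  also have "\<dots> \<le> (\<Sum>S\<in>I. order_F)"
  proof (rule sum_mono)
    fix S assume "S \<in> I"
    then have "finite S" "\<kappa> < card S" using B by (auto simp: I_def intro: finite_subset)
    then show "card {u. \<forall>r\<in>S. E r u} \<le> order_F" using common_neighbours_card by (simp add: less_imp_le)
  qed
  also have "\<dots> \<le> 2 ^ card B * order_F" using I(2) by simp
  finally show "card {u. \<kappa> < card (nb u \<inter> B)} \<le> 2 ^ card B * order_F" .
qed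

lemma sum_card_nb_le:
  assumes "finite A" "finite B"
  shows "(\<Sum>u\<in>A. card (nb u \<inter> B)) \<le> \<kappa> * card A + card B * (2 ^ card B * order_F)"
proof -
  let ?X = "{u. \<kappa> < card (nb u \<inter> B)}"
  have "card (nb u \<inter> B) \<le> \<kappa> + (if u \<in> ?X then card B else 0)" for u
    using card_mono[OF assms(2), of "nb u \<inter> B"] by auto
  then have "(\<Sum>u\<in>A. card (nb u \<inter> B)) \<le> (\<Sum>u\<in>A. \<kappa> + (if u \<in> ?X then card B else 0))" by (rule sum_mono)
  also have "\<dots> = \<kappa> * card A + card B * card (A \<inter> ?X)"
    using assms by (simp add: sum.distrib sum.If_cases)
  also have "card (A \<inter> ?X) \<le> card ?X" using exceptional_card(1)[OF assms(2)] by (intro card_mono) auto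
  also have "\<dots> \<le> 2 ^ card B * order_F" by (rule exceptional_card(2)[OF assms(2)])
  finally show ?thesis by simp
qed

end

text \<open>\<open>\<delta>\<close> is the degree threshold for \<open>B\<close>, and
  \<open>b\<close> bounds the size of \<open>B\<close>. The three parts of \<open>large\<close> let
  \<open>\<delta> * n / 4\<close> absorb the walks through \<open>B\<close>, the exceptional
  vertices of \<open>exceptional_card\<close>, and bounded terms.\<close>

locale large_extremal_graph = extremal_graph +
  fixes \<delta> :: real and b :: nat
  assumes \<kappa>2: "2 \<le> \<kappa>" and \<delta>: "0 < \<delta>" "\<delta> * (1000 * (1 + 3 * order_F + 50 * \<kappa>)) \<le> 1" and b: "\<kappa> + 1 \<le> b * \<delta>"
    and large: "b * sqrt ((2 * order_F + 1) * n) \<le> \<delta> * n / 4" "(b + 1) * (2 ^ b * order_F) \<le> \<delta> * n / 4"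
      "\<kappa>\<^sup>2 + 4 * order_F + 8 \<le> \<delta> * n / 4"
begin

lemma \<delta>_small: "\<delta> * order_F \<le> 1 / 3000" "\<delta> * \<kappa> \<le> 1 / 50000" "\<delta> \<le> 1 / 1000"
proof -
  have "\<delta> * real (1000 * (1 + 3 * order_F + 50 * \<kappa>)) = 1000 * \<delta> + 3000 * (\<delta> * order_F) + 50000 * (\<delta> * \<kappa>)"
    by (simp add: algebra_simps)
  then have *: "1000 * \<delta> + 3000 * (\<delta> * order_F) + 50000 * (\<delta> * \<kappa>) \<le> 1" using \<delta>(2) by linarith
  have **: "0 \<le> \<delta> * order_F" "0 \<le> \<delta> * \<kappa>" using \<delta> by auto
  show "\<delta> * order_F \<le> 1 / 3000" using * ** \<delta>(1) by linarith
  show "\<delta> * \<kappa> \<le> 1 / 50000" using * ** \<delta>(1) by linarith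
  show "\<delta> \<le> 1 / 1000" using * ** by linarith
qed

lemma \<kappa>_less_n: "\<kappa> < n" and n_large: "4 * order_F + 8 \<le> n"
proof -
  have "\<delta> * n / 4 \<le> real n" using \<delta>(1) \<delta>_small(3) mult_right_mono[of \<delta> 1 "real n"] by linarith
  then have "real (\<kappa>\<^sup>2 + 4 * order_F + 8) \<le> real n" using large(3) by linarith
  then have 1: "\<kappa>\<^sup>2 + 4 * order_F + 8 \<le> n" by (simp only: of_nat_le_iff)
  have "\<kappa> \<le> \<kappa>\<^sup>2" using \<kappa>2 by (simp add: power2_eq_square)
  then show "\<kappa> < n" using 1 by linarith
  show "4 * order_F + 8 \<le> n" using 1 by linarith
qed

definition B :: "nat set" where "B = {v. v < n \<and> \<delta> * n \<le> card (nb v)}"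

lemma finite_B [simp]: "finite B" by (simp add: B_def)

text \<open>Double counting: \<open>b\<close> vertices of \<open>B\<close> would send out at least
  \<open>(\<kappa> + 1) * n\<close> edges, while all but boundedly many vertices receive at most
  \<kappa> of them.\<close>

lemma card_B: "card B < b"
proof (rule ccontr)
  assume "\<not> card B < b"
  then obtain B' where B': "B' \<subseteq> B" "card B' = b" "finite B'" using obtain_subset_with_card_n[of b B] by (auto simp: not_less)
  have "(\<kappa> + 1) * real n \<le> b * \<delta> * n" using b by (intro mult_right_mono) auto
  also have "\<dots> = (\<Sum>r\<in>B'. \<delta> * n)" using B' by simp
  also have "\<dots> \<le> (\<Sum>r\<in>B'. real (card (nb r)))" using B' by (intro sum_mono) (auto simp: B_def)
  also have "\<dots> = real (edge_count E B' {..<n})"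
  proof -
    have "{w \<in> {..<n}. E r w} = nb r" for r using nb_sub by auto
    then show ?thesis by (simp add: edge_count_def)
  qed
  also have "edge_count E B' {..<n} = edge_count E {..<n} B'" using B' E_symp by (intro edge_count_flip) auto
  also have "\<dots> = (\<Sum>u<n. card (nb u \<inter> B'))" unfolding edge_count_def
    by (intro sum.cong refl arg_cong[of _ _ card]) auto
  also have "real \<dots> \<le> real (\<kappa> * n + b * (2 ^ b * order_F))"
    using sum_card_nb_le[OF finite_lessThan B'(3), of n] B'(2) by (intro of_nat_mono) simp
  finally have "real n \<le> b * (2 ^ b * order_F)" by (simp add: algebra_simps)
  also have "\<dots> \<le> real ((b + 1) * (2 ^ b * order_F))" by (intro of_nat_mono mult_le_mono1) simp
  also have "\<dots> \<le> \<delta> * n / 4" using large(2) by simp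
  also have "\<dots> < real n" using \<delta>(1) \<delta>_small(3) n_pos mult_right_mono[of \<delta> 1 "real n"] by linarith
  finally show False by simp
qed

lemma low_degree:
  assumes "v \<notin> B" shows "card (nb v) \<le> \<delta> * n"
proof (cases "v < n")
  case True
  then show ?thesis using assms by (auto simp: B_def)
next
  case False
  then have "nb v = {}" using E_less by blast
  then show ?thesis using \<delta>(1) by simp
qed

definition bw :: "nat \<Rightarrow> real" where "bw u = (\<Sum>w\<in>nb u \<inter> B. x w)"

lemma bw_le: "bw u \<le> card (nb u \<inter> B)"
proof -
  have "bw u \<le> (\<Sum>w\<in>nb u \<inter> B. 1)" unfolding bw_def by (intro sum_mono x_le1) (auto simp: B_def)
  then show ?thesis by simp
qed

lemma pow_B_le: "card B * (2 ^ card B * order_F) \<le> (b + 1) * (2 ^ b * order_F)"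
  using card_B by (intro mult_le_mono power_increasing) auto

lemma sum_bw_le:
  assumes "finite A" shows "(\<Sum>u\<in>A. bw u) \<le> \<kappa> * card A + \<delta> * n / 4"
proof -
  have "(\<Sum>u\<in>A. bw u) \<le> (\<Sum>u\<in>A. real (card (nb u \<inter> B)))" by (intro sum_mono bw_le)
  also have "\<dots> = real (\<Sum>u\<in>A. card (nb u \<inter> B))" by simp
  also have "\<dots> \<le> real (\<kappa> * card A + (b + 1) * (2 ^ b * order_F))"
    using sum_card_nb_le[OF assms finite_B] pow_B_le by (intro of_nat_mono) linarith
  finally show ?thesis using large(2) by simp
qed

lemma lam_B_le: "card B * lam \<le> \<delta> * n / 4"
proof -
  have "lam \<le> sqrt ((2 * order_F + 1) * n)" using lam_upper by (intro real_le_rsqrt) simp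
  then have "card B * lam \<le> b * sqrt ((2 * order_F + 1) * n)"
    using card_B rho_E_nonneg by (intro mult_mono) auto
  then show ?thesis using large(1) by linarith
qed

text \<open>Walks of length two from \<open>v\<close> are sorted by whether the middle vertex and
  the end lie in \<open>B\<close>. Those with middle vertex in \<open>B\<close> weigh at most
  \<open>card B * lam\<close>, which is only of order sqrt n.\<close>

lemma weight_split:
  assumes v: "v < n"
  shows "\<kappa> * n * x v \<le> (\<Sum>u\<in>nb v - B. bw u) + (\<Sum>u\<in>nb v - B. \<Sum>w\<in>nb u - B. x w) + \<delta> * n / 2"
proof -
  have "real \<kappa> * (real n - \<kappa>) * x v \<le> lam\<^sup>2 * x v"
    using rho_lower[OF \<kappa>_less_n] x_nonneg by (intro mult_right_mono) auto
  moreover have "real \<kappa> * \<kappa> * x v \<le> real \<kappa> * \<kappa>" using x_le1[OF v] by (intro mult_left_le) auto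
  then have "\<kappa> * \<kappa> * x v \<le> \<delta> * n / 4" using large(3) by (simp add: power2_eq_square)
  ultimately have 1: "\<kappa> * n * x v \<le> lam\<^sup>2 * x v + \<delta> * n / 4" by (simp add: algebra_simps)
  have "(\<Sum>u\<in>nb v. \<Sum>w\<in>nb u. x w) = (\<Sum>u\<in>nb v \<inter> B. \<Sum>w\<in>nb u. x w) + (\<Sum>u\<in>nb v - B. \<Sum>w\<in>nb u. x w)"
    by (simp add: sum.Int_Diff[of "nb v" _ B])
  also have "(\<Sum>u\<in>nb v \<inter> B. \<Sum>w\<in>nb u. x w) = (\<Sum>u\<in>nb v \<inter> B. lam * x u)"
    by (intro sum.cong refl) (use eigen in \<open>auto simp: B_def\<close>)
  also have "\<dots> \<le> (\<Sum>u\<in>nb v \<inter> B. lam * 1)" using x_le1 rho_E_nonneg by (intro sum_mono mult_left_mono) (auto simp: B_def)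
  also have "\<dots> \<le> card B * lam" using rho_E_nonneg by (simp add: mult_right_mono card_mono)
  also have "\<dots> \<le> \<delta> * n / 4" by (rule lam_B_le)
  also have "(\<Sum>u\<in>nb v - B. \<Sum>w\<in>nb u. x w) = (\<Sum>u\<in>nb v - B. bw u + (\<Sum>w\<in>nb u - B. x w))"
    unfolding bw_def by (intro sum.cong refl sum.Int_Diff) simp
  finally show ?thesis using 1 two_step[OF v] by (simp add: sum.distrib)
qed

text \<open>A vertex of low degree has too few neighbours for the \<open>bw\<close> part to matter;
  its weight must come from walks that avoid \<open>B\<close>.\<close>

lemma low_weight_split:
  assumes "v < n" "v \<notin> B"
  shows "\<kappa> * n * x v \<le> (\<Sum>u\<in>nb v - B. \<Sum>w\<in>nb u - B. x w) + (\<kappa> + 1) * \<delta> * n"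
proof -
  have "card (nb v - B) \<le> card (nb v)" by (intro card_mono) auto
  then have "real (card (nb v - B)) \<le> \<delta> * n" using low_degree[OF assms(2)] by linarith
  then have "\<kappa> * real (card (nb v - B)) \<le> \<kappa> * (\<delta> * n)" by (intro mult_left_mono) auto
  then have "(\<Sum>u\<in>nb v - B. bw u) \<le> \<kappa> * (\<delta> * n) + \<delta> * n / 4" using sum_bw_le[of "nb v - B"] by simp
  moreover have "0 \<le> \<delta> * n" using \<delta>(1) by simp
  ultimately show ?thesis using weight_split[OF assms(1)] by (simp add: algebra_simps)
qed

end

section \<open>Smallness of the Perron entries outside the vertices of high degree\<close>

context large_extremal_graph
begin

definition A :: "nat \<Rightarrow> nat set" where "A v = nb v - B"

definition walks :: "nat \<Rightarrow> nat" where "walks v = (\<Sum>u\<in>A v. card (nb u - B))"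

text \<open>The second neighbourhood of \<open>v\<close> within the complement of \<open>B\<close>.
  Alternating paths between \<open>A v\<close> and \<open>T v\<close> need the two to be
  disjoint.\<close>

definition T :: "nat \<Rightarrow> nat set" where
  "T v = {w. w < n \<and> w \<notin> B \<and> w \<noteq> v \<and> w \<notin> nb v \<and> (\<exists>u\<in>A v. E u w)}"

lemma finite_A [simp]: "finite (A v)" and finite_T [simp]: "finite (T v)"
  and A_sub: "A v \<subseteq> nb v" and A_T: "A v \<inter> T v = {}" and v_A: "v \<notin> A v" and v_T: "v \<notin> T v"
  using E_irrefl by (auto simp: A_def T_def)

lemma card_A: "v \<notin> B \<Longrightarrow> card (A v) \<le> \<delta> * n"
  using low_degree[of v] card_mono[of "nb v" "A v"] A_sub[of v] by simp

lemma card_A_T: "card (A v) + card (T v) \<le> n"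
proof -
  have "card (A v) + card (T v) = card (A v \<union> T v)" using A_T by (simp add: card_Un_disjoint)
  also have "\<dots> \<le> card {..<n}" using A_sub nb_sub by (intro card_mono) (auto simp: T_def)
  finally show ?thesis by simp
qed

text \<open>Walks that return to \<open>v\<close> or end in \<open>A v\<close> are few: the latter
  are counted by the crude bound with \<open>A v\<close> on both sides, and \<open>A v\<close> has
  at most \<open>\<delta> * n\<close> elements.\<close>

lemma walks_T:
  assumes "v \<notin> B"
  shows "walks v \<le> edge_count E (A v) (T v) + (1 + 2 * order_F) * (\<delta> * n)"
proof -
  have c: "card (nb u - B) \<le> 1 + card {w \<in> A v. E u w} + card {w \<in> T v. E u w}" if u: "u \<in> A v" for u
  proof -
    have "nb u - B \<subseteq> {v} \<union> {w \<in> A v. E u w} \<union> {w \<in> T v. E u w}"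
      using u E_less by (auto simp: A_def T_def)
    then have "card (nb u - B) \<le> card ({v} \<union> {w \<in> A v. E u w} \<union> {w \<in> T v. E u w})" by (intro card_mono) auto
    also have "\<dots> \<le> card {v} + card {w \<in> A v. E u w} + card {w \<in> T v. E u w}"
      by (meson card_Un_le add_le_mono1 order_trans)
    finally show ?thesis by simp
  qed
  have "walks v \<le> (\<Sum>u\<in>A v. 1 + card {w \<in> A v. E u w} + card {w \<in> T v. E u w})"
    unfolding walks_def by (intro sum_mono c)
  also have "\<dots> = card (A v) + edge_count E (A v) (A v) + edge_count E (A v) (T v)"
    by (simp add: sum_Suc sum.distrib edge_count_def)
  also have "\<dots> \<le> card (A v) + order_F * (card (A v) + card (A v)) + edge_count E (A v) (T v)"
    using edge_count_le[OF A_sub finite_A v_A] by simp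
  also have "\<dots> = edge_count E (A v) (T v) + (1 + 2 * order_F) * card (A v)" by (simp add: algebra_simps)
  finally have "real (walks v) \<le> real (edge_count E (A v) (T v) + (1 + 2 * order_F) * card (A v))" by (rule of_nat_mono)
  also have "\<dots> \<le> edge_count E (A v) (T v) + (1 + 2 * order_F) * (\<delta> * n)"
    using mult_left_mono[OF card_A[OF assms], of "1 + 2 * real order_F"] by (simp add: algebra_simps)
  finally show ?thesis .
qed

lemma inner_le:
  assumes "\<And>w. w < n \<Longrightarrow> w \<notin> B \<Longrightarrow> x w \<le> m"
  shows "(\<Sum>u\<in>nb v - B. \<Sum>w\<in>nb u - B. x w) \<le> m * walks v"
proof -
  have "(\<Sum>u\<in>nb v - B. \<Sum>w\<in>nb u - B. x w) \<le> (\<Sum>u\<in>nb v - B. \<Sum>w\<in>nb u - B. m)"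
    using E_less by (intro sum_mono assms) auto
  also have "\<dots> = m * walks v" by (simp add: walks_def A_def sum_distrib_left algebra_simps)
  finally show ?thesis .
qed

lemma max_outside:
  assumes "v < n" "v \<notin> B"
  obtains m where "m < n" "m \<notin> B" "\<And>w. w < n \<Longrightarrow> w \<notin> B \<Longrightarrow> x w \<le> x m"
proof -
  let ?S = "{..<n} - B"
  have "Max (x ` ?S) \<in> x ` ?S" using assms by (intro Max_in) auto
  then obtain m where m: "m \<in> ?S" "x m = Max (x ` ?S)" by auto
  have "x w \<le> x m" if "w < n" "w \<notin> B" for w unfolding m(2) using that by (intro Max_ge) auto
  then show thesis using that m(1) by auto
qed

text \<open>The leading coefficient is \<open>\<kappa> - 1\<close>, one less than in the lower bound
  for \<open>lam\<^sup>2\<close>. Everything gained for several cycles comes from this gap.\<close>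

lemma walks_sharp:
  assumes "v \<notin> B" and k\<kappa>: "\<And>i. i \<in> {1..t} \<Longrightarrow> k i \<le> \<kappa>"
  shows "walks v \<le> (\<kappa> - 1) * real n + (1 + 3 * order_F) * (\<delta> * n)"
proof -
  define d where "d = nat \<lfloor>\<delta> * n\<rfloor>"
  have d: "card (nb u) \<le> d" if "u \<notin> B" for u using low_degree[OF that] unfolding d_def by (simp add: le_nat_floor)
  have d': "real d \<le> \<delta> * n" unfolding d_def using \<delta>(1) by simp
  have "edge_count E (A v) (T v) \<le> (\<kappa> - 1) * (card (A v) + card (T v)) + (\<Sum>i=1..t. 2 * k i - 1) * d"
  proof (rule ccontr)
    assume "\<not> ?thesis"
    then have "\<exists>p. petals E v {1..t} k p \<and> (\<forall>i\<in>{1..t}. set (p i) \<subseteq> A v \<union> T v)"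
    proof (intro sharp_petals[where K = \<kappa> and d = d])
      show "card {w \<in> T v. E u w} \<le> d" if "u \<in> A v" for u
        using d[of u] that card_mono[of "nb u" "{w \<in> T v. E u w}"] by (force simp: A_def)
      show "card {u \<in> A v. E w u} \<le> d" if "w \<in> T v" for w
        using d[of w] that card_mono[of "nb w" "{u \<in> A v. E w u}"] by (force simp: T_def)
    qed (use k_ge1 k\<kappa> E_symp A_T v_A v_T A_sub[of v] in auto)
    then show False using no_flower by (auto simp: flower_def)
  qed
  also have "\<dots> \<le> (\<kappa> - 1) * n + order_F * d"
    unfolding order_F_def using card_A_T by (intro add_mono mult_le_mono sum_mono) auto
  finally have "real (edge_count E (A v) (T v)) \<le> real ((\<kappa> - 1) * n + order_F * d)" by (rule of_nat_mono)
  also have "\<dots> \<le> (\<kappa> - 1) * real n + order_F * (\<delta> * n)" using d' \<kappa>2 by (simp add: mult_left_mono of_nat_diff)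
  finally show ?thesis using walks_T[OF assms(1)] by (simp add: algebra_simps)
qed

lemma small_outside_multi:
  assumes "2 \<le> t" "w < n" "w \<notin> B"
  shows "x w \<le> 1000 * (\<kappa> + 2) * \<delta>"
proof -
  have k\<kappa>: "k i \<le> \<kappa>" if i: "i \<in> {1..t}" for i
  proof -
    \<comment> \<open>A second cycle contributes at least 1 to \<kappa>, so \<open>k i - 1\<close>
      is at most \<open>\<kappa> - 1\<close>.\<close>
    obtain j where j: "j \<in> {1..t}" "j \<noteq> i" using assms(1) i by (metis atLeastAtMost_iff le_refl numeral_le_one_iff one_le_numeral order_trans semiring_norm(69))
    have "(\<Sum>l\<in>{i, j}. k l - 1) \<le> \<kappa>" unfolding \<kappa> using i j by (intro sum_mono2) auto
    then show ?thesis using j k[OF i] k[OF j(1)] by simp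
  qed
  obtain m where m: "m < n" "m \<notin> B" "\<And>w. w < n \<Longrightarrow> w \<notin> B \<Longrightarrow> x w \<le> x m" using max_outside[OF assms(2,3)] by metis
  have "\<kappa> * n * x m \<le> x m * walks m + (\<kappa> + 1) * \<delta> * n"
    using low_weight_split[OF m(1,2)] inner_le[OF m(3), of m] by linarith
  also have "x m * walks m \<le> x m * ((\<kappa> - 1) * real n + (1 + 3 * order_F) * (\<delta> * n))"
    using walks_sharp[OF m(2) k\<kappa>] x_nonneg by (intro mult_left_mono)
  finally have "\<kappa> * n * x m \<le> x m * ((\<kappa> - 1) * real n + (1 + 3 * order_F) * (\<delta> * n)) + (\<kappa> + 1) * \<delta> * n" by simp
  moreover have "(1 + 3 * order_F) * \<delta> \<le> 1 / 2" using \<delta>_small \<delta>(1) by (simp add: algebra_simps)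
  then have "x m * ((1 + 3 * order_F) * \<delta> * n) \<le> x m * (1 / 2 * n)" using x_nonneg by (intro mult_left_mono mult_right_mono) auto
  \<comment> \<open>The coefficients \<kappa> and \<open>\<kappa> - 1\<close> leave
    \<open>n * x m\<close>; half of it pays for the error term proportional to
    \<open>x m\<close>.\<close>
  ultimately have "real n * (x m / 2) \<le> real n * ((\<kappa> + 1) * \<delta>)" using \<kappa>2 by (simp add: algebra_simps of_nat_diff)
  then have "x m / 2 \<le> (\<kappa> + 1) * \<delta>" using n_pos by (subst (asm) mult_le_cancel_left_pos) auto
  moreover have "2 * (real \<kappa> + 1) * \<delta> \<le> 1000 * (real \<kappa> + 2) * \<delta>" using \<delta>(1) by (intro mult_right_mono) auto
  ultimately have "x m \<le> 1000 * (\<kappa> + 2) * \<delta>" by (simp add: algebra_simps)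
  then show ?thesis using m(3)[OF assms(2,3)] by linarith
qed

end

text \<open>
  For a single cycle the bound on \<open>walks v\<close> is only about \<open>\<kappa> * n\<close>, which is not smaller than \<open>\<lambda>\<^sup>2\<close>. But if an
  entry \<open>x v\<^sub>0\<close> is not small, this bound is almost attained at \<open>v\<^sub>0\<close> and then at almost all vertices,
  so that almost all pairs of vertices are joined by a walk of length two avoiding \<open>B\<close>. As degrees
  outside \<open>B\<close> are small, such walks can be concatenated greedily to a cycle of length \<open>2 * k 1\<close>.
\<close>

locale single_cycle_graph = large_extremal_graph +
  fixes v\<^sub>0 :: nat
  assumes t1: "t = 1" and v0: "v\<^sub>0 < n" "v\<^sub>0 \<notin> B" and v0_max: "w < n \<Longrightarrow> w \<notin> B \<Longrightarrow> x w \<le> x v\<^sub>0"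
    and v0_big: "1000 * (\<kappa> + 2) * \<delta> < x v\<^sub>0"
begin

abbreviation \<alpha> :: real where "\<alpha> \<equiv> x v\<^sub>0"

lemma k1: "k 1 = \<kappa> + 1" using \<kappa> t1 k[of 1] by simp

lemma \<alpha>_pos: "0 < \<alpha>" by (rule x_pos[OF v0(1)])

lemma flower_single:
  assumes "is_path E p" "length p = 2 * k 1 - 1" "E v (hd p)" "E v (last p)" "v \<notin> set p"
  shows False
proof -
  have "petals E v {1..t} k (\<lambda>_. p)" using assms t1 by (auto simp: petals_def)
  then show False using no_flower by (auto simp: flower_def)
qed

lemma edge_count_A_T: "edge_count E (A v) (T v) \<le> \<kappa> * (card (A v) + card (T v))"
proof (rule ccontr)
  assume "\<not> ?thesis"
  then have "(k 1 - 1) * (card (A v) + card (T v)) < edge_count E (A v) (T v)" using k1 by simp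
  then obtain p where p: "is_path E p" "length p = 2 * k 1 - 1" "hd p \<in> A v" "last p \<in> A v" "set p \<subseteq> A v \<union> T v"
    using alternating_path_if_dense[OF finite_A finite_T A_T E_symp, of "k 1" v "k 1"] k[of 1] t1 by auto
  show False by (rule flower_single[OF p(1,2), of v]) (use p A_sub v_A v_T in auto)
qed

lemma walks_le_T: "v \<notin> B \<Longrightarrow> walks v \<le> \<kappa> * card (T v) + n / 500"
proof -
  assume v: "v \<notin> B"
  have "real (edge_count E (A v) (T v)) \<le> real (\<kappa> * (card (A v) + card (T v)))" using edge_count_A_T by (rule of_nat_mono)
  also have "\<dots> \<le> \<kappa> * (\<delta> * n) + \<kappa> * card (T v)" using mult_left_mono[OF card_A[OF v], of \<kappa>] by (simp add: algebra_simps)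
  finally have "walks v \<le> \<kappa> * card (T v) + (1 + 2 * order_F + \<kappa>) * \<delta> * n" using walks_T[OF v] by (simp add: algebra_simps)
  moreover have "(1 + 2 * order_F + \<kappa>) * \<delta> \<le> 1 / 500" using \<delta>_small by (simp add: algebra_simps)
  then have "(1 + 2 * order_F + \<kappa>) * \<delta> * n \<le> 1 / 500 * n" by (intro mult_right_mono) auto
  ultimately show ?thesis by simp
qed

lemma inner_ge: "v < n \<Longrightarrow> v \<notin> B \<Longrightarrow> \<kappa> * n * x v - \<alpha> * n / 1000 \<le> (\<Sum>u\<in>nb v - B. \<Sum>w\<in>nb u - B. x w)"
proof -
  assume v: "v < n" "v \<notin> B"
  have "(\<kappa> + 1) * \<delta> \<le> \<alpha> / 1000" using v0_big \<delta>(1) by (simp add: algebra_simps)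
  then have "(\<kappa> + 1) * \<delta> * n \<le> \<alpha> / 1000 * n" by (intro mult_right_mono) auto
  then show ?thesis using low_weight_split[OF v] by simp
qed

text \<open>Each walk avoiding \<open>B\<close> weighs at most \<alpha>, so a large entry forces
  many walks; as there are only about \<kappa> of them per vertex of \<open>T v\<close>, the second
  neighbourhood must be large.\<close>

lemma card_T_ge:
  assumes v: "v < n" "v \<notin> B" and c: "c * \<alpha> \<le> x v" 
  shows "(c - 3 / 1000) * n \<le> card (T v)"
proof -
  have "\<kappa> * n * x v - \<alpha> * n / 1000 \<le> \<alpha> * walks v"
    using inner_ge[OF v] inner_le[OF v0_max, of v] by linarith
  also have "\<dots> \<le> \<alpha> * (\<kappa> * card (T v) + n / 500)" using walks_le_T[OF v(2)] \<alpha>_pos by (intro mult_left_mono) auto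
  finally have "\<kappa> * n * x v \<le> \<alpha> * (\<kappa> * card (T v) + 3 * n / 1000)" by (simp add: algebra_simps)
  moreover have "\<kappa> * n * (c * \<alpha>) \<le> \<kappa> * n * x v" using c by (intro mult_left_mono) auto
  ultimately have "\<alpha> * (\<kappa> * n * c) \<le> \<alpha> * (\<kappa> * card (T v) + 3 * n / 1000)" by (simp add: algebra_simps)
  then have "\<kappa> * n * c \<le> \<kappa> * card (T v) + 3 * n / 1000" using \<alpha>_pos by (subst (asm) mult_le_cancel_left_pos) auto
  moreover have "1 * (3 * n / 1000) \<le> \<kappa> * (3 * n / 1000)" using \<kappa>2 by (intro mult_right_mono) auto
  ultimately have "real \<kappa> * ((c - 3 / 1000) * n) \<le> real \<kappa> * real (card (T v))" by (simp add: algebra_simps)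
  then show ?thesis using \<kappa>2 by (subst (asm) mult_le_cancel_left_pos) auto
qed

text \<open>
  Hubs with few common neighbours with \<open>v\<^sub>0\<close> are needed to keep the last two middle vertices of the
  cycle distinct.
\<close>

definition low :: "nat set" where "low = {w \<in> T v\<^sub>0. x w < 19 / 20 * \<alpha>}"
definition heavy :: "nat set" where "heavy = {w \<in> T v\<^sub>0. 40 * \<kappa> < card {u \<in> A v\<^sub>0. E w u}}"
definition hubs :: "nat set" where "hubs = T v\<^sub>0 - low - heavy"

lemma finite_low [simp]: "finite low" "finite heavy" "finite hubs" by (simp_all add: low_def heavy_def hubs_def)

text \<open>A deficit count. The walks from \<open>v\<^sub>0\<close> together weigh at most
  \<open>3 * \<alpha> * n / 1000\<close> less than \<alpha> times the largest possible number of
  them, and each vertex of \<open>low\<close> ends at least one walk with deficit at least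
  \<open>\<alpha> / 20\<close>.\<close>

lemma card_low: "card low \<le> 6 / 100 * n"
proof -
  have "card low = (\<Sum>w\<in>low. 1)" by simp
  also have "\<dots> \<le> (\<Sum>w\<in>low. card {u \<in> A v\<^sub>0. E w u})"
  proof (rule sum_mono)
    fix w assume "w \<in> low"
    then obtain u where "u \<in> A v\<^sub>0" "E u w" by (auto simp: low_def T_def)
    then have "u \<in> {u \<in> A v\<^sub>0. E w u}" using E_sym by auto
    moreover have "finite {u \<in> A v\<^sub>0. E w u}" by simp
    ultimately have "0 < card {u \<in> A v\<^sub>0. E w u}" by (auto simp only: card_gt_0_iff)
    then show "1 \<le> card {u \<in> A v\<^sub>0. E w u}" by simp
  qed
  also have "\<dots> = edge_count E (A v\<^sub>0) low" using edge_count_flip[OF _ _ E_symp, of "A v\<^sub>0" low] by (simp add: edge_count_def)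
  finally have 1: "card low \<le> edge_count E (A v\<^sub>0) low" .
  have "\<alpha> / 20 * card low \<le> \<alpha> / 20 * edge_count E (A v\<^sub>0) low" using 1 \<alpha>_pos by (intro mult_left_mono) auto
  also have "\<dots> = (\<Sum>u\<in>A v\<^sub>0. \<Sum>w\<in>{w \<in> low. E u w}. \<alpha> / 20)" by (simp add: edge_count_def sum_distrib_left algebra_simps)
  also have "\<dots> \<le> (\<Sum>u\<in>A v\<^sub>0. \<Sum>w\<in>{w \<in> low. E u w}. \<alpha> - x w)"
    by (intro sum_mono) (auto simp: low_def)
  also have "\<dots> \<le> (\<Sum>u\<in>A v\<^sub>0. \<Sum>w\<in>nb u - B. \<alpha> - x w)"
    using v0_max E_less by (intro sum_mono sum_mono2) (auto simp: low_def T_def)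
  also have "\<dots> = \<alpha> * walks v\<^sub>0 - (\<Sum>u\<in>A v\<^sub>0. \<Sum>w\<in>nb u - B. x w)"
    by (simp add: sum_subtractf walks_def sum_distrib_left algebra_simps)
  also have "\<dots> \<le> \<alpha> * (\<kappa> * card (T v\<^sub>0) + n / 500) - (\<kappa> * n * \<alpha> - \<alpha> * n / 1000)"
    using inner_ge[OF v0] walks_le_T[OF v0(2)] \<alpha>_pos unfolding A_def by (intro diff_mono mult_left_mono) auto
  also have "\<dots> \<le> \<alpha> * (\<kappa> * n + n / 500) - (\<kappa> * n * \<alpha> - \<alpha> * n / 1000)"
  proof -
    have "real \<kappa> * real (card (T v\<^sub>0)) \<le> real \<kappa> * real n" using card_A_T[of v\<^sub>0] by (intro mult_left_mono) auto
    then show ?thesis using \<alpha>_pos by (intro diff_mono mult_left_mono add_mono) auto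
  qed
  also have "\<dots> = \<alpha> / 20 * (6 / 100 * n)" by (simp add: algebra_simps)
  finally show ?thesis using \<alpha>_pos by (subst (asm) mult_le_cancel_left_pos) auto
qed

lemma card_heavy: "card heavy \<le> n / 40"
proof -
  have "40 * \<kappa> * card heavy = (\<Sum>w\<in>heavy. 40 * \<kappa>)" by simp
  also have "\<dots> \<le> (\<Sum>w\<in>heavy. card {u \<in> A v\<^sub>0. E w u})" by (intro sum_mono) (auto simp: heavy_def)
  also have "\<dots> \<le> (\<Sum>w\<in>T v\<^sub>0. card {u \<in> A v\<^sub>0. E w u})" by (intro sum_mono2) (auto simp: heavy_def)
  also have "\<dots> = edge_count E (A v\<^sub>0) (T v\<^sub>0)" using edge_count_flip[OF _ _ E_symp, of "A v\<^sub>0" "T v\<^sub>0"] by (simp add: edge_count_def)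
  also have "\<dots> \<le> \<kappa> * (card (A v\<^sub>0) + card (T v\<^sub>0))" by (rule edge_count_A_T)
  also have "\<dots> \<le> \<kappa> * n" using card_A_T by simp
  finally have "40 * card heavy \<le> n" using \<kappa>2 by simp
  then show ?thesis by linarith
qed

lemma hub: "w \<in> hubs \<Longrightarrow> w < n \<and> w \<notin> B \<and> w \<noteq> v\<^sub>0 \<and> w \<in> T v\<^sub>0"
  by (auto simp: hubs_def T_def)

lemma card_hubs: "9 / 10 * n \<le> card hubs"
proof -
  have "997 / 1000 * n \<le> card (T v\<^sub>0)" using card_T_ge[OF v0, of 1] by simp
  moreover have "card (T v\<^sub>0) - card low \<le> card (T v\<^sub>0 - low)" by (rule diff_card_le_card_Diff) simp
  moreover have "card (T v\<^sub>0 - low) - card heavy \<le> card hubs" unfolding hubs_def by (rule diff_card_le_card_Diff) simp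
  ultimately show ?thesis using card_low card_heavy by linarith
qed

lemma card_hubs_T:
  assumes "w \<in> hubs" shows "8 / 10 * n \<le> card (hubs \<inter> T w)"
proof -
  have "19 / 20 * \<alpha> \<le> x w" using assms by (auto simp: hubs_def low_def)
  then have 1: "947 / 1000 * n \<le> card (T w)" using card_T_ge[of w "19 / 20"] hub[OF assms] by simp
  have "card hubs + card (T w) = card (hubs \<union> T w) + card (hubs \<inter> T w)" by (rule card_Un_Int) auto
  moreover have "card (hubs \<union> T w) \<le> card {..<n}" using hub by (intro card_mono) (auto simp: T_def)
  ultimately have "real (card hubs) + real (card (T w)) \<le> real n + real (card (hubs \<inter> T w))" by simp
  then show ?thesis using 1 card_hubs by linarith
qed

text \<open>The path runs from hub to hub through middle vertices such as \<open>m\<close>. The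
  additional vertex \<open>m'\<close> is kept in reserve for closing the cycle at
  \<open>v\<^sub>0\<close>.\<close>

lemma extend_path:
  assumes p: "is_path E p" "p \<noteq> []" "set p \<subseteq> {..<n} - B" "v\<^sub>0 \<notin> set p" "length p \<le> order_F" "last p \<in> hubs"
  shows "\<exists>m v. v \<in> hubs \<and> is_path E (p @ [m, v]) \<and> m < n \<and> m \<notin> B \<and> m \<noteq> v\<^sub>0 \<and>
    (\<exists>m'. E v\<^sub>0 m' \<and> E m' v \<and> m' \<notin> set (p @ [m, v]))"
proof -
  let ?w = "last p"
  define Y where "Y = insert v\<^sub>0 (set p)"
  define Z where "Z = {u \<in> A v\<^sub>0. E ?w u}"
  have Y: "finite Y" "card Y \<le> order_F + 1" "Y \<inter> B = {}"
    using p(3,5) v0 card_length[of p] by (auto simp: Y_def card_insert_if)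
  have Z: "finite Z" "card Z \<le> 40 * \<kappa>" "Z \<inter> B = {}"
    using p(6) by (auto simp: Z_def A_def hubs_def heavy_def)
  \<comment> \<open>Avoiding the neighbours of \<open>Y\<close> keeps \<open>m\<close> and
    \<open>m'\<close> off the path. Avoiding those of \<open>Z\<close> gives
    \<open>m \<noteq> m'\<close>, because a vertex serving as both would lie in \<open>Z\<close>. As
    \<open>Y\<close> and \<open>Z\<close> are bounded and outside \<open>B\<close>, only a small
    fraction of the vertices is excluded.\<close>
  define bad where "bad = Y \<union> (\<Union>y\<in>Y \<union> Z. nb y)"
  have "card bad \<le> card Y + card (\<Union>y\<in>Y \<union> Z. nb y)" unfolding bad_def by (rule card_Un_le)
  also have "\<dots> \<le> card Y + (\<Sum>y\<in>Y \<union> Z. card (nb y))" using Y Z by (intro add_left_mono card_UN_le) auto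
  finally have "real (card bad) \<le> real (card Y + (\<Sum>y\<in>Y \<union> Z. card (nb y)))" by (rule of_nat_mono)
  also have "\<dots> = card Y + (\<Sum>y\<in>Y \<union> Z. real (card (nb y)))" by simp
  also have "\<dots> \<le> card Y + (\<Sum>y\<in>Y \<union> Z. \<delta> * n)" using Y Z by (intro add_left_mono sum_mono low_degree) auto
  also have "\<dots> = card Y + card (Y \<union> Z) * (\<delta> * n)" by simp
  also have "\<dots> \<le> real (order_F + 1) + real (order_F + 1 + 40 * \<kappa>) * (\<delta> * n)"
  proof -
    have "card (Y \<union> Z) \<le> order_F + 1 + 40 * \<kappa>" using card_Un_le[of Y Z] Y Z by linarith
    then show ?thesis using Y(2) \<delta>(1) by (intro add_mono mult_right_mono of_nat_mono) auto
  qed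
  also have "\<dots> = real (order_F + 1) + (\<delta> * order_F + \<delta> + 40 * (\<delta> * \<kappa>)) * n" by (simp add: algebra_simps)
  also have "\<dots> \<le> real n / 4 + (1 / 10) * n"
    using n_large \<delta>_small by (intro add_mono mult_right_mono) auto
  finally have "real (card bad) < card (hubs \<inter> T ?w)" using card_hubs_T[OF p(6)] n_pos by simp
  then have "\<not> hubs \<inter> T ?w \<subseteq> bad" using card_mono[of bad "hubs \<inter> T ?w"] Y Z by (auto simp: bad_def)
  then obtain v where v: "v \<in> hubs" "v \<in> T ?w" "v \<notin> bad" by auto
  obtain m where m: "m \<in> A ?w" "E m v" using v(2) by (auto simp: T_def)
  obtain m' where m': "m' \<in> A v\<^sub>0" "E m' v" using hub[OF v(1)] by (auto simp: T_def)
  have nY: "y \<notin> Y" if "E y v" for y using v(3) that by (auto simp: bad_def)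
  have nZ: "y \<notin> Z" if "E y v" for y using v(3) that by (auto simp: bad_def)
  have vp: "v \<notin> set p" using v(3) by (auto simp: bad_def Y_def)
  have mp: "m \<notin> set p" "m \<noteq> v\<^sub>0" "m' \<notin> set p" using nY m m' by (auto simp: Y_def)
  have "m \<noteq> m'" using nZ[OF m'(2)] m m' by (auto simp: Z_def A_def)
  moreover have "m \<noteq> v" "m' \<noteq> v" using m m' E_irrefl by auto
  moreover have "is_path E (p @ [m, v])" using m vp mp \<open>m \<noteq> v\<close> p by (intro is_path_snoc2) (auto simp: A_def)
  ultimately show ?thesis using m m' v(1) mp E_less by (intro exI[of _ m] exI[of _ v]) (auto simp: A_def)
qed

text \<open>For \<open>j = 1\<close> the hub may be reachable from \<open>v\<^sub>0\<close> only
  through the vertex already used; a spare middle vertex is guaranteed from the first extension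
  on.\<close>

lemma hub_path:
  assumes "1 \<le> j" "j \<le> \<kappa>"
  shows "\<exists>p. is_path E p \<and> length p = 2 * j \<and> E v\<^sub>0 (hd p) \<and> set p \<subseteq> {..<n} - B \<and> v\<^sub>0 \<notin> set p \<and> last p \<in> hubs \<and>
    (2 \<le> j \<longrightarrow> (\<exists>m'. E v\<^sub>0 m' \<and> E m' (last p) \<and> m' \<notin> set p))"
  using assms
proof (induction j rule: nat_induct_at_least)
  case base
  have "hubs \<noteq> {}" using card_hubs n_pos by auto
  then obtain v where v: "v \<in> hubs" by auto
  obtain m where m: "m \<in> A v\<^sub>0" "E m v" using hub[OF v] by (auto simp: T_def)
  have "m \<noteq> v" "m \<noteq> v\<^sub>0" using m E_irrefl v_A by auto
  then show ?case using m v hub[OF v] E_less by (intro exI[of _ "[m, v]"]) (auto simp: is_path_def A_def)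
next
  case (Suc j)
  then obtain p where p: "is_path E p" "length p = 2 * j" "E v\<^sub>0 (hd p)" "set p \<subseteq> {..<n} - B" "v\<^sub>0 \<notin> set p" "last p \<in> hubs" by auto
  have ne: "p \<noteq> []" using p(2) Suc(1) by auto
  have "2 * k 1 \<le> order_F" unfolding order_F_def using t1 by simp
  then have len: "length p \<le> order_F" using p(2) Suc.prems k1 by simp
  obtain m v where mv: "v \<in> hubs" "is_path E (p @ [m, v])" "m < n" "m \<notin> B" "m \<noteq> v\<^sub>0"
    "\<exists>m'. E v\<^sub>0 m' \<and> E m' v \<and> m' \<notin> set (p @ [m, v])" using extend_path[OF p(1) ne p(4,5) len p(6)] by blast
  then show ?case using p ne hub[OF mv(1)] by (intro exI[of _ "p @ [m, v]"]) auto
qed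

lemma contradiction: False
proof -
  obtain p m where p: "is_path E p" "length p = 2 * \<kappa>" "E v\<^sub>0 (hd p)" "v\<^sub>0 \<notin> set p" "E v\<^sub>0 m" "E m (last p)" "m \<notin> set p"
    using hub_path[of \<kappa>] \<kappa>2 by auto
  have ne: "p \<noteq> []" using p(2) \<kappa>2 by auto
  \<comment> \<open>The result has \<open>2 * \<kappa> + 1 = 2 * k 1 - 1\<close> vertices and both
    ends adjacent to \<open>v\<^sub>0\<close>: a petal.\<close>
  have "is_path E (p @ [m])" using p ne E_sym by (auto simp: is_path_def successively_append_iff)
  moreover have "v\<^sub>0 \<noteq> m" using p E_irrefl by auto
  ultimately show False using p ne k1 by (intro flower_single[of "p @ [m]" v\<^sub>0]) auto
qed

end

context large_extremal_graph
begin

lemma small_outside: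
  assumes w: "w < n" "w \<notin> B"
  shows "x w \<le> 1000 * (\<kappa> + 2) * \<delta>"
proof (cases "2 \<le> t")
  case True
  then show ?thesis using small_outside_multi w by simp
next
  case False
  then have t1: "t = 1" using t by simp
  obtain m where m: "m < n" "m \<notin> B" "\<And>w. w < n \<Longrightarrow> w \<notin> B \<Longrightarrow> x w \<le> x m" using max_outside[OF w] by metis
  show ?thesis
  proof (rule ccontr)
    assume "\<not> ?thesis"
    moreover have "real (1000 * (\<kappa> + 2)) * \<delta> = 1000 * (real \<kappa> + 2) * \<delta>" by simp
    ultimately have big: "1000 * (real \<kappa> + 2) * \<delta> < x m" using m(3)[OF w] by linarith
    interpret single_cycle_graph t k \<kappa> n E x z \<delta> b m by unfold_locales (fact t1, fact m(1), fact m(2), erule (1) m(3), fact big)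
    show False by (rule contradiction)
  qed
qed

end

section \<open>The hubs and their common neighbourhood\<close>

locale tiny_extremal_graph = large_extremal_graph +
  fixes e :: real
  assumes e_def: "e = (1000 * (real \<kappa> + 2) * (2 * real order_F + 1) + 2) * \<delta>"
    and e_small: "200 * (2 * real \<kappa> + 2)\<^sup>2 * (2 * real order_F + 1) * e \<le> 1"
begin

lemma \<delta>_le_e: "\<delta> \<le> e"
proof -
  have "1 * \<delta> \<le> (1000 * (real \<kappa> + 2) * (2 * real order_F + 1) + 2) * \<delta>" using \<delta>(1) by (intro mult_right_mono) auto
  then show ?thesis by (simp add: e_def)
qed

lemma e_pos: "0 < e" using \<delta>_le_e \<delta>(1) by linarith

lemma e_bounds: "200 * e \<le> 1" "800 * \<kappa> * e \<le> 1" "800 * \<kappa> * order_F * e \<le> 1"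
proof -
  have sq: "4 * real \<kappa> \<le> (2 * real \<kappa> + 2)\<^sup>2" "1 \<le> (2 * real \<kappa> + 2)\<^sup>2" by (simp_all add: power2_eq_square algebra_simps)
  have *: "a * e \<le> 1" if "a \<le> 200 * (2 * real \<kappa> + 2)\<^sup>2 * (2 * real order_F + 1)" for a
    using mult_right_mono[OF that, of e] e_pos e_small by linarith
  have "200 * 1 * 1 \<le> 200 * (2 * real \<kappa> + 2)\<^sup>2 * (2 * real order_F + 1)"
    using sq by (intro mult_mono) auto
  then show "200 * e \<le> 1" using *[of 200] by simp
  have "200 * (4 * real \<kappa>) * 1 \<le> 200 * (2 * real \<kappa> + 2)\<^sup>2 * (2 * real order_F + 1)"
    using sq by (intro mult_mono) auto
  then show "800 * \<kappa> * e \<le> 1" using *[of "800 * \<kappa>"] by simp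
  have "200 * (4 * real \<kappa>) * order_F \<le> 200 * (2 * real \<kappa> + 2)\<^sup>2 * (2 * real order_F + 1)"
    using sq by (intro mult_mono) auto
  then show "800 * \<kappa> * order_F * e \<le> 1" using *[of "800 * \<kappa> * order_F"] by simp
qed

text \<open>The main part of \<open>e\<close> is the bound of \<open>small_outside\<close> times the
  factor \<open>2 * order_F + 1\<close> from the number of walks. Stating the result with
  \<open>e - \<delta>\<close> keeps a reserve for the exceptional vertices in later sums over
  \<open>bw\<close>.\<close>

lemma weight_le:
  assumes v: "v < n"
  shows "\<kappa> * n * x v \<le> (\<Sum>u\<in>nb v - B. bw u) + (e - \<delta>) * n"
proof -
  let ?c = "1000 * (real \<kappa> + 2) * \<delta>"
  have c: "0 \<le> ?c" using \<delta>(1) by simp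
  have "walks v \<le> (\<Sum>u\<in>nb v. card (nb u))"
    unfolding walks_def A_def by (rule order_trans[OF sum_mono[OF card_mono] sum_mono2]) auto
  also have "\<dots> \<le> (2 * order_F + 1) * n" by (rule walks_le_all)
  finally have "real (walks v) \<le> real ((2 * order_F + 1) * n)" by (rule of_nat_mono)
  then have "?c * walks v \<le> ?c * ((2 * real order_F + 1) * n)" using c by (intro mult_left_mono) (auto simp: algebra_simps)
  moreover have "(\<Sum>u\<in>nb v - B. \<Sum>w\<in>nb u - B. x w) \<le> ?c * walks v"
  proof (rule inner_le)
    show "x w \<le> ?c" if "w < n" "w \<notin> B" for w using small_outside[OF that] by (simp add: algebra_simps)
  qed
  moreover have "?c * ((2 * real order_F + 1) * n) = (e - 2 * \<delta>) * n" by (simp add: e_def algebra_simps)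
  moreover have "0 \<le> \<delta> * n" using \<delta>(1) by simp
  ultimately show ?thesis using weight_split[OF v] by (simp add: algebra_simps)
qed

text \<open>Apart from few exceptions a neighbour contributes at most \<kappa> through
  \<open>bw\<close>, so an entry \<open>x v\<close> requires about \<open>n * x v\<close>
  neighbours. This converts weight into degree.\<close>

lemma degree_ge:
  assumes v: "v < n"
  shows "n * x v \<le> card (nb v) + e * n"
proof -
  have "real (card (nb v - B)) \<le> card (nb v)" by (intro of_nat_mono card_mono) auto
  then have "\<kappa> * real (card (nb v - B)) \<le> \<kappa> * real (card (nb v))" by (intro mult_left_mono) auto
  moreover have "0 \<le> \<delta> * n" "0 \<le> e * n" using \<delta>(1) e_pos by auto
  ultimately have "\<kappa> * n * x v \<le> \<kappa> * real (card (nb v)) + e * n"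
    using weight_le[OF v] sum_bw_le[of "nb v - B"] by (simp add: algebra_simps)
  also have "e * n \<le> \<kappa> * (e * n)" using \<kappa>2 \<open>0 \<le> e * n\<close> mult_right_mono[of 1 "real \<kappa>" "e * n"] by simp
  finally have "real \<kappa> * (n * x v) \<le> real \<kappa> * (card (nb v) + e * n)" by (simp add: algebra_simps)
  then show ?thesis using \<kappa>2 by (subst (asm) mult_le_cancel_left_pos) auto
qed

text \<open>Averaging at \<open>z\<close>, where the entry is 1: the sum runs over at least half of
  all vertices, so a loss of \<open>4 * e\<close> at each unexceptional one would amount to more
  than the permitted error.\<close>

lemma exists_hub_neighbour: "\<exists>u. u \<in> nb z - B \<and> card (nb u \<inter> B) \<le> \<kappa> \<and> \<kappa> - 4 * e \<le> bw u"
proof (rule ccontr)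
  assume no: "\<not> ?thesis"
  let ?X = "{u. \<kappa> < card (nb u \<inter> B)}"
  have X: "finite ?X" "card ?X \<le> 2 ^ card B * order_F" using exceptional_card[OF finite_B] by auto
  have "bw u \<le> (\<kappa> - 4 * e) + (if u \<in> ?X then real b + 1 else 0)" if u: "u \<in> nb z - B" for u
  proof (cases "u \<in> ?X")
    case True
    have "card (nb u \<inter> B) \<le> card B" by (intro card_mono) auto
    then have "bw u \<le> b" using bw_le[of u] card_B by linarith
    moreover have "4 * e \<le> 1" using e_bounds by linarith
    ultimately show ?thesis using True by simp
  next
    case False
    then have "card (nb u \<inter> B) \<le> \<kappa>" by simp
    then have "bw u < \<kappa> - 4 * e" using no u by (meson not_le)
    then show ?thesis using False by simp
  qed
  then have "(\<Sum>u\<in>nb z - B. bw u) \<le> (\<Sum>u\<in>nb z - B. (\<kappa> - 4 * e) + (if u \<in> ?X then real b + 1 else 0))" by (rule sum_mono)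
  also have "\<dots> = (\<kappa> - 4 * e) * card (nb z - B) + (b + 1) * card ((nb z - B) \<inter> ?X)"
    by (simp add: sum.distrib sum.If_cases sum_subtractf algebra_simps)
  also have "real ((b + 1) * card ((nb z - B) \<inter> ?X)) \<le> real ((b + 1) * (2 ^ b * order_F))"
  proof (intro of_nat_mono mult_le_mono2)
    have "card ((nb z - B) \<inter> ?X) \<le> card ?X" using X by (intro card_mono) auto
    also have "\<dots> \<le> 2 ^ b * order_F" using X(2) card_B by (meson less_imp_le mult_le_mono1 one_le_numeral order_trans power_increasing)
    finally show "card ((nb z - B) \<inter> ?X) \<le> 2 ^ b * order_F" .
  qed
  also have "\<dots> \<le> \<delta> * n / 4" using large(2) by simp
  finally have 1: "(\<Sum>u\<in>nb z - B. bw u) \<le> (\<kappa> - 4 * e) * card (nb z - B) + \<delta> * n / 4" by simp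
  have "real b \<le> real ((b + 1) * (2 ^ b * order_F))"
  proof (rule of_nat_mono)
    have "b * 1 \<le> (b + 1) * (2 ^ b * order_F)" using order_F_pos by (intro mult_le_mono) auto
    then show "b \<le> (b + 1) * (2 ^ b * order_F)" by simp
  qed
  then have bn: "real b \<le> \<delta> * n / 4" using large(2) by linarith
  have "card (nb z) - card B \<le> card (nb z - B)" by (rule diff_card_le_card_Diff) simp
  then have "card (nb z) - real b \<le> card (nb z - B)" using card_B by linarith
  then have "n - e * n - \<delta> * n / 4 \<le> card (nb z - B)" using degree_ge[OF z(1)] z(2) bn by simp
  moreover have "e * n \<le> n / 200" "\<delta> * n \<le> n / 1000"
    using e_bounds(1) \<delta>_small(3) mult_right_mono[of e "1 / 200" "real n"] mult_right_mono[of \<delta> "1 / 1000" "real n"] by auto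
  ultimately have half: "n / 2 \<le> card (nb z - B)" by linarith
  have "\<kappa> * real (card (nb z - B)) \<le> \<kappa> * real n"
    using card_nb_le[of z] card_mono[of "nb z" "nb z - B"] by (intro mult_left_mono) auto
  moreover have "4 * e * (n / 2) \<le> 4 * e * card (nb z - B)" using half e_pos by (intro mult_left_mono) auto
  moreover have "0 < e * n" "0 < \<delta> * n" using e_pos \<delta>(1) n_pos by auto
  ultimately show False using 1 weight_le[OF z(1)] z(2) by (simp add: algebra_simps)
qed

text \<open>At most \<kappa> numbers, none above 1, have sum at least
  \<open>\<kappa> - 4 * e\<close>. Hence there are exactly \<kappa> of them, and none is more than
  \<open>4 * e\<close> below 1.\<close>

lemma exists_hubs:
  "\<exists>R. R \<subseteq> {..<n} \<and> card R = \<kappa> \<and> (\<forall>r\<in>R. 1 - 4 * e \<le> x r)"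
proof -
  obtain u where u: "card (nb u \<inter> B) \<le> \<kappa>" "\<kappa> - 4 * e \<le> bw u" using exists_hub_neighbour by blast
  let ?R = "nb u \<inter> B"
  have "real \<kappa> - 1 < card ?R" using u(2) bw_le[of u] e_bounds(1) by linarith
  then have c: "card ?R = \<kappa>" using u(1) by linarith
  have "1 - 4 * e \<le> x r" if r: "r \<in> ?R" for r
  proof -
    have "bw u = x r + (\<Sum>w\<in>?R - {r}. x w)" unfolding bw_def using r by (intro sum.remove) auto
    also have "(\<Sum>w\<in>?R - {r}. x w) \<le> (\<Sum>w\<in>?R - {r}. 1)" by (intro sum_mono x_le1) (auto simp: B_def)
    also have "(\<Sum>w\<in>?R - {r}. 1) = real \<kappa> - 1" using r c \<kappa>2 by (simp add: of_nat_diff)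
    finally show ?thesis using u(2) by simp
  qed
  moreover have "?R \<subseteq> {..<n}" by (auto simp: B_def)
  ultimately show ?thesis using c by blast
qed

lemma complete_to_hubs:
  "\<exists>R. R \<subseteq> {..<n} \<and> card R = \<kappa> \<and> (\<forall>r\<in>R. \<forall>v<n. v \<notin> R \<longrightarrow> E r v)"
proof -
  obtain R where R: "R \<subseteq> {..<n}" "card R = \<kappa>" and xR: "\<And>r. r \<in> R \<Longrightarrow> 1 - 4 * e \<le> x r" using exists_hubs by blast
  have finR [simp]: "finite R" using R(1) finite_subset by blast
  have en: "0 < e * n" using e_pos n_pos by simp
  have miss: "card ({..<n} - nb r) \<le> 5 * e * n" if r: "r \<in> R" for r
  proof -
    have "n * (1 - 4 * e) \<le> n * x r" using xR[OF r] by (intro mult_left_mono) auto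
    also have "\<dots> \<le> card (nb r) + e * n" using R r by (intro degree_ge) auto
    finally have "n - 5 * e * n \<le> card (nb r)" by (simp add: algebra_simps)
    moreover have "card ({..<n} - nb r) = n - card (nb r)" using nb_sub by (subst card_Diff_subset) auto
    ultimately show ?thesis using card_nb_le[of r] by (simp add: of_nat_diff)
  qed
  \<comment> \<open>The hubs themselves belong to \<open>M\<close>, no vertex being adjacent to
    itself; therefore \<open>S\<close> below is \<open>M - R\<close>.\<close>
  define M where "M = (\<Union>r\<in>R. {..<n} - nb r)"
  have finM [simp]: "finite M" by (simp add: M_def)
  have cM: "card M \<le> 5 * \<kappa> * e * n"
  proof -
    have "card M \<le> (\<Sum>r\<in>R. card ({..<n} - nb r))" unfolding M_def by (intro card_UN_le) simp
    then have "real (card M) \<le> (\<Sum>r\<in>R. real (card ({..<n} - nb r)))" by (metis of_nat_mono of_nat_sum)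
    also have "\<dots> \<le> (\<Sum>r\<in>R. 5 * e * n)" by (intro sum_mono miss)
    finally show ?thesis using R(2) by (simp add: algebra_simps)
  qed
  \<comment> \<open>A neighbour of \<open>w\<close> outside \<open>M\<close> is adjacent to all of
    \<open>insert w R\<close>, a set of \<open>\<kappa> + 1\<close> vertices.\<close>
  have common: "card (nb w - M) < order_F" if w: "w \<notin> R" for w
  proof -
    have "card (nb w - M) \<le> card {u. \<forall>r\<in>insert w R. E r u}"
    proof (rule card_mono)
      show "finite {u. \<forall>r\<in>insert w R. E r u}" by (rule finite_subset[of _ "nb w"]) auto
      show "nb w - M \<subseteq> {u. \<forall>r\<in>insert w R. E r u}" using E_less by (auto simp: M_def)
    qed
    also have "\<dots> < order_F" using w R(2) by (intro common_neighbours_card) auto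
    finally show ?thesis .
  qed
  have fn: "order_F \<le> e * n"
  proof -
    have "real order_F \<le> real (\<kappa>\<^sup>2 + 4 * order_F + 8)" by (rule of_nat_mono) simp
    also have "\<dots> \<le> \<delta> * n / 4" by (rule large(3))
    also have "\<dots> \<le> e * n / 4" using \<delta>_le_e by (intro divide_right_mono mult_right_mono) auto
    finally show ?thesis using en by linarith
  qed
  have small: "x w \<le> 7 * \<kappa> * e" if w: "w < n" "w \<notin> R" for w
  proof -
    have "card (nb w) \<le> card (nb w - M) + card M"
      by (rule order_trans[OF card_mono[of "(nb w - M) \<union> M"] card_Un_le]) auto
    then have "real (card (nb w)) \<le> order_F + 5 * \<kappa> * e * n" using common[OF w(2)] cM by linarith
    then have "n * x w \<le> e * n + 5 * \<kappa> * e * n + e * n" using degree_ge[OF w(1)] fn by linarith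
    also have "\<dots> \<le> n * (7 * \<kappa> * e)"
      using \<kappa>2 mult_right_mono[of 1 "real \<kappa>" "e * n"] en by (simp add: algebra_simps)
    finally show ?thesis using n_pos by (subst (asm) mult_le_cancel_left_pos) auto
  qed
  define S where "S = M - R"
  have finS [simp]: "finite S" by (simp add: S_def)
  have S_less: "v < n" "v \<notin> R" if "v \<in> S" for v using that by (auto simp: S_def M_def)
  have cS: "card S \<le> 5 * \<kappa> * e * n"
  proof -
    have "card S \<le> card M" unfolding S_def by (intro card_mono) auto
    then show ?thesis using cM by linarith
  qed
  define y where "y v = (\<Sum>u\<in>nb v \<inter> S. x u)" for v
  \<comment> \<open>By \<open>sum_le_neighbour_sum\<close> the neighbours of \<open>v\<close> weigh
    at least as much as \<open>R\<close>. A hub of weight at least 3/4 is missing among them, and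
    the neighbours outside \<open>R\<close> and \<open>M\<close> weigh at most 1/4. So
    \<open>y v\<close> is at least 1/2 and controls the whole neighbour sum.\<close>
  have key: "lam * x v \<le> (2 * \<kappa> + 2) * y v" if v: "v \<in> S" for v
  proof -
    have vn: "v < n" "v \<notin> R" using S_less[OF v] by auto
    have "5 * \<kappa> * e * n \<le> n / 4" using e_bounds(2) mult_right_mono[of "5 * \<kappa> * e" "1 / 4" "real n"] by simp
    moreover have "n - card (M \<union> {v}) \<le> card ({..<n} - (M \<union> {v}))" using diff_card_le_card_Diff[of "M \<union> {v}" "{..<n}"] by simp
    moreover have "card (M \<union> {v}) \<le> card M + 1" using card_Un_le[of M "{v}"] by simp
    ultimately have "order_F < card ({..<n} - (M \<union> {v}))" using cM n_large by linarith
    also have "\<dots> \<le> card {u. u < n \<and> u \<noteq> v \<and> (\<forall>r\<in>R. E r u)}" by (intro card_mono) (auto simp: M_def)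
    finally have "(\<Sum>r\<in>R. x r) \<le> (\<Sum>j\<in>nb v. x j)" using vn R(1) by (intro sum_le_neighbour_sum) auto
    moreover have "(\<Sum>j\<in>nb v. x j) = (\<Sum>j\<in>nb v \<inter> R. x j) + (\<Sum>j\<in>nb v - R. x j)" by (rule sum.Int_Diff) simp
    moreover have "(\<Sum>j\<in>nb v - R. x j) = (\<Sum>j\<in>(nb v - R) \<inter> M. x j) + (\<Sum>j\<in>nb v - R - M. x j)" by (rule sum.Int_Diff) simp
    moreover have "(\<Sum>j\<in>(nb v - R) \<inter> M. x j) = y v" unfolding y_def by (rule sum.cong) (auto simp: S_def)
    moreover have "(\<Sum>j\<in>nb v - R - M. x j) \<le> 1 / 4"
    proof -
      have "(\<Sum>j\<in>nb v - R - M. x j) \<le> (\<Sum>j\<in>nb v - R - M. 7 * \<kappa> * e)" using E_less by (intro sum_mono small) auto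
      also have "\<dots> = card (nb v - R - M) * (7 * \<kappa> * e)" by simp
      also have "\<dots> \<le> order_F * (7 * \<kappa> * e)"
      proof (rule mult_right_mono)
        have "card (nb v - R - M) \<le> card (nb v - M)" by (intro card_mono) auto
        then show "real (card (nb v - R - M)) \<le> order_F" using common[OF vn(2)] by linarith
      qed (use e_pos in auto)
      also have "\<dots> \<le> 1 / 4" using e_bounds(3) by (simp add: algebra_simps)
      finally show ?thesis .
    qed
    moreover have "(\<Sum>r\<in>R. x r) = (\<Sum>r\<in>R \<inter> nb v. x r) + (\<Sum>r\<in>R - nb v. x r)" by (rule sum.Int_Diff) simp
    moreover have "(\<Sum>r\<in>R \<inter> nb v. x r) = (\<Sum>r\<in>nb v \<inter> R. x r)" by (simp add: Int_commute)
    moreover have "3 / 4 \<le> (\<Sum>r\<in>R - nb v. x r)"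
    proof -
      obtain r where r: "r \<in> R" "\<not> E r v" using v by (auto simp: S_def M_def)
      then have "r \<in> R - nb v" using E_sym by auto
      then have "x r \<le> (\<Sum>r\<in>R - nb v. x r)" using x_nonneg by (intro member_le_sum) auto
      then show ?thesis using xR[OF r(1)] e_bounds(1) by linarith
    qed
    moreover have "(\<Sum>j\<in>nb v \<inter> R. x j) \<le> \<kappa>"
    proof -
      have "(\<Sum>j\<in>nb v \<inter> R. x j) \<le> (\<Sum>j\<in>nb v \<inter> R. 1)" using R(1) by (intro sum_mono x_le1) auto
      also have "\<dots> \<le> real \<kappa>" using card_mono[of R "nb v \<inter> R"] R(2) by simp
      finally show ?thesis .
    qed
    ultimately have y: "1 / 2 \<le> y v \<and> (\<Sum>j\<in>nb v. x j) \<le> \<kappa> + 1 / 4 + y v" by linarith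
    then have "(2 * \<kappa> + 1) * (1 / 2) \<le> (2 * \<kappa> + 1) * y v" by (intro mult_left_mono) auto
    then show ?thesis using eigen[OF vn(1)] y by (simp add: algebra_simps)
  qed
  have "S = {}"
  proof (rule ccontr)
    assume "S \<noteq> {}"
    then have "Max (x ` S) \<in> x ` S" by (intro Max_in) auto
    then obtain v where v: "v \<in> S" "x v = Max (x ` S)" by auto
    have vmax: "x w \<le> x v" if "w \<in> S" for w unfolding v(2) using that by (intro Max_ge) auto
    have pos: "0 < x v" using x_pos S_less[OF v(1)] by simp
    let ?c = "2 * real \<kappa> + 2"
    \<comment> \<open>Using \<open>key\<close> twice at the maximal entry of \<open>S\<close> bounds
      \<open>lam\<^sup>2\<close> by a multiple of the number of walks inside \<open>S\<close>, which
      is linear in \<open>card S\<close>.\<close>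
    have "lam\<^sup>2 * x v \<le> lam * (?c * y v)" using mult_left_mono[OF key[OF v(1)] rho_E_nonneg] by (simp add: power2_eq_square algebra_simps)
    also have "\<dots> = ?c * (\<Sum>u\<in>nb v \<inter> S. lam * x u)" by (simp add: y_def sum_distrib_left algebra_simps)
    also have "\<dots> \<le> ?c * (\<Sum>u\<in>nb v \<inter> S. ?c * y u)"
    proof (intro mult_left_mono sum_mono)
      show "lam * x u \<le> ?c * y u" if "u \<in> nb v \<inter> S" for u using key[of u] that by (simp add: algebra_simps)
    qed simp
    also have "(\<Sum>u\<in>nb v \<inter> S. ?c * y u) \<le> (\<Sum>u\<in>nb v \<inter> S. ?c * (\<Sum>w\<in>nb u \<inter> S. x v))"
      unfolding y_def using vmax by (intro sum_mono mult_left_mono) auto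
    also have "\<dots> = ?c * (x v * real (\<Sum>u\<in>nb v \<inter> S. card (nb u \<inter> S)))" by (simp add: sum_distrib_left algebra_simps)
    also have "?c * \<dots> \<le> ?c * (?c * (x v * real ((2 * order_F + 1) * card S)))"
    proof (intro mult_left_mono of_nat_mono)
      show "(\<Sum>u\<in>nb v \<inter> S. card (nb u \<inter> S)) \<le> (2 * order_F + 1) * card S" using S_less by (intro walks_le) auto
    qed (use pos in auto)
    also have "\<dots> = x v * (?c\<^sup>2 * (2 * real order_F + 1) * card S)" by (simp add: power2_eq_square algebra_simps)
    finally have "x v * lam\<^sup>2 \<le> x v * (?c\<^sup>2 * (2 * real order_F + 1) * card S)" by (simp add: mult.commute)
    then have "lam\<^sup>2 \<le> ?c\<^sup>2 * (2 * real order_F + 1) * card S" using pos by (subst (asm) mult_le_cancel_left_pos) auto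
    also have "\<dots> \<le> ?c\<^sup>2 * (2 * real order_F + 1) * (5 * \<kappa> * e * n)" using cS by (intro mult_left_mono) auto
    also have "\<dots> = (200 * ?c\<^sup>2 * (2 * real order_F + 1) * e) * (\<kappa> * n / 40)" by (simp add: algebra_simps)
    also have "\<dots> \<le> 1 * (\<kappa> * n / 40)" using e_small by (intro mult_right_mono) auto
    finally have "lam\<^sup>2 \<le> \<kappa> * n / 40" by simp
    moreover have "real \<kappa> * (real n - \<kappa>) \<le> lam\<^sup>2" by (rule rho_lower[OF \<kappa>_less_n])
    moreover have "real \<kappa> * \<kappa> \<le> \<kappa> * n / 4"
    proof -
      have "real (\<kappa>\<^sup>2) \<le> real (\<kappa>\<^sup>2 + 4 * order_F + 8)" by (rule of_nat_mono) simp
      also have "\<dots> \<le> \<delta> * n / 4" by (rule large(3))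
      also have "\<dots> \<le> 1 * n / 4" using \<delta>_small(3) mult_right_mono[of \<delta> 1 "real n"] by simp
      also have "\<dots> \<le> \<kappa> * n / 4" using \<kappa>2 mult_right_mono[of 1 "real \<kappa>" "real n"] by simp
      finally show ?thesis by (simp add: power2_eq_square)
    qed
    moreover have "0 < real \<kappa> * n" using \<kappa>2 n_pos by simp
    ultimately show False by (simp add: algebra_simps)
  qed
  then have "E r v" if "r \<in> R" "v < n" "v \<notin> R" for r v using that by (auto simp: S_def M_def)
  then show ?thesis using R by blast
qed

end

section \<open>Identification of the extremal graph\<close>

lemma graph_isoI_bij:
  assumes G: "pair_wf_digraph G" and H: "pair_wf_digraph H" and f: "bij_betw f (pverts G) (pverts H)"
    and arcs: "\<And>u v. u \<in> pverts G \<Longrightarrow> v \<in> pverts G \<Longrightarrow> (u, v) \<in> parcs G \<longleftrightarrow> (f u, f v) \<in> parcs H"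
  shows "G \<simeq>\<^sub>g H"
proof (rule graph_isoI[where f = f])
  interpret G: pair_wf_digraph G by fact
  interpret H: pair_wf_digraph H by fact
  show "pverts H = f ` pverts G" using f by (simp add: bij_betw_def)
  show "parcs H = map_prod f f ` parcs G"
  proof (intro equalityI subsetI)
    fix a assume a: "a \<in> parcs H"
    obtain u' v' where uv: "a = (u', v')" by (cases a)
    obtain u v where "u \<in> pverts G" "f u = u'" "v \<in> pverts G" "f v = v'"
      using H.in_arcsD1 H.in_arcsD2 a uv f unfolding bij_betw_def by (metis imageE)
    then show "a \<in> map_prod f f ` parcs G" using arcs a uv by (auto intro!: image_eqI[of _ _ "(u, v)"])
  next
    fix a assume "a \<in> map_prod f f ` parcs G"
    then show "a \<in> parcs H" using arcs by (auto dest: G.in_arcsD1 G.in_arcsD2)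
  qed
qed (use G f in \<open>auto simp: bij_betw_def\<close>)

lemma parcs_S_plus:
  "(Inl u, Inl v) \<in> parcs (S_plus_graph n m) \<longleftrightarrow> u < m \<and> v < m \<and> u \<noteq> v"
  "(Inl u, Inr p) \<in> parcs (S_plus_graph n m) \<longleftrightarrow> u < m \<and> p \<in> {..<n - m} \<times> {0}"
  "(Inr p, Inl u) \<in> parcs (S_plus_graph n m) \<longleftrightarrow> u < m \<and> p \<in> {..<n - m} \<times> {0}"
  "(Inr p, Inr q) \<in> parcs (S_plus_graph n m) \<longleftrightarrow> (p, q) \<in> {((0, 0), (1, 0)), ((1, 0), (0, 0))}"
  by (auto simp: S_plus_graph_def add_edge_def S_graph_def join_def disjoint_union_def complete_graph_def copies_def)

lemma pverts_S_plus: "pverts (S_plus_graph n m) = {..<m} <+> ({..<n - m} \<times> {0})"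
  by (auto simp: S_plus_graph_def add_edge_def S_graph_def join_def disjoint_union_def complete_graph_def copies_def)

lemma wf_S_plus:
  assumes "m + 2 \<le> n" shows "pair_wf_digraph (S_plus_graph n m)"
proof unfold_locales
  fix e assume e: "e \<in> parcs (S_plus_graph n m)"
  obtain a c where ac: "e = (a, c)" by (cases e)
  show "fst e \<in> pverts (S_plus_graph n m)" "snd e \<in> pverts (S_plus_graph n m)"
    using e assms unfolding ac pverts_S_plus by (cases a; cases c; auto simp: parcs_S_plus)+
qed

lemma parcs_F:
  "(Inl u, Inl v) \<in> parcs (F_graph n m) \<longleftrightarrow> u < m \<and> v < m \<and> u \<noteq> v"
  "(Inl u, Inr p) \<in> parcs (F_graph n m) \<longleftrightarrow> u < m \<and> p \<in> ({..<(n - m) div 2} \<times> {..<2}) <+> ({..<(n - m) mod 2} \<times> {0})"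
  "(Inr p, Inl u) \<in> parcs (F_graph n m) \<longleftrightarrow> u < m \<and> p \<in> ({..<(n - m) div 2} \<times> {..<2}) <+> ({..<(n - m) mod 2} \<times> {0})"
  "(Inr p, Inr q) \<in> parcs (F_graph n m) \<longleftrightarrow>
    (\<exists>i c d. p = Inl (i, c) \<and> q = Inl (i, d) \<and> i < (n - m) div 2 \<and> c < 2 \<and> d < 2 \<and> c \<noteq> d)"
  by (auto simp: F_graph_def M_graph_def join_def disjoint_union_def complete_graph_def copies_def)

lemma pverts_F: "pverts (F_graph n m) = {..<m} <+> (({..<(n - m) div 2} \<times> {..<2}) <+> ({..<(n - m) mod 2} \<times> {0}))"
  by (auto simp: F_graph_def M_graph_def join_def disjoint_union_def complete_graph_def copies_def)

lemma wf_F: "pair_wf_digraph (F_graph n m)"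
proof unfold_locales
  fix e assume e: "e \<in> parcs (F_graph n m)"
  obtain a c where ac: "e = (a, c)" by (cases e)
  show "fst e \<in> pverts (F_graph n m)" "snd e \<in> pverts (F_graph n m)"
    using e unfolding ac pverts_F by (cases a; cases c; force simp: parcs_F)+
qed

lemma card_pverts_F: "m \<le> n \<Longrightarrow> card (pverts (F_graph n m)) = n"
  unfolding pverts_F by (simp add: card_Plus card_cartesian_product)

locale hub_graph = extremal_graph +
  fixes R :: "nat set"
  assumes R: "R \<subseteq> {..<n}" "card R = \<kappa>" and complete: "r \<in> R \<Longrightarrow> v < n \<Longrightarrow> v \<notin> R \<Longrightarrow> E r v"
    and n_ge: "\<kappa> + order_F \<le> n"
begin

definition outer :: "nat set" where "outer = {..<n} - R"

lemma finite_R [simp]: "finite R" "finite outer" using R(1) finite_subset by (auto simp: outer_def)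

lemma card_O: "card outer = n - \<kappa>" unfolding outer_def using R by (simp add: card_Diff_subset)

lemma RO: "r \<in> R \<Longrightarrow> c \<in> outer \<Longrightarrow> E r c" using complete by (auto simp: outer_def)

text \<open>All entries of \<open>x\<close> are positive, so an additional edge strictly increases
  the form at \<open>x\<close>.\<close>

lemma maximal:
  assumes E': "simple_rel n E'" "free n E'" and sub: "\<And>u v. E u v \<Longrightarrow> E' u v" and uv: "E' u v"
  shows "E u v"
proof (rule ccontr)
  assume nE: "\<not> E u v"
  have un: "u < n" "v < n" using simple_rel_less[OF E'(1)] uv by auto
  have le: "adj_sum n E x i \<le> adj_sum n E' x i" for i
    unfolding adj_sum_def using sub x_nonneg by (intro sum_mono) auto
  have "adj_sum n E x u < adj_sum n E' x u"
    unfolding adj_sum_def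
  proof (rule sum_strict_mono_ex1)
    show "\<forall>j\<in>{..<n}. (if E u j then x j else 0) \<le> (if E' u j then x j else 0)" using sub x_nonneg by auto
    show "\<exists>j\<in>{..<n}. (if E u j then x j else 0) < (if E' u j then x j else 0)"
      using uv nE un x_pos[OF un(2)] by (intro bexI[of _ v]) auto
  qed simp
  then have "qform n E x < qform n E' x" unfolding qform_def
    using le x_nonneg un x_pos[OF un(1)]
    by (intro sum_strict_mono_ex1) (auto intro!: mult_left_mono bexI[of _ u] mult_strict_left_mono)
  also have "\<dots> \<le> rho n E' * (\<Sum>i<n. (x i)\<^sup>2)" by (rule rayleigh[OF E'(1) n_pos])
  also have "\<dots> \<le> rho n E * (\<Sum>i<n. (x i)\<^sup>2)" using extremal[OF E'] by (intro mult_right_mono sum_nonneg) auto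
  finally show False using qform_x by simp
qed

lemma matching:
  assumes "a \<in> outer" "b \<in> outer" "d \<in> outer" "E b a" "E b d"
  shows "a = d"
proof (rule ccontr)
  assume "a \<noteq> d"
  then have "flower E {1..t} k"
    using t k k_ge1 R(2) card_O n_ge assms RO E_sym E_irrefl
    by (intro flower_if_path3[where s = 1 and R = R and C = outer and a = a and b = b and d = d] E_symp)
      (auto simp: \<kappa> order_F_def)
  then show False using no_flower by simp
qed

text \<open>Assumption \<open>s\<close> says that freeness is decided by the edges outside
  \<open>R\<close>, as it is when \<open>R\<close> is a near cover. Then all edges inside
  \<open>R\<close> can be added at once.\<close>

lemma clique:
  assumes "u \<in> R" "v \<in> R" "u \<noteq> v" and s: "\<And>E'. simple_rel n E' \<Longrightarrow> (\<And>u v. u \<notin> R \<Longrightarrow> v \<notin> R \<Longrightarrow> E' u v = E u v) \<Longrightarrow> free n E'"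
  shows "E u v"
proof -
  define E' where "E' u v \<longleftrightarrow> E u v \<or> u \<in> R \<and> v \<in> R \<and> u \<noteq> v" for u v
  have E': "simple_rel n E'" using E_sym E_irrefl E_less R(1) unfolding simple_rel_def symp_def E'_def by blast
  have "free n E'" by (rule s[OF E']) (auto simp: E'_def)
  then show ?thesis by (rule maximal[OF E']) (use assms in \<open>auto simp: E'_def\<close>)
qed

lemma notin_R: "E u v \<Longrightarrow> u \<notin> R \<Longrightarrow> u \<in> outer" using E_less by (auto simp: outer_def)

lemma bij_R: "\<exists>h. bij_betw h R {..<\<kappa>}"
  using ex_bij_betw_finite_nat[OF finite_R(1)] R(2) by (simp add: lessThan_atLeast0)

lemma wf_E: "pair_wf_digraph (graph_of n E)"
proof -
  interpret pair_graph "graph_of n E" by (rule pair_graph_graph_of[OF simple])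
  show ?thesis by (rule pair_wf_digraph)
qed

lemma single_edge:
  assumes s: "s \<in> {1..t}" "3 \<le> k s" and "a \<in> outer" "b \<in> outer" "c \<in> outer" "d \<in> outer" "E a b" "E c d"
  shows "{a, b} = {c, d}"
proof (rule ccontr)
  assume ne: "{a, b} \<noteq> {c, d}"
  \<comment> \<open>Distinct edges of a matching are disjoint.\<close>
  have "a \<noteq> c" "a \<noteq> d" "b \<noteq> c" "b \<noteq> d"
    using ne matching[of b a d] matching[of b a c] matching[of a b d] matching[of a b c] assms E_sym by blast+
  then have "flower E {1..t} k"
  proof (intro flower_if_two_edges[where s = s and R = R and C = outer and a = a and b = b and c = c and d = d])
    show "(\<Sum>i = 1..t. k i - 1) = card R" using R(2) \<kappa> by simp
    show "(\<Sum>i = 1..t. 2 * k i) \<le> card outer" using card_O n_ge by (simp add: order_F_def)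
    show "s \<in> {1..t}" by fact
    show "1 \<le> k i" if "i \<in> {1..t}" for i by (rule k_ge1[OF that])
  qed (simp_all add: assms RO E_irrefl E_symp)
  then show False using no_flower by simp
qed

lemma iso_S_plus:
  assumes s: "s \<in> {1..t}" "3 \<le> k s"
  shows "graph_of n E \<simeq>\<^sub>g S_plus_graph n \<kappa>" "minor_free (graph_of n E) F"
proof -
  have big: "2 \<le> card outer" using card_O n_ge order_F_pos by simp
  have free': "minor_free (graph_of n E') F" if E': "simple_rel n E'"
    and eq: "\<And>u v. u \<notin> R \<Longrightarrow> v \<notin> R \<Longrightarrow> E' u v \<Longrightarrow> (u, v) \<in> {(a, b), (b, a)}" and ab: "a \<noteq> b" for E' a b
  proof (rule minor_free_if_cover[OF E' finite_R(1), of True])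
    show "v = w" if "u \<notin> R" "v \<notin> R" "w \<notin> R" "E' u v" "E' u w" for u v w
      using eq[OF that(1,2,4)] eq[OF that(1,3,5)] ab by auto
    show "\<exists>a b. \<forall>u v. u \<notin> R \<and> v \<notin> R \<and> E' u v \<longrightarrow> (u, v) \<in> {(a, b), (b, a)}"
      using eq by metis
  qed (use R(2) in auto)
  \<comment> \<open>If no edge avoided \<open>R\<close>, an arbitrary one could be added and
    \<open>R\<close> would still be a near cover.\<close>
  have "\<exists>a\<in>outer. \<exists>b\<in>outer. E a b"
  proof (rule ccontr)
    assume no: "\<not> ?thesis"
    obtain a where a: "a \<in> outer" using big by fastforce
    have "outer - {a} \<noteq> {}" using big a by (metis card.empty card_Diff_singleton finite_R(2) One_nat_def Suc_1 diff_is_0_eq not_less_eq_eq)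
    then obtain b where b: "b \<in> outer" "b \<noteq> a" by auto
    define E' where "E' u v \<longleftrightarrow> E u v \<or> (u, v) \<in> {(a, b), (b, a)}" for u v
    have E': "simple_rel n E'" using E_sym E_irrefl E_less a b unfolding simple_rel_def symp_def E'_def outer_def by blast
    have "(u, v) \<in> {(a, b), (b, a)}" if "u \<notin> R" "v \<notin> R" "E' u v" for u v
      using that no E_sym by (metis E'_def notin_R)
    then have "free n E'" using free'[OF E', of a b] b free_if_minor_free[OF E'] by blast
    then have "E a b" by (rule maximal[OF E']) (auto simp: E'_def)
    then show False using no a b by blast
  qed
  then obtain a b where ab: "a \<in> outer" "b \<in> outer" "E a b" by blast
  have neq: "a \<noteq> b" using ab E_irrefl by auto
  have out: "(u, v) \<in> {(a, b), (b, a)}" if "u \<notin> R" "v \<notin> R" "E u v" for u v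
  proof -
    have "{u, v} = {a, b}" using single_edge[OF s, of u v a b] that ab E_sym notin_R by blast
    then show ?thesis using E_irrefl that by (auto simp: doubleton_eq_iff)
  qed
  show "minor_free (graph_of n E) F" by (rule free'[OF simple out neq])
  have clq: "E u v" if "u \<in> R" "v \<in> R" "u \<noteq> v" for u v
  proof (rule clique[OF that])
    fix E' assume E': "simple_rel n E'" and eq: "\<And>u v. u \<notin> R \<Longrightarrow> v \<notin> R \<Longrightarrow> E' u v = E u v"
    have "minor_free (graph_of n E') F" by (rule free'[OF E' _ neq]) (use eq out in blast)
    then show "free n E'" by (rule free_if_minor_free[OF E'])
  qed
  obtain h where h: "bij_betw h R {..<\<kappa>}" using bij_R by blast
  have "card (outer - {a, b}) = card {2..<n - \<kappa>}" using ab neq card_O by simp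
  then obtain g where g: "bij_betw g (outer - {a, b}) {2..<n - \<kappa>}" using finite_same_card_bij[of "outer - {a, b}" "{2..<n - \<kappa>}"] by auto
  \<comment> \<open>\<open>S_plus_graph\<close> joins copies 0 and 1 of the independent set, so
    these labels go to the ends of the edge.\<close>
  define g' where "g' v = (if v = a then 0 else if v = b then 1 else g v)" for v
  define f where "f v = (if v \<in> R then Inl (h v) else Inr (g' v, 0::nat))" for v
  have g_ge: "2 \<le> g v" "g v < n - \<kappa>" if "v \<in> outer" "v \<noteq> a" "v \<noteq> b" for v using g that unfolding bij_betw_def by auto
  have g'_less: "g' v < n - \<kappa>" if "v \<in> outer" for v using g_ge[OF that] big card_O by (auto simp: g'_def)
  have g'_inj: "u = v" if "u \<in> outer" "v \<in> outer" "g' u = g' v" for u v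
  proof (cases "u = a \<or> u = b \<or> v = a \<or> v = b")
    case True
    then show ?thesis using that(3) neq g_ge(1)[OF that(1)] g_ge(1)[OF that(2)] by (auto simp: g'_def split: if_splits)
  next
    case False
    then show ?thesis using that inj_onD[OF bij_betw_imp_inj_on[OF g], of u v] by (simp add: g'_def)
  qed
  have h_less: "h v < \<kappa>" if "v \<in> R" for v using h that by (auto simp: bij_betw_def)
  have h_inj: "u = v" if "u \<in> R" "v \<in> R" "h u = h v" for u v using h that by (auto simp: bij_betw_def inj_on_def)
  have vR: "v \<in> outer \<longleftrightarrow> v \<notin> R" if "v < n" for v using that by (auto simp: outer_def)
  have inj: "inj_on f {..<n}"
    by (rule inj_onI) (use g'_inj h_inj vR in \<open>auto simp: f_def split: if_splits\<close>)
  have "f ` {..<n} \<subseteq> pverts (S_plus_graph n \<kappa>)"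
    unfolding pverts_S_plus using h_less g'_less vR by (auto simp: f_def)
  moreover have "card (pverts (S_plus_graph n \<kappa>)) = n" unfolding pverts_S_plus using n_ge by (simp add: card_Plus card_cartesian_product)
  ultimately have bij: "bij_betw f {..<n} (pverts (S_plus_graph n \<kappa>))"
    unfolding bij_betw_def using inj by (metis card_image card_lessThan card_subset_eq card.infinite n_pos less_irrefl)
  show "graph_of n E \<simeq>\<^sub>g S_plus_graph n \<kappa>"
  proof (rule graph_isoI_bij[OF wf_E wf_S_plus])
    show "\<kappa> + 2 \<le> n" using big card_O by linarith
    show "bij_betw f (pverts (graph_of n E)) (pverts (S_plus_graph n \<kappa>))" using bij by simp
    fix u v assume "u \<in> pverts (graph_of n E)" "v \<in> pverts (graph_of n E)"
    then have uv: "u < n" "v < n" by auto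
    have "E u v \<longleftrightarrow> (f u, f v) \<in> parcs (S_plus_graph n \<kappa>)"
    proof (cases "u \<in> R"; cases "v \<in> R")
      assume "u \<in> R" "v \<in> R"
      then show ?thesis using clq[of u v] h_inj[of u v] h_less E_irrefl by (cases "u = v") (auto simp: f_def parcs_S_plus)
    next
      assume "u \<in> R" "v \<notin> R"
      then show ?thesis using RO vR uv h_less g'_less by (auto simp: f_def parcs_S_plus)
    next
      assume "u \<notin> R" "v \<in> R"
      then show ?thesis using RO vR uv h_less g'_less E_sym by (auto simp: f_def parcs_S_plus)
    next
      assume R: "u \<notin> R" "v \<notin> R"
      have "E u v \<longleftrightarrow> (u = a \<and> v = b) \<or> (u = b \<and> v = a)" using out[OF R] ab E_sym by blast
      also have "\<dots> \<longleftrightarrow> (g' u = 0 \<and> g' v = 1) \<or> (g' u = 1 \<and> g' v = 0)"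
      proof -
        have "g' a = 0" "g' b = 1" using neq by (auto simp: g'_def)
        then show ?thesis using g'_inj R vR uv ab by metis
      qed
      finally show ?thesis using R by (auto simp: f_def parcs_S_plus)
    qed
    then show "(u, v) \<in> parcs (graph_of n E) \<longleftrightarrow> (f u, f v) \<in> parcs (S_plus_graph n \<kappa>)" by simp
  qed
qed

end

context hub_graph
begin

lemma iso_F:
  assumes all2: "\<forall>i\<in>{1..t}. k i = 2"
  shows "graph_of n E \<simeq>\<^sub>g F_graph n \<kappa>" "minor_free (graph_of n E) F"
proof -
  have free': "minor_free (graph_of n E') F" if E': "simple_rel n E'"
    and eq: "\<And>u v w. u \<notin> R \<Longrightarrow> v \<notin> R \<Longrightarrow> w \<notin> R \<Longrightarrow> E' u v \<Longrightarrow> E' u w \<Longrightarrow> v = w" for E'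
    by (rule minor_free_if_cover[OF E' finite_R(1), of False]) (use R(2) eq all2 in auto)
  have out: "v = w" if "u \<notin> R" "v \<notin> R" "w \<notin> R" "E u v" "E u w" for u v w
    using matching[of v u w] notin_R E_sym that by blast
  show "minor_free (graph_of n E) F" by (rule free'[OF simple out])
  have clq: "E u v" if "u \<in> R" "v \<in> R" "u \<noteq> v" for u v
  proof (rule clique[OF that])
    fix E' assume E': "simple_rel n E'" and eq: "\<And>u v. u \<notin> R \<Longrightarrow> v \<notin> R \<Longrightarrow> E' u v = E u v"
    have "minor_free (graph_of n E') F" by (rule free'[OF E']) (use eq out in metis)
    then show "free n E'" by (rule free_if_minor_free[OF E'])
  qed
  define U where "U = {v \<in> outer. \<forall>w\<in>outer. \<not> E v w}"
  have finU: "finite U" by (simp add: U_def)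
  \<comment> \<open>Two unmatched vertices could be joined without violating the matching condition.
    The one that may remain becomes the isolated vertex of \<open>M_graph\<close>.\<close>
  have U1: "p = q" if p: "p \<in> U" and q: "q \<in> U" for p q
  proof (rule ccontr)
    assume pq: "p \<noteq> q"
    define E' where "E' u v \<longleftrightarrow> E u v \<or> (u, v) \<in> {(p, q), (q, p)}" for u v
    have pqn: "p < n" "q < n" "p \<notin> R" "q \<notin> R" using p q by (auto simp: U_def outer_def)
    have E': "simple_rel n E'" using E_sym E_irrefl E_less pqn pq unfolding simple_rel_def symp_def E'_def by blast
    have nE: "\<not> E p w" "\<not> E q w" if "w \<notin> R" for w
      using p q that E_less by (auto simp: U_def outer_def)
    have "minor_free (graph_of n E') F"
    proof (rule free'[OF E'])
      fix u v w assume R': "u \<notin> R" "v \<notin> R" "w \<notin> R" and uv: "E' u v" "E' u w"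
      show "v = w"
      proof (cases "u = p \<or> u = q")
        case True
        then show ?thesis using uv nE[OF R'(2)] nE[OF R'(3)] pq by (auto simp: E'_def)
      next
        case False
        then show ?thesis using uv out[OF R'] by (auto simp: E'_def)
      qed
    qed
    then have "free n E'" by (rule free_if_minor_free[OF E'])
    then have "E p q" by (rule maximal[OF E']) (auto simp: E'_def)
    then show False using nE(1)[OF pqn(4)] by simp
  qed
  define mate where "mate v = (THE w. w \<in> outer \<and> E v w)" for v
  have mate_eq: "mate v = w" if "v \<in> outer" "w \<in> outer" "E v w" for v w
    unfolding mate_def
  proof (rule the_equality)
    show "w \<in> outer \<and> E v w" using that by simp
    show "w' = w" if "w' \<in> outer \<and> E v w'" for w' using matching[of w' v w] that \<open>v \<in> outer\<close> \<open>w \<in> outer\<close> \<open>E v w\<close> by simp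
  qed
  have mate: "mate v \<in> outer" "E v (mate v)" "mate v \<notin> U" "mate (mate v) = v" "mate v \<noteq> v" if v: "v \<in> outer" "v \<notin> U" for v
  proof -
    obtain w where w: "w \<in> outer" "E v w" using v by (auto simp: U_def)
    have "mate v = w" by (rule mate_eq[OF v(1) w])
    then show m: "mate v \<in> outer" "E v (mate v)" using w by auto
    have m': "E (mate v) v" using E_sym[OF m(2)] .
    show "mate v \<notin> U" using v(1) m' by (auto simp: U_def)
    show "mate (mate v) = v" by (rule mate_eq[OF m(1) v(1) m'])
    show "mate v \<noteq> v" using m' E_irrefl by metis
  qed
  \<comment> \<open>The smaller endpoint of each matching edge; it receives label 0 in its copy of
    \<open>complete_graph 2\<close>, and its mate label 1.\<close>
  define P where "P = {v \<in> outer. v \<notin> U \<and> v < mate v}"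
  have finP: "finite P" by (simp add: P_def)
  have matePQ: "mate v \<in> P" if "v \<in> outer" "v \<notin> U" "v \<notin> P" for v
    using mate[OF that(1,2)] that by (auto simp: P_def)
  have matePn: "mate v \<notin> P" if "v \<in> P" for v
    using mate[of v] that by (auto simp: P_def)
  have injP: "inj_on mate P"
  proof (rule inj_onI)
    fix u v assume uv: "u \<in> P" "v \<in> P" "mate u = mate v"
    have "mate (mate u) = u" "mate (mate v) = v" using mate(4)[of u] mate(4)[of v] uv(1,2) unfolding P_def by blast+
    then show "u = v" using uv(3) by metis
  qed
  have O_eq: "outer = P \<union> mate ` P \<union> U"
  proof (intro equalityI subsetI)
    fix v assume v: "v \<in> outer"
    show "v \<in> P \<union> mate ` P \<union> U"
    proof (cases "v \<in> U \<or> v \<in> P")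
      case False
      then have "mate v \<in> P" "mate (mate v) = v" using matePQ[OF v] mate(4)[OF v] by blast+
      then show ?thesis by (metis UnCI image_eqI)
    qed auto
  next
    fix v assume "v \<in> P \<union> mate ` P \<union> U"
    then show "v \<in> outer" using mate(1) unfolding P_def U_def by blast
  qed
  have "card outer = card (P \<union> mate ` P) + card U"
  proof -
    have "(P \<union> mate ` P) \<inter> U = {}" using mate(3) unfolding P_def by blast
    then show ?thesis using finP finU card_Un_disjoint[of "P \<union> mate ` P" U] O_eq by simp
  qed
  also have "card (P \<union> mate ` P) = card P + card P"
  proof -
    have "P \<inter> mate ` P = {}" using matePn by blast
    then show ?thesis using finP card_Un_disjoint[of P "mate ` P"] card_image[OF injP] by simp
  qed
  finally have cO: "n - \<kappa> = 2 * card P + card U" using card_O by simp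
  have cU: "card U \<le> 1" using U1 finU by (simp add: card_le_Suc0_iff_eq)
  have cP: "card P \<le> (n - \<kappa>) div 2" using cO by simp
  obtain i0 where i0: "bij_betw i0 P {0..<card P}" using ex_bij_betw_finite_nat[OF finP] by blast
  have i_less: "i0 v < (n - \<kappa>) div 2" if "v \<in> P" for v
  proof -
    have "i0 v \<in> {0..<card P}" using bij_betwE[OF i0] that by blast
    then show ?thesis using cP by simp
  qed
  have i_inj: "u = v" if "i0 u = i0 v" "u \<in> P" "v \<in> P" for u v using i0 that by (auto simp: bij_betw_def inj_on_def)
  obtain h where h: "bij_betw h R {..<\<kappa>}" using bij_R by blast
  have h_less: "h v < \<kappa>" if "v \<in> R" for v using h that by (auto simp: bij_betw_def)
  have h_inj: "u = v" if "u \<in> R" "v \<in> R" "h u = h v" for u v using h that by (auto simp: bij_betw_def inj_on_def)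
  define g :: "nat \<Rightarrow> nat \<times> nat + nat \<times> nat" where
    "g v = (if v \<in> U then Inr (0, 0) else if v \<in> P then Inl (i0 v, 0) else Inl (i0 (mate v), 1))" for v
  define f where "f v = (if v \<in> R then Inl (h v) else Inr (g v))" for v
  have vR: "v \<in> outer \<longleftrightarrow> v \<notin> R" if "v < n" for v using that by (auto simp: outer_def)
  have g_inj: "u = v" if uvg: "u \<in> outer" "v \<in> outer" "g u = g v" for u v
  proof -
    consider "u \<in> U" "v \<in> U" | "u \<in> P" "v \<in> P" "i0 u = i0 v" "u \<notin> U" "v \<notin> U"
      | "u \<notin> P" "v \<notin> P" "u \<notin> U" "v \<notin> U" "i0 (mate u) = i0 (mate v)"
      using uvg(3) by (auto simp: g_def split: if_splits)
    then show ?thesis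
    proof cases
      case 1 then show ?thesis by (rule U1)
    next
      case 2 then show ?thesis using i_inj by blast
    next
      case 3
      then have "mate u = mate v" using i_inj matePQ that by blast
      then show ?thesis using mate(4)[OF that(1) 3(3)] mate(4)[OF that(2) 3(4)] by metis
    qed
  qed
  have g_mem: "g v \<in> ({..<(n - \<kappa>) div 2} \<times> {..<2}) <+> ({..<(n - \<kappa>) mod 2} \<times> {0})" if v: "v \<in> outer" for v
  proof (cases "v \<in> U")
    case True
    then have "card U = 1" using cU finU by (metis card_0_eq empty_iff le_antisym less_one not_le)
    then have "(n - \<kappa>) mod 2 = 1" using cO by simp
    then show ?thesis using True by (auto simp: g_def)
  next
    case False
    then show ?thesis using i_less matePQ[OF v False] by (auto simp: g_def)
  qed
  have inj: "inj_on f {..<n}"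
    by (rule inj_onI) (use g_inj h_inj vR in \<open>auto simp: f_def split: if_splits\<close>)
  have sub: "f ` {..<n} \<subseteq> pverts (F_graph n \<kappa>)"
    unfolding pverts_F using h_less g_mem vR by (auto simp: f_def)
  have "card (pverts (F_graph n \<kappa>)) = n" using n_ge by (intro card_pverts_F) simp
  then have bij: "bij_betw f {..<n} (pverts (F_graph n \<kappa>))"
    unfolding bij_betw_def using inj sub by (metis card_image card_lessThan card_subset_eq card.infinite n_pos less_irrefl)
  show "graph_of n E \<simeq>\<^sub>g F_graph n \<kappa>"
  proof (rule graph_isoI_bij[OF wf_E wf_F])
    show "bij_betw f (pverts (graph_of n E)) (pverts (F_graph n \<kappa>))" using bij by simp
    fix u v assume "u \<in> pverts (graph_of n E)" "v \<in> pverts (graph_of n E)"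
    then have uv: "u < n" "v < n" by auto
    have "E u v \<longleftrightarrow> (f u, f v) \<in> parcs (F_graph n \<kappa>)"
    proof (cases "u \<in> R"; cases "v \<in> R")
      assume "u \<in> R" "v \<in> R"
      then show ?thesis using clq[of u v] h_inj[of u v] h_less E_irrefl by (cases "u = v") (auto simp: f_def parcs_F)
    next
      assume R': "u \<in> R" "v \<notin> R"
      then have "v \<in> outer" using vR uv by simp
      then show ?thesis using RO[OF R'(1)] h_less[OF R'(1)] g_mem[of v] R' by (simp add: f_def parcs_F)
    next
      assume R': "u \<notin> R" "v \<in> R"
      then have "u \<in> outer" using vR uv by simp
      then show ?thesis using E_sym[OF RO[OF R'(2)]] h_less[OF R'(2)] g_mem[of u] R' by (simp add: f_def parcs_F)
    next
      assume "u \<notin> R" "v \<notin> R"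
      then have O: "u \<in> outer" "v \<in> outer" and fe: "f u = Inr (g u)" "f v = Inr (g v)" using vR uv by (auto simp: f_def)
      show ?thesis
      proof (cases "u \<in> U \<or> v \<in> U")
        case True
        then have "\<not> E u v" using O E_sym[of u v] by (auto simp: U_def)
        then show ?thesis using True unfolding fe parcs_F by (auto simp: g_def split: if_splits)
      next
        case False
        then have nU: "u \<notin> U" "v \<notin> U" by auto
        have "E u v \<longleftrightarrow> v = mate u" using mate_eq[OF O] mate(2)[OF O(1) nU(1)] by blast
        also have "\<dots> \<longleftrightarrow> (\<exists>i c d. g u = Inl (i, c) \<and> g v = Inl (i, d) \<and> i < (n - \<kappa>) div 2 \<and> c < 2 \<and> d < 2 \<and> c \<noteq> d)"
        proof
          assume v: "v = mate u"
          show "\<exists>i c d. g u = Inl (i, c) \<and> g v = Inl (i, d) \<and> i < (n - \<kappa>) div 2 \<and> c < 2 \<and> d < 2 \<and> c \<noteq> d"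
          proof (cases "u \<in> P")
            case True
            then have "v \<notin> P" "mate v = u" using v matePn mate(4)[OF O(1) nU(1)] by auto
            then show ?thesis using True nU i_less[OF True] by (auto simp: g_def)
          next
            case False
            then have "v \<in> P" using v matePQ[OF O(1) nU(1)] by simp
            then show ?thesis using False nU i_less v by (auto simp: g_def)
          qed
        next
          assume "\<exists>i c d. g u = Inl (i, c) \<and> g v = Inl (i, d) \<and> i < (n - \<kappa>) div 2 \<and> c < 2 \<and> d < 2 \<and> c \<noteq> d"
          then consider "u \<in> P" "v \<notin> P" "i0 u = i0 (mate v)" | "u \<notin> P" "v \<in> P" "i0 (mate u) = i0 v"
            using nU by (auto simp: g_def split: if_splits)
          then show "v = mate u"
          proof cases
            case 1
            then have "u = mate v" using i_inj matePQ[OF O(2) nU(2)] by blast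
            then show ?thesis using mate(4)[OF O(2) nU(2)] by metis
          next
            case 2
            then show ?thesis using i_inj[of "mate u" v] matePQ[OF O(1) nU(1)] by simp
          qed
        qed
        finally show ?thesis unfolding fe parcs_F .
      qed
    qed
    then show "(u, v) \<in> parcs (graph_of n E) \<longleftrightarrow> (f u, f v) \<in> parcs (F_graph n \<kappa>)" by simp
  qed
qed

end

section \<open>The 4-cycle\<close>

lemma funpow_mult_fixed:
  assumes "(f ^^ p) x = x" shows "(f ^^ (m * p)) x = x"
  by (induction m) (simp_all add: funpow_add assms)

text \<open>The cyclic group of prime order acts without fixed points, so each orbit has
  \<open>p\<close> elements; the induction removes one orbit at a time.\<close>

lemma prime_dvd_card_if_no_fixpoint:
  fixes p :: nat
  assumes p: "prime p" and "finite X" and f: "\<And>x. x \<in> X \<Longrightarrow> f x \<in> X" "\<And>x. x \<in> X \<Longrightarrow> (f ^^ p) x = x" "\<And>x. x \<in> X \<Longrightarrow> f x \<noteq> x"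
  shows "p dvd card X"
  using assms(2-)
proof (induction "card X" arbitrary: X rule: less_induct)
  case less
  show ?case
  proof (cases "X = {}")
    case False
    then obtain x where x: "x \<in> X" by auto
    have p2: "2 \<le> p" using prime_ge_2_nat[OF p] .
    have mem: "(f ^^ i) x \<in> X" for i using x less.prems(2) by (induction i) auto
    have ne: "(f ^^ i) x \<noteq> (f ^^ j) x" if ij: "i < j" "j < p" for i j
    proof
      assume eq: "(f ^^ i) x = (f ^^ j) x"
      let ?y = "(f ^^ i) x" and ?q = "j - i"
      have "(f ^^ ?q) ?y = (f ^^ j) x" using ij by (metis comp_apply funpow_add le_add_diff_inverse2 less_imp_le)
      then have q: "(f ^^ ?q) ?y = ?y" using eq by simp
      have "\<not> p dvd ?q" using ij by (auto dest: dvd_imp_le)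
      then have "coprime p ?q" using p by (simp add: prime_imp_coprime)
      then have "gcd ?q p = 1" by (simp add: coprime_iff_gcd_eq_1 gcd.commute)
      \<comment> \<open>By Bezout some multiple of \<open>?q\<close> exceeds a multiple of
        \<open>p\<close> by one, so \<open>f\<close> itself would fix \<open>?y\<close>.\<close>
      then obtain a c where ac: "?q * a = p * c + 1" using bezout_nat[of ?q p] ij by auto
      have "(f ^^ (?q * a)) ?y = ?y" using funpow_mult_fixed[OF q, of a] by (simp add: mult.commute)
      moreover have "(f ^^ (p * c + 1)) ?y = f ((f ^^ (c * p)) ?y)" by (simp add: mult.commute)
      moreover have "(f ^^ (c * p)) ?y = ?y" using less.prems(3)[OF mem] by (rule funpow_mult_fixed)
      ultimately have "f ?y = ?y" using ac by simp
      then show False using less.prems(4)[OF mem] by blast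
    qed
    define Y where "Y = (\<lambda>i. (f ^^ i) x) ` {..<p}"
    have "inj_on (\<lambda>i. (f ^^ i) x) {..<p}"
    proof (rule inj_onI)
      fix i j assume "i \<in> {..<p}" "j \<in> {..<p}" "(f ^^ i) x = (f ^^ j) x"
      then show "i = j" using ne[of i j] ne[of j i] by (metis lessThan_iff nat_neq_iff)
    qed
    then have Y: "card Y = p" "Y \<subseteq> X" "finite Y" unfolding Y_def using mem by (auto simp: card_image)
    have fY: "f y \<in> Y" if y: "y \<in> Y" for y
    proof -
      obtain i where i: "i < p" "y = (f ^^ i) x" using y by (auto simp: Y_def)
      show ?thesis
      proof (cases "Suc i = p")
        case True
        then have "f y = (f ^^ 0) x" using i less.prems(3)[OF x] by (metis funpow.simps(2) comp_apply funpow_0)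
        then show ?thesis unfolding Y_def using p2 by (intro image_eqI[of _ _ 0]) auto
      next
        case False
        then show ?thesis unfolding Y_def using i by (intro image_eqI[of _ _ "Suc i"]) auto
      qed
    qed
    have fYi: "(f ^^ i) y \<in> Y" if "y \<in> Y" for i y using that fY by (induction i) auto
    have "f y \<notin> Y" if y: "y \<in> X" "y \<notin> Y" for y
    proof
      assume "f y \<in> Y"
      then have "(f ^^ (p - 1)) (f y) \<in> Y" by (rule fYi)
      moreover have "(f ^^ (p - 1)) (f y) = (f ^^ Suc (p - 1)) y" by (simp only: funpow_Suc_right comp_apply)
      ultimately show False using less.prems(3)[OF y(1)] y(2) p2 by simp
    qed
    moreover have "card (X - Y) = card X - p" using Y less.prems(1) by (simp add: card_Diff_subset)
    moreover have "p \<le> card X" using Y less.prems(1) card_mono[of X Y] by simp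
    ultimately have "p dvd card (X - Y)" using less.prems p2 by (intro less.hyps) auto
    then show ?thesis using \<open>card (X - Y) = card X - p\<close> \<open>p \<le> card X\<close> by (metis dvd_add_triv_right_iff le_add_diff_inverse2)
  qed simp
qed

lemma even_card_if_matched:
  assumes "finite X" and ex: "\<And>w. w \<in> X \<Longrightarrow> \<exists>a\<in>X. E w a" and uni: "\<And>w a c. w \<in> X \<Longrightarrow> a \<in> X \<Longrightarrow> c \<in> X \<Longrightarrow> E w a \<Longrightarrow> E w c \<Longrightarrow> a = c"
    and E: "symp E" "\<And>w. \<not> E w w"
  shows "even (card X)"
proof -
  define f where "f w = (SOME a. a \<in> X \<and> E w a)" for w
  have f: "f w \<in> X \<and> E w (f w)" if "w \<in> X" for w unfolding f_def by (rule someI_ex) (use ex[OF that] in blast)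
  have "f (f w) = w" if w: "w \<in> X" for w
    using uni[of "f w" "f (f w)" w] f[OF w] f[of "f w"] w sympD[OF E(1)] by blast
  note ff = this
  show ?thesis
  proof (rule prime_dvd_card_if_no_fixpoint[where f = f])
    show "(f ^^ 2) w = w" if "w \<in> X" for w using ff[OF that] by (simp add: numeral_2_eq_2)
    show "f w \<noteq> w" if "w \<in> X" for w using f[OF that] E(2) by metis
  qed (use f assms(1) in auto)
qed

primrec walk_count :: "(nat \<Rightarrow> nat \<Rightarrow> bool) \<Rightarrow> nat \<Rightarrow> nat \<Rightarrow> nat \<Rightarrow> nat" where
  "walk_count E 0 u w = (if u = w then 1 else 0)"
| "walk_count E (Suc m) u w = (\<Sum>y | E u y. walk_count E m y w)"

text \<open>The starting vertex is not stored, so a closed walk of length \<open>m\<close> is a list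
  of \<open>m\<close> vertices on which \<open>rotate1\<close> acts.\<close>

definition walk_set :: "(nat \<Rightarrow> nat \<Rightarrow> bool) \<Rightarrow> nat \<Rightarrow> nat \<Rightarrow> nat \<Rightarrow> nat list set" where
  "walk_set E m u w = {ys. length ys = m \<and> successively E (u # ys) \<and> last (u # ys) = w}"

lemma card_walk_set:
  assumes fin: "\<And>u. finite {y. E u y}"
  shows "finite (walk_set E m u w) \<and> card (walk_set E m u w) = walk_count E m u w"
proof (induction m arbitrary: u)
  case 0
  have "walk_set E 0 u w = (if u = w then {[]} else {})" by (auto simp: walk_set_def)
  then show ?case by simp
next
  case (Suc m)
  have eq: "walk_set E (Suc m) u w = (\<Union>y\<in>{y. E u y}. (#) y ` walk_set E m y w)"
  proof (intro equalityI subsetI)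
    fix ys assume ys: "ys \<in> walk_set E (Suc m) u w"
    then obtain y zs where "ys = y # zs" by (cases ys) (auto simp: walk_set_def)
    then show "ys \<in> (\<Union>y\<in>{y. E u y}. (#) y ` walk_set E m y w)" using ys by (auto simp: walk_set_def)
  qed (auto simp: walk_set_def)
  have "card (\<Union>y\<in>{y. E u y}. (#) y ` walk_set E m y w) = (\<Sum>y | E u y. card ((#) y ` walk_set E m y w))"
    using fin Suc by (intro card_UN_disjoint) auto
  also have "\<dots> = (\<Sum>y | E u y. walk_count E m y w)"
    using Suc by (intro sum.cong refl) (simp add: card_image)
  finally show ?case unfolding eq using fin Suc by simp
qed

section \<open>Graphs without 4-cycles: weighted counting of missing pairs\<close>

context extremal_graph
begin

definition missing :: "nat \<Rightarrow> nat set" where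
  "missing u = {w. w < n \<and> w \<noteq> u \<and> (\<forall>a. \<not> (E u a \<and> E w a))}"

lemma finite_missing [simp]: "finite (missing u)" by (simp add: missing_def)

end

locale c4_graph = extremal_graph +
  assumes \<kappa>1: "\<kappa> = 1" and n5: "5 \<le> n"
begin

abbreviation m :: "nat \<Rightarrow> nat" where "m u \<equiv> card (missing u)"
abbreviation d :: "nat \<Rightarrow> nat" where "d u \<equiv> card (nb u)"

lemma t1: "t = 1" and k2: "k 1 = 2"
proof -
  have "(\<Sum>i = 1..t. 1) \<le> (\<Sum>i = 1..t. k i - 1)"
  proof (rule sum_mono)
    show "1 \<le> k i - 1" if "i \<in> {1..t}" for i using k[OF that] by linarith
  qed
  then show "t = 1" using t \<kappa> \<kappa>1 by simp
  then show "k 1 = 2" using \<kappa> \<kappa>1 k[of 1] by simp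
qed

lemma unique_common:
  assumes "u \<noteq> v" "E u a" "E v a" "E u c" "E v c" shows "a = c"
proof (rule ccontr)
  assume "a \<noteq> c"
  then have "flower E {1..t} k" using assms t1 k2 E_irrefl
    by (intro flower_if_common_neighbours[where R = "{u, v}" and C = "{a, c}"] E_symp) auto
  then show False using no_flower by simp
qed

lemma free_if_center:
  assumes E': "simple_rel n E'" and m: "\<And>u v w. u \<noteq> 0 \<Longrightarrow> v \<noteq> 0 \<Longrightarrow> w \<noteq> 0 \<Longrightarrow> E' u v \<Longrightarrow> E' u w \<Longrightarrow> v = w"
  shows "free n E'"
proof (rule free_if_minor_free[OF E'])
  show "minor_free (graph_of n E') F"
  proof (rule minor_free_if_cover[OF E', of "{0}" False])
    show "v = w" if "u \<notin> {0}" "v \<notin> {0}" "w \<notin> {0}" "E' u v" "E' u w" for u v w using m[of u v w] that by simp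
  qed (use \<kappa>1 t1 k2 in auto)
qed

lemma lam_gt1: "1 < lam"
proof (rule ccontr)
  assume "\<not> 1 < lam"
  then have "lam\<^sup>2 \<le> 1" using rho_E_nonneg by (simp add: power_le_one)
  moreover have "real n - 1 \<le> lam\<^sup>2" using rho_lower n5 \<kappa>1 by simp
  ultimately show False using n5 by simp
qed

text \<open>The vector \<open>y\<close> solves the eigenvalue equation for \<open>lam\<close>
  everywhere except at vertex 0; an excess there would lift the Rayleigh quotient above
  \<open>lam\<close>. In this way the spectral radius of the comparison graph need not be
  computed.\<close>

lemma center_test:
  assumes E': "simple_rel n E'" "free n E'" and y: "y 0 = 1"
    and ev: "\<And>i. i < n \<Longrightarrow> i \<noteq> 0 \<Longrightarrow> adj_sum n E' y i = lam * y i"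
  shows "adj_sum n E' y 0 \<le> lam"
proof (rule ccontr)
  assume "\<not> adj_sum n E' y 0 \<le> lam"
  then have gt: "lam < adj_sum n E' y 0" by simp
  have "lam * (\<Sum>i<n. (y i)\<^sup>2) = (\<Sum>i<n. y i * (lam * y i))" by (simp add: sum_distrib_left power2_eq_square algebra_simps)
  also have "\<dots> < (\<Sum>i<n. y i * adj_sum n E' y i)"
  proof (rule sum_strict_mono_ex1)
    show "\<forall>i\<in>{..<n}. y i * (lam * y i) \<le> y i * adj_sum n E' y i"
    proof
      fix i assume "i \<in> {..<n}"
      then show "y i * (lam * y i) \<le> y i * adj_sum n E' y i" using ev[of i] y gt by (cases "i = 0") auto
    qed
    show "\<exists>i\<in>{..<n}. y i * (lam * y i) < y i * adj_sum n E' y i" using y gt n_pos by (intro bexI[of _ 0]) auto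
  qed simp
  also have "\<dots> = qform n E' y" by (simp add: qform_def)
  also have "\<dots> \<le> rho n E' * (\<Sum>i<n. (y i)\<^sup>2)" by (rule rayleigh[OF E'(1) n_pos])
  also have "\<dots> \<le> lam * (\<Sum>i<n. (y i)\<^sup>2)" using extremal[OF E'] by (intro mult_right_mono sum_nonneg) auto
  finally show False by simp
qed

definition partner :: "nat \<Rightarrow> nat" where "partner i = (if odd i then Suc i else i - 1)"

text \<open>The friendship graph: triangles sharing vertex 0. For even \<open>n\<close> the vertex
  \<open>n - 1\<close> has no partner below \<open>n\<close> and is pendant.\<close>

definition windmill :: "nat \<Rightarrow> nat \<Rightarrow> bool" where
  "windmill i j \<longleftrightarrow> i < n \<and> j < n \<and> i \<noteq> j \<and> (i = 0 \<or> j = 0 \<or> j = partner i)"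

lemma partner_partner: "i \<noteq> 0 \<Longrightarrow> partner (partner i) = i" "i \<noteq> 0 \<Longrightarrow> partner i \<noteq> i" "i \<noteq> 0 \<Longrightarrow> partner i \<noteq> 0"
  by (cases "odd i"; auto simp: partner_def)+

lemma simple_windmill: "simple_rel n windmill" and free_windmill: "free n windmill"
proof -
  show windmill: "simple_rel n windmill" unfolding simple_rel_def symp_def windmill_def using partner_partner by metis
  show "free n windmill" by (rule free_if_center[OF windmill]) (auto simp: windmill_def)
qed

lemma adj_sum_windmill_0: "adj_sum n windmill y 0 = (\<Sum>j = 1..<n. y j)"
proof -
  have "{j. windmill 0 j} = {1..<n}" using n5 by (auto simp: windmill_def)
  then show ?thesis using adj_sum_eq[OF simple_windmill] by simp
qed

lemma adj_sum_windmill: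
  assumes "i < n" "i \<noteq> 0"
  shows "adj_sum n windmill y i = y 0 + (if partner i < n then y (partner i) else 0)"
proof -
  have "{j. windmill i j} = insert 0 (if partner i < n then {partner i} else {})" using assms partner_partner[of i] by (auto simp: windmill_def)
  then show ?thesis using adj_sum_eq[OF simple_windmill] partner_partner[of i] assms by simp
qed

lemma lam_odd: assumes "odd n" shows "real n - 1 \<le> lam\<^sup>2 - lam"
proof -
  \<comment> \<open>With value 1 at the centre, the common value \<open>c\<close> of two partners
    must satisfy \<open>lam * c = 1 + c\<close>.\<close>
  define y where "y i = (if i = 0 then 1 else 1 / (lam - 1))" for i :: nat
  have "adj_sum n windmill y 0 \<le> lam"
  proof (rule center_test[OF simple_windmill free_windmill])
    fix i assume i: "i < n" "i \<noteq> 0"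
    have "partner i = Suc i \<and> odd i \<or> partner i = i - 1 \<and> even i" by (simp add: partner_def)
    then have "partner i < n" using i assms by presburger
    then have "adj_sum n windmill y i = 1 + 1 / (lam - 1)" using adj_sum_windmill[OF i] partner_partner[of i] i by (simp add: y_def)
    also have "\<dots> = lam * y i" using i lam_gt1 by (simp add: y_def field_simps)
    finally show "adj_sum n windmill y i = lam * y i" .
  qed (simp add: y_def)
  moreover have "adj_sum n windmill y 0 = (\<Sum>j = 1..<n. 1 / (lam - 1))" unfolding adj_sum_windmill_0 by (intro sum.cong) (auto simp: y_def)
  ultimately have "(real n - 1) / (lam - 1) \<le> lam" using n5 by (simp add: of_nat_diff)
  then show ?thesis using lam_gt1 by (simp add: pos_divide_le_eq power2_eq_square algebra_simps)
qed

lemma lam_even: assumes "even n" shows "(real n - 1) * lam \<le> lam ^ 3 - lam\<^sup>2 + 1"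
proof -
  \<comment> \<open>As in the odd case, but the pendant vertex must satisfy
    \<open>lam * y (n - 1) = 1\<close>.\<close>
  define y where "y i = (if i = 0 then 1 else if i = n - 1 then 1 / lam else 1 / (lam - 1))" for i :: nat
  have "adj_sum n windmill y 0 \<le> lam"
  proof (rule center_test[OF simple_windmill free_windmill])
    fix i assume i: "i < n" "i \<noteq> 0"
    show "adj_sum n windmill y i = lam * y i"
    proof (cases "i = n - 1")
      case True
      then have "\<not> partner i < n" using assms n5 by (auto simp: partner_def)
      then show ?thesis using adj_sum_windmill[OF i] True i lam_gt1 by (simp add: y_def)
    next
      case False
      have "partner i = Suc i \<and> odd i \<or> partner i = i - 1 \<and> even i" by (simp add: partner_def)
      then have "partner i < n \<and> partner i \<noteq> n - 1" using False i assms by presburger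
      then have "adj_sum n windmill y i = 1 + 1 / (lam - 1)" using adj_sum_windmill[OF i] partner_partner[of i] i by (simp add: y_def)
      also have "\<dots> = lam * y i" using i False lam_gt1 by (simp add: y_def field_simps)
      finally show ?thesis .
    qed
  qed (simp add: y_def)
  moreover have "adj_sum n windmill y 0 = (\<Sum>j = 1..<n - 1. 1 / (lam - 1)) + 1 / lam"
  proof -
    have "{1..<n} = insert (n - 1) {1..<n - 1}" using n5 by auto
    then have "adj_sum n windmill y 0 = y (n - 1) + (\<Sum>j = 1..<n - 1. y j)" unfolding adj_sum_windmill_0 by simp
    also have "(\<Sum>j = 1..<n - 1. y j) = (\<Sum>j = 1..<n - 1. 1 / (lam - 1))" by (intro sum.cong) (auto simp: y_def)
    moreover have "y (n - 1) = 1 / lam" using n5 by (simp add: y_def)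
    ultimately show ?thesis by linarith
  qed
  ultimately have "(real n - 2) / (lam - 1) + 1 / lam \<le> lam" using n5 by (simp add: of_nat_diff)
  then have "((real n - 2) / (lam - 1) + 1 / lam) * (lam * (lam - 1)) \<le> lam * (lam * (lam - 1))"
    using lam_gt1 by (intro mult_right_mono) auto
  moreover have "((real n - 2) / (lam - 1) + 1 / lam) * (lam * (lam - 1)) = (real n - 2) * lam + (lam - 1)"
    using lam_gt1 by (simp add: field_simps)
  ultimately show ?thesis by (simp add: power2_eq_square power3_eq_cube algebra_simps)
qed

text \<open>Without 4-cycles the sets \<open>nb w - {u}\<close> for the neighbours \<open>w\<close>
  of \<open>u\<close> are disjoint, and their union consists of the vertices that have a common
  neighbour with \<open>u\<close>.\<close>

lemma nb_union:
  assumes "u < n"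
  shows "(\<Sum>w\<in>nb u. d w - 1) + m u = n - 1"
proof -
  have "card (nb w - {u}) = d w - 1" if "w \<in> nb u" for w using that E_sym[of u w] by (intro card_Diff_singleton) auto
  then have "(\<Sum>w\<in>nb u. d w - 1) = (\<Sum>w\<in>nb u. card (nb w - {u}))" by (intro sum.cong) auto
  also have "\<dots> = card (\<Union>w\<in>nb u. nb w - {u})"
  proof (rule card_UN_disjoint[symmetric])
    show "\<forall>w\<in>nb u. \<forall>w'\<in>nb u. w \<noteq> w' \<longrightarrow> (nb w - {u}) \<inter> (nb w' - {u}) = {}"
      using unique_common E_sym by blast
  qed auto
  also have "\<dots> + m u = card ((\<Union>w\<in>nb u. nb w - {u}) \<union> missing u)"
    by (rule card_Un_disjoint[symmetric]) (auto simp: missing_def dest: E_sym)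
  also have "(\<Union>w\<in>nb u. nb w - {u}) \<union> missing u = {..<n} - {u}"
    using E_less E_sym by (auto simp: missing_def)
  finally show ?thesis using assms by simp
qed

lemma d_pos: "E u w \<Longrightarrow> 1 \<le> d w"
proof -
  assume "E u w"
  then have "u \<in> nb w" using E_sym by simp
  then have "0 < d w" using finite_nbs(1)[of w] unfolding card_gt_0_iff by blast
  then show ?thesis by simp
qed

text \<open>Sum \<open>nb_union\<close> over \<open>u\<close> with weights \<open>x u\<close>: by
  symmetry of the adjacency each degree turns into a factor \<open>lam\<close>. The bounds
  \<open>lam_odd\<close> and \<open>lam_even\<close> control the factor on the right.\<close>

lemma sum_missing: "(\<Sum>u<n. x u * m u) = (real n - 1 - lam\<^sup>2 + lam) * (\<Sum>u<n. x u)"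
proof -
  have ev: "adj_sum n E x u = lam * x u" if "u < n" for u using eigen[OF that] by (simp add: adj_sum_eq[OF simple])
  have deg: "adj_sum n E (\<lambda>_. 1) u = d u" for u by (simp add: adj_sum_eq[OF simple])
  have dx: "(\<Sum>u<n. x u * d u) = lam * (\<Sum>u<n. x u)"
  proof -
    have "(\<Sum>u<n. x u * d u) = (\<Sum>u<n. x u * adj_sum n E (\<lambda>_. 1) u)" by (simp add: deg)
    also have "\<dots> = (\<Sum>u<n. 1 * adj_sum n E x u)" by (rule adj_sum_swap[OF simple])
    also have "\<dots> = (\<Sum>u<n. lam * x u)" using ev by (intro sum.cong) auto
    finally show ?thesis by (simp add: sum_distrib_left)
  qed
  have r: "real (m u) = real n - 1 - (adj_sum n E (\<lambda>w. real (d w)) u - d u)" if u: "u < n" for u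
  proof -
    have "real (\<Sum>w\<in>nb u. d w - 1) = (\<Sum>w\<in>nb u. real (d w) - 1)"
      unfolding of_nat_sum by (intro sum.cong refl) (use d_pos in \<open>auto simp: of_nat_diff\<close>)
    also have "\<dots> = adj_sum n E (\<lambda>w. real (d w)) u - d u" by (simp add: sum_subtractf adj_sum_eq[OF simple])
    finally have "adj_sum n E (\<lambda>w. real (d w)) u - d u + real (m u) = real (n - 1)"
      using nb_union[OF u] by (metis of_nat_add)
    then show ?thesis using u by (simp add: of_nat_diff)
  qed
  have "(\<Sum>u<n. x u * m u) = (\<Sum>u<n. x u * (real n - 1 - (adj_sum n E (\<lambda>w. real (d w)) u - d u)))"
    using r by (intro sum.cong) auto
  also have "\<dots> = (real n - 1) * (\<Sum>u<n. x u) - (\<Sum>u<n. x u * adj_sum n E (\<lambda>w. real (d w)) u) + (\<Sum>u<n. x u * d u)"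
    by (simp add: algebra_simps sum.distrib sum_subtractf sum_distrib_left)
  also have "(\<Sum>u<n. x u * adj_sum n E (\<lambda>w. real (d w)) u) = (\<Sum>u<n. d u * adj_sum n E x u)" by (rule adj_sum_swap[OF simple])
  also have "\<dots> = lam * (\<Sum>u<n. x u * d u)" unfolding sum_distrib_left using ev by (intro sum.cong) auto
  finally show ?thesis unfolding dx by (simp add: algebra_simps power2_eq_square)
qed

lemma sum_x_pos: "0 < (\<Sum>u<n. x u)" using x_pos n_pos by (intro sum_pos) auto

lemma common_if_not_missing: "w < n \<Longrightarrow> w \<noteq> u \<Longrightarrow> w \<notin> missing u \<Longrightarrow> \<exists>a. E u a \<and> E w a"
  by (auto simp: missing_def)

text \<open>Mapping each neighbour of \<open>u\<close> to its common neighbour with \<open>v\<close> is injective, as there are no 4-cycles.\<close>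

lemma degree_le:
  assumes "u < n" "v < n" "\<not> E u v" "u \<noteq> v" and "nb u \<inter> missing v = {}"
  shows "d u \<le> d v"
proof -
  have "\<exists>a. E v a \<and> E w a" if "w \<in> nb u" for w
    using that assms E_less by (intro common_if_not_missing) auto
  then obtain g where g: "\<And>w. w \<in> nb u \<Longrightarrow> E v (g w) \<and> E w (g w)" by metis
  have "inj_on g (nb u)"
  proof (rule inj_onI)
    fix w w' assume w: "w \<in> nb u" "w' \<in> nb u" "g w = g w'"
    have "g w \<noteq> u" using g[OF w(1)] assms(3) E_sym by blast
    then show "w = w'" using unique_common[of u "g w" w w'] w g[OF w(1)] g[OF w(2)] E_sym by fastforce
  qed
  then show ?thesis using g by (intro card_inj_on_le[of g]) auto
qed

end

context c4_graph
begin

text \<open>A neighbour of \<open>u\<close> has at most one common neighbour with \<open>u\<close>,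
  so under the hypothesis \<open>E\<close> is a perfect matching on \<open>nb u\<close>.\<close>

lemma even_degree_if_matched:
  assumes "\<And>w. E u w \<Longrightarrow> \<exists>a. E u a \<and> E w a"
  shows "even (d u)"
proof (rule even_card_if_matched[OF _ _ _ E_symp E_irrefl])
  show "\<exists>a\<in>nb u. E w a" if "w \<in> nb u" for w using assms that by auto
  show "a = c" if "w \<in> nb u" "a \<in> nb u" "c \<in> nb u" "E w a" "E w c" for w a c
    using unique_common[of u w a c] that E_irrefl by auto
qed simp

lemma matched_if_not_missing:
  assumes "m u = 0" "E u w" shows "\<exists>a. E u a \<and> E w a"
proof -
  have "missing u = {}" using assms(1) by simp
  then show ?thesis using common_if_not_missing[of w u] assms(2) E_less E_irrefl by blast
qed

lemma even_degree_if_good: "m u = 0 \<Longrightarrow> even (d u)"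
  by (rule even_degree_if_matched) (rule matched_if_not_missing)

subsection \<open>An odd number of vertices: the friendship theorem\<close>

text \<open>Without a universal vertex the graph is regular of degree \<open>D\<close>, by
  \<open>degree_le\<close>. For a prime \<open>p\<close> dividing \<open>D - 1\<close>, any two
  vertices are joined by 1 mod \<open>p\<close> walks of each length at least 2, so the number of
  closed walks of length \<open>p\<close> is congruent to \<open>n\<close> and hence to 1. Rotation,
  however, splits them into orbits of size \<open>p\<close>.\<close>

lemma friendship_universal:
  assumes good: "\<And>u. u < n \<Longrightarrow> missing u = {}"
  shows "\<exists>c<n. \<forall>v<n. v \<noteq> c \<longrightarrow> E c v"
proof (rule ccontr)
  assume no: "\<not> ?thesis"
  have eq: "d u = d v" if "u < n" "v < n" "\<not> E u v" "u \<noteq> v" for u v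
    using degree_le[of u v] degree_le[of v u] that good E_sym by (metis Int_empty_right antisym)
  define D where "D = d 0"
  define X where "X = {u. u < n \<and> d u = D}"
  define Y where "Y = {u. u < n \<and> d u \<noteq> D}"
  have XY: "E u v" "u \<noteq> v" if "u \<in> X" "v \<in> Y" for u v using eq[of u v] that by (auto simp: X_def Y_def)
  have all: "v \<in> X \<or> v \<in> Y" if "v < n" for v using that by (auto simp: X_def Y_def)
  have X0: "0 \<in> X" using n_pos by (simp add: X_def D_def)
  \<comment> \<open>\<open>X\<close> and \<open>Y\<close> are completely joined. As no vertex is
    universal, a nonempty \<open>Y\<close> would give two vertices on each side, hence a
    4-cycle.\<close>
  have "Y = {}"
  proof (rule ccontr)
    assume "Y \<noteq> {}"
    then obtain y where y: "y \<in> Y" by auto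
    obtain a where a: "a \<in> X" "a \<noteq> 0"
    proof -
      have "\<exists>a\<in>X. a \<noteq> 0"
      proof (rule ccontr)
        assume "\<not> ?thesis"
        then have "E 0 v" if "v < n" "v \<noteq> 0" for v using all[OF that(1)] that XY[OF X0] by blast
        then show False using no n_pos by blast
      qed
      then show thesis using that by blast
    qed
    obtain c where c: "c \<in> Y" "c \<noteq> y"
    proof -
      have "\<exists>c\<in>Y. c \<noteq> y"
      proof (rule ccontr)
        assume "\<not> ?thesis"
        then have "E y v" if "v < n" "v \<noteq> y" for v using all[OF that(1)] that XY[OF _ y] E_sym by blast
        then show False using no y by (auto simp: Y_def)
      qed
      then show thesis using that by blast
    qed
    show False using unique_common[of 0 a y c] XY X0 a y c by blast
  qed
  then have reg: "d u = D" if "u < n" for u using all[OF that] that by (auto simp: X_def)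
  have nD: "D * (D - 1) + 1 = n"
  proof -
    have "(\<Sum>w\<in>nb 0. d w - 1) = (\<Sum>w\<in>nb 0. D - 1)" using reg E_less by (intro sum.cong) auto
    then have "(\<Sum>w\<in>nb 0. d w - 1) = D * (D - 1)" by (simp add: D_def)
    then show ?thesis using nb_union[OF n_pos] good[OF n_pos] n_pos by simp
  qed
  have D3: "3 \<le> D"
  proof (rule ccontr)
    assume "\<not> 3 \<le> D"
    then have "D * (D - 1) \<le> 2 * 1" by (intro mult_le_mono) auto
    then show False using nD n5 by simp
  qed
  then have "D - 1 \<noteq> 1" by linarith
  then obtain p where p: "prime p" "p dvd D - 1" using prime_factor_nat by blast
  have p2: "2 \<le> p" using prime_ge_2_nat[OF p(1)] .
  have "[D - 1 = 0] (mod p)" using p(2) by (simp add: cong_0_iff)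
  then have "[D - 1 + 1 = 0 + 1] (mod p)" by (intro cong_add cong_refl)
  then have Dp: "[D = 1] (mod p)" using D3 by simp
  have step: "[walk_count E (Suc j) u w = 1] (mod p)" if "u < n" "\<And>y. y < n \<Longrightarrow> [walk_count E j y w = 1] (mod p)" for j u w
  proof -
    have "[walk_count E (Suc j) u w = (\<Sum>y\<in>nb u. 1)] (mod p)"
      unfolding walk_count.simps using that(2) E_less by (intro cong_sum) auto
    moreover have "(\<Sum>y\<in>nb u. 1) = D" using reg[OF that(1)] by simp
    ultimately show ?thesis using Dp by (metis cong_trans)
  qed
  have base: "[walk_count E 2 u w = 1] (mod p)" if uw: "u < n" "w < n" for u w
  proof -
    have "walk_count E 2 u w = (\<Sum>y\<in>nb u. \<Sum>y'\<in>nb y. if y' = w then 1 else 0)"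
      by (simp add: numeral_2_eq_2)
    also have "\<dots> = (\<Sum>y\<in>nb u. if E y w then 1 else 0)"
      by (intro sum.cong refl) (simp add: sum.delta)
    also have "\<dots> = card {y \<in> nb u. E y w}" by (simp add: sum.If_cases Int_def)
    finally have wc: "walk_count E 2 u w = card {y \<in> nb u. E y w}" .
    show ?thesis
    proof (cases "u = w")
      case True
      have "{y \<in> nb u. E y w} = nb u" using True E_sym by auto
      then show ?thesis using wc reg[OF uw(1)] Dp by simp
    next
      case False
      obtain a where a: "E u a" "E w a" using common_if_not_missing[of w u] good[OF uw(1)] uw False by auto
      have "{y \<in> nb u. E y w} = {a}" using a E_sym unique_common[OF False] by blast
      then show ?thesis using wc by simp
    qed
  qed
  have all1: "[walk_count E (j + 2) u w = 1] (mod p)" if "u < n" "w < n" for j u w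
    using that(1)
  proof (induction j arbitrary: u)
    case 0
    then show ?case using base[OF _ that(2)] by (simp only: add_0_left)
  next
    case (Suc j)
    have "[walk_count E (Suc (j + 2)) u w = 1] (mod p)" by (rule step) (use Suc in auto)
    then show ?case by (simp only: add_Suc)
  qed
  define C where "C = {ys. length ys = p \<and> successively E (last ys # ys)}"
  have C_eq: "C = (\<Union>u\<in>{..<n}. walk_set E p u u)"
  proof (intro equalityI subsetI)
    fix ys assume ys: "ys \<in> C"
    then have ne: "ys \<noteq> []" using p2 by (auto simp: C_def)
    then have "E (last ys) (hd ys)" using ys by (cases ys) (auto simp: C_def)
    then show "ys \<in> (\<Union>u\<in>{..<n}. walk_set E p u u)"
      using ys ne E_less by (intro UN_I[of "last ys"]) (auto simp: C_def walk_set_def)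
  next
    fix ys assume "ys \<in> (\<Union>u\<in>{..<n}. walk_set E p u u)"
    then obtain u where u: "ys \<in> walk_set E p u u" by auto
    then have "ys \<noteq> []" using p2 by (auto simp: walk_set_def)
    then show "ys \<in> C" using u by (auto simp: C_def walk_set_def)
  qed
  have ws: "finite (walk_set E p u w)" "card (walk_set E p u w) = walk_count E p u w" for u w
    using card_walk_set[of E p u w] by auto
  have "card C = (\<Sum>u<n. card (walk_set E p u u))" unfolding C_eq
  proof (rule card_UN_disjoint)
    show "\<forall>i\<in>{..<n}. \<forall>j\<in>{..<n}. i \<noteq> j \<longrightarrow> walk_set E p i i \<inter> walk_set E p j j = {}"
      using p2 by (auto simp: walk_set_def split: if_splits)
  qed (use ws in auto)
  also have "\<dots> = (\<Sum>u<n. walk_count E p u u)" using ws by simp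
  finally have "[card C = (\<Sum>u<n. 1)] (mod p)"
  proof -
    assume c: "card C = (\<Sum>u<n. walk_count E p u u)"
    have "[walk_count E p u u = 1] (mod p)" if "u < n" for u
    proof -
      have "p - 2 + 2 = p" using p2 by simp
      then show ?thesis using all1[OF that that, of "p - 2"] by (simp only:)
    qed
    then show ?thesis unfolding c by (intro cong_sum) auto
  qed
  then have "[card C = n] (mod p)" by simp
  moreover have "[n = 1] (mod p)"
  proof -
    have "[D * (D - 1) + 1 = 0 + 1] (mod p)" using p(2) by (intro cong_add cong_refl) (simp add: cong_0_iff)
    then show ?thesis using nD by simp
  qed
  ultimately have "[card C = 1] (mod p)" by (rule cong_trans)
  moreover have "p dvd card C"
  proof (rule prime_dvd_card_if_no_fixpoint[OF p(1), where f = rotate1])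
    show "finite C" unfolding C_eq using ws by simp
    fix ys assume ys: "ys \<in> C"
    then have len: "length ys = p" by (simp add: C_def)
    obtain y zs where y: "ys = y # zs" using len p2 by (cases ys) auto
    have zs: "zs \<noteq> []" using len p2 y by auto
    have ad: "E (last zs) y" "successively E (y # zs)" using ys zs y by (auto simp: C_def)
    have "successively E ((y # zs) @ [y])" using ad zs unfolding successively_append_iff by simp
    then show "rotate1 ys \<in> C" using len y by (simp add: C_def)
    have "(rotate1 ^^ p) ys = rotate (length ys) ys" using len by (simp add: rotate_def)
    then show "(rotate1 ^^ p) ys = ys" by simp
    \<comment> \<open>A list fixed by \<open>rotate1\<close> is constant, and its walk would use a
      loop.\<close>
    show "rotate1 ys \<noteq> ys"
    proof
      assume "rotate1 ys = ys"
      then have "zs @ [y] = y # zs" using y by simp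
      then have "set zs \<subseteq> {y}" by (induction zs) auto
      then have "last zs = y" using last_in_set[OF zs] by blast
      then show False using ad(1) E_irrefl by simp
    qed
  qed
  ultimately have "[1 = 0] (mod p)" by (metis cong_0_iff cong_sym cong_trans)
  then show False using p2 by (simp add: cong_def)
qed

lemma universal_odd:
  assumes "odd n" shows "\<exists>c<n. \<forall>v<n. v \<noteq> c \<longrightarrow> E c v"
proof (rule friendship_universal)
  fix u assume u: "u < n"
  have "(real n - 1 - lam\<^sup>2 + lam) * (\<Sum>u<n. x u) \<le> 0"
    using lam_odd[OF assms] sum_x_pos by (intro mult_nonpos_nonneg) auto
  then have "(\<Sum>u<n. x u * m u) \<le> 0" using sum_missing by simp
  moreover have "x u * m u \<le> (\<Sum>u<n. x u * m u)" using u x_nonneg by (intro member_le_sum) auto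
  ultimately have "x u * m u \<le> 0" by simp
  then have "m u = 0" using x_pos[OF u] by (simp add: mult_le_0_iff)
  then show "missing u = {}" by simp
qed

subsection \<open>An even number of vertices\<close>

definition missing_sum :: "nat \<Rightarrow> nat" where "missing_sum w = (\<Sum>u\<in>nb w. m u)"

text \<open>Parity in \<open>nb_union\<close>: \<open>d w\<close> is even by
  \<open>even_degree_if_good\<close>, and the \<open>d w\<close> terms \<open>d u - 1\<close> add up
  to the odd number \<open>n - 1\<close>, so they cannot all be odd.\<close>

lemma odd_neighbour:
  assumes "even n" "w < n" "m w = 0"
  shows "\<exists>u. E w u \<and> odd (d u)"
proof (rule ccontr)
  assume no: "\<not> ?thesis"
  have "even (\<Sum>u\<in>nb w. d u - 1) \<longleftrightarrow> even (card {u \<in> nb w. odd (d u - 1)})" by (rule even_sum_iff) simp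
  moreover have "{u \<in> nb w. odd (d u - 1)} = nb w" using no d_pos by fastforce
  ultimately have "even (\<Sum>u\<in>nb w. d u - 1)" using even_degree_if_good[OF assms(3)] by simp
  then show False using nb_union[OF assms(2)] assms n5 by (metis add.right_neutral dvd_diffD1 even_add odd_one one_le_numeral order_trans)
qed

lemma m_pos_if_odd: "odd (d u) \<Longrightarrow> 1 \<le> m u"
proof -
  assume "odd (d u)"
  then have "m u \<noteq> 0" using even_degree_if_good by blast
  then show ?thesis by linarith
qed

lemma m_le_missing_sum: "E w u \<Longrightarrow> m u \<le> missing_sum w" unfolding missing_sum_def by (rule member_le_sum) auto

text \<open>The vertices of \<open>Z\<close> spoil the estimate that \<open>missing_sum\<close> is
  at least 1. But they have positive \<open>m\<close> themselves and so raise
  \<open>missing_sum\<close> at their neighbours; in the Perron weighting this gain is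
  \<open>lam\<close> times the loss. Since \<open>lam\<close> exceeds 1 and \<open>lam_even\<close>
  bounds the total, \<open>Z\<close> is empty and equality holds everywhere.\<close>

lemma missing_sum_eq_1:
  assumes even: "even n"
  shows "\<forall>w<n. missing_sum w = 1"
proof -
  define Z where "Z = {w. w < n \<and> missing_sum w = 0}"
  have Zd: "even (d w) \<and> 1 \<le> m w" if w: "w \<in> Z" for w
  proof -
    have g: "m u = 0" if "E w u" for u using m_le_missing_sum[OF that] w by (simp add: Z_def)
    have "even (d w)"
    proof (rule even_degree_if_matched)
      fix u assume u: "E w u"
      show "\<exists>a. E w a \<and> E u a" using matched_if_not_missing[OF g[OF u] E_sym[OF u]] by blast
    qed
    moreover have "m w \<noteq> 0"
    proof
      assume "m w = 0"
      then obtain u where "E w u" "odd (d u)" using odd_neighbour[OF even] w by (auto simp: Z_def)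
      then show False using g m_pos_if_odd by fastforce
    qed
    ultimately show ?thesis by (metis One_nat_def Suc_leI gr0I)
  qed
  \<comment> \<open>If \<open>m u = 0\<close>, the neighbour of odd degree counts in addition to
    those in \<open>Z\<close>, whose degrees are even. If \<open>m u\<close> is positive, no
    neighbour of \<open>u\<close> can lie in \<open>Z\<close>.\<close>
  have ge: "card (nb u \<inter> Z) + 1 \<le> missing_sum u + (if u \<in> Z then 1 else 0)" if u: "u < n" for u
  proof (cases "m u = 0")
    case True
    obtain a where a: "E u a" "odd (d a)" using odd_neighbour[OF even u True] by blast
    then have aZ: "a \<notin> Z" using Zd by blast
    have "card (nb u \<inter> Z) + 1 = (\<Sum>v\<in>insert a (nb u \<inter> Z). 1)" using aZ by simp
    also have "\<dots> \<le> (\<Sum>v\<in>insert a (nb u \<inter> Z). m v)" using Zd m_pos_if_odd[OF a(2)] by (intro sum_mono) auto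
    also have "\<dots> \<le> missing_sum u" unfolding missing_sum_def using a by (intro sum_mono2) auto
    finally show ?thesis by simp
  next
    case False
    have "nb u \<inter> Z = {}"
    proof (rule ccontr)
      assume "nb u \<inter> Z \<noteq> {}"
      then obtain w where w: "E u w" "w \<in> Z" by auto
      then show False using m_le_missing_sum[OF E_sym[OF w(1)]] False by (simp add: Z_def)
    qed
    then show ?thesis using u by (auto simp: Z_def)
  qed
  let ?S = "\<Sum>u<n. x u"
  have ev: "adj_sum n E x u = lam * x u" if "u < n" for u using eigen[OF that] by (simp add: adj_sum_eq[OF simple])
  have MS: "(\<Sum>u<n. x u * missing_sum u) = lam * (\<Sum>u<n. x u * m u)"
  proof -
    have "(\<Sum>u<n. x u * missing_sum u) = (\<Sum>u<n. x u * adj_sum n E (\<lambda>u. real (m u)) u)" by (simp add: missing_sum_def adj_sum_eq[OF simple])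
    also have "\<dots> = (\<Sum>u<n. m u * adj_sum n E x u)" by (rule adj_sum_swap[OF simple])
    also have "\<dots> = lam * (\<Sum>u<n. x u * m u)" unfolding sum_distrib_left using ev by (intro sum.cong) auto
    finally show ?thesis .
  qed
  let ?i = "\<lambda>u. if u \<in> Z then 1 else (0::real)"
  have ZS: "(\<Sum>u<n. x u * card (nb u \<inter> Z)) = lam * (\<Sum>u<n. x u * ?i u)"
  proof -
    have "real (card (nb u \<inter> Z)) = adj_sum n E ?i u" for u by (simp add: adj_sum_eq[OF simple] sum.If_cases)
    then have "(\<Sum>u<n. x u * card (nb u \<inter> Z)) = (\<Sum>u<n. x u * adj_sum n E ?i u)" by simp
    also have "\<dots> = (\<Sum>u<n. ?i u * adj_sum n E x u)" by (rule adj_sum_swap[OF simple])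
    also have "\<dots> = lam * (\<Sum>u<n. x u * ?i u)" unfolding sum_distrib_left using ev by (intro sum.cong) auto
    finally show ?thesis .
  qed
  have le: "x u * card (nb u \<inter> Z) + x u \<le> x u * missing_sum u + x u * ?i u" if "u < n" for u
  proof -
    have "real (card (nb u \<inter> Z) + 1) \<le> real (missing_sum u + (if u \<in> Z then 1 else 0))" using ge[OF that] by (rule of_nat_mono)
    then have "x u * (card (nb u \<inter> Z) + 1) \<le> x u * (missing_sum u + ?i u)" using x_nonneg[of u] by (intro mult_left_mono) auto
    then show ?thesis by (simp add: algebra_simps)
  qed
  have "(\<Sum>u<n. x u * card (nb u \<inter> Z) + x u) \<le> (\<Sum>u<n. x u * missing_sum u + x u * ?i u)" using le by (intro sum_mono) auto
  then have 1: "lam * (\<Sum>u<n. x u * ?i u) + ?S \<le> lam * (\<Sum>u<n. x u * m u) + (\<Sum>u<n. x u * ?i u)"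
    using MS ZS by (simp add: sum.distrib)
  have "lam * (\<Sum>u<n. x u * m u) = ((real n - 1) * lam - lam ^ 3 + lam\<^sup>2) * ?S"
    unfolding sum_missing by (simp add: algebra_simps power2_eq_square power3_eq_cube)
  also have "\<dots> \<le> 1 * ?S" using lam_even[OF even] sum_x_pos by (intro mult_right_mono) auto
  finally have 2: "lam * (\<Sum>u<n. x u * m u) \<le> ?S" by simp
  have I0: "0 \<le> (\<Sum>u<n. x u * ?i u)" using x_nonneg by (intro sum_nonneg) auto
  have "(lam - 1) * (\<Sum>u<n. x u * ?i u) \<le> 0" using 1 2 by (simp add: algebra_simps)
  then have I: "(\<Sum>u<n. x u * ?i u) = 0" using lam_gt1 I0 by (simp add: mult_le_0_iff)
  have Z0: "Z = {}"
  proof (rule ccontr)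
    assume "Z \<noteq> {}"
    then obtain w where w: "w \<in> Z" "w < n" by (auto simp: Z_def)
    have "x w * ?i w \<le> (\<Sum>u<n. x u * ?i u)" using w x_nonneg by (intro member_le_sum) auto
    then show False using I w x_pos[OF w(2)] by simp
  qed
  have ge1: "1 \<le> missing_sum u" if "u < n" for u using ge[OF that] Z0 by simp
  have "(\<Sum>u<n. x u * (real (missing_sum u) - 1)) = lam * (\<Sum>u<n. x u * m u) - ?S" using MS by (simp add: algebra_simps sum_subtractf)
  then have s0: "(\<Sum>u<n. x u * (real (missing_sum u) - 1)) \<le> 0" using 2 by simp
  show ?thesis
  proof (intro allI impI)
    fix u assume u: "u < n"
    have "x u * (real (missing_sum u) - 1) \<le> (\<Sum>u<n. x u * (real (missing_sum u) - 1))"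
      using u x_nonneg ge1 by (intro member_le_sum) (auto intro!: mult_nonneg_nonneg)
    then have "x u * (real (missing_sum u) - 1) \<le> 0" using s0 by linarith
    then have "real (missing_sum u) - 1 \<le> 0" using x_pos[OF u] by (simp add: mult_le_0_iff)
    then show "missing_sum u = 1" using ge1[OF u] by simp
  qed
qed

text \<open>Every vertex has exactly one neighbour with positive \<open>m\<close>, and the value is
  1. This singles out two adjacent vertices \<open>b\<close> and \<open>b'\<close> that miss only
  each other; one of them turns out to be a leaf, which leaves the other adjacent to
  everything.\<close>

lemma universal_even:
  assumes even: "even n" shows "\<exists>c<n. \<forall>v<n. v \<noteq> c \<longrightarrow> E c v"
proof -
  have M1: "missing_sum w = 1" if "w < n" for w using missing_sum_eq_1[OF even] that by blast
  have uniq: "a = c" if "E w a" "E w c" "1 \<le> m a" "1 \<le> m c" for w a c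
  proof (rule ccontr)
    assume ac: "a \<noteq> c"
    have "m a + m c = (\<Sum>u\<in>{a, c}. m u)" using ac by simp
    also have "\<dots> \<le> missing_sum w" unfolding missing_sum_def using that by (intro sum_mono2) auto
    also have "missing_sum w = 1" using M1 E_less that by blast
    finally show False using that by simp
  qed
  have ex: "\<exists>a. E w a \<and> m a = 1" if w: "w < n" for w
  proof -
    have "missing_sum w \<noteq> 0" using M1[OF w] by simp
    then obtain a where a: "E w a" "m a \<noteq> 0" unfolding missing_sum_def by (metis (mono_tags, lifting) mem_Collect_eq sum.neutral)
    then have "m a = 1" using m_le_missing_sum[OF a(1)] M1[OF w] by linarith
    then show ?thesis using a(1) by blast
  qed
  obtain b where b: "b < n" "m b = 1" using ex[OF n_pos] E_less by blast
  obtain b' where b': "E b b'" "m b' = 1" using ex[OF b(1)] by blast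
  have bn: "b' < n" "b \<noteq> b'" using b' E_less E_irrefl by auto
  have nc: False if "E b w" "E b' w" for w
    using uniq[of w b b'] that E_sym b b' bn by auto
  have miss: "missing b = {b'}" "missing b' = {b}"
  proof -
    have "b' \<in> missing b" "b \<in> missing b'" using nc bn b by (auto simp: missing_def)
    then show "missing b = {b'}" "missing b' = {b}" using b(2) b'(2) by (auto simp: card_1_singleton_iff)
  qed
  have odd_b: "odd (d c)" if c: "E c c'" "missing c = {c'}" "c < n" for c c'
  proof -
    have nc: False if "E c w" "E c' w" for w using c that by (auto simp: missing_def)
    have "even (card (nb c - {c'}))"
    proof (rule even_card_if_matched[OF _ _ _ E_symp E_irrefl])
      fix w assume w: "w \<in> nb c - {c'}"
      then obtain a where a: "E c a" "E w a" using common_if_not_missing[of w c] c E_less E_irrefl by blast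
      have "a \<noteq> c'" using nc[of w] a w E_sym by blast
      then show "\<exists>a\<in>nb c - {c'}. E w a" using a by blast
    next
      fix w a e assume "w \<in> nb c - {c'}" "a \<in> nb c - {c'}" "e \<in> nb c - {c'}" "E w a" "E w e"
      then show "a = e" using unique_common[of c w a e] E_irrefl by blast
    qed simp
    moreover have "card (nb c - {c'}) = d c - 1" using c(1) by simp
    moreover obtain j where "d c = Suc j" using d_pos[OF E_sym[OF c(1)]] by (metis One_nat_def Suc_le_D)
    ultimately show ?thesis by simp
  qed
  have ob: "odd (d b)" "odd (d b')" using odd_b[OF b'(1) miss(1) b(1)] odd_b[OF E_sym[OF b'(1)] miss(2) bn(1)] .
  have only: "c = b \<or> c = b'" if c: "c < n" "1 \<le> m c" for c
  proof (rule ccontr)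
    assume nb: "\<not> ?thesis"
    then obtain a where "E b a" "E c a" using common_if_not_missing[of c b] miss c by auto
    then show False using uniq[of a b c] E_sym b c nb by auto
  qed
  \<comment> \<open>Otherwise \<open>degree_le\<close> in both directions gives
    \<open>d u = d b\<close>, but \<open>d u\<close> is even and \<open>d b\<close> is odd.\<close>
  have adj: "E b u \<or> E b' u" if u: "u < n" "u \<noteq> b" "u \<noteq> b'" for u
  proof (rule ccontr)
    assume na: "\<not> ?thesis"
    have m0: "m u = 0" using only[OF u(1)] u by (cases "m u = 0") auto
    have "d u \<le> d b" using u b na miss E_sym by (intro degree_le) auto
    moreover have "d b \<le> d u" using u b na m0 by (intro degree_le) auto
    ultimately show False using ob(1) even_degree_if_good[OF m0] by (metis antisym)
  qed
  \<comment> \<open>Further neighbours \<open>u\<close> of \<open>b\<close> and \<open>v\<close> of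
    \<open>b'\<close> have a common neighbour \<open>y\<close>, and \<open>y\<close> is adjacent to
    \<open>b\<close> or \<open>b'\<close>; either way a 4-cycle through the edge between
    \<open>b\<close> and \<open>b'\<close> arises.\<close>
  have "(\<forall>u. E b u \<longrightarrow> u = b') \<or> (\<forall>u. E b' u \<longrightarrow> u = b)"
  proof (rule ccontr)
    assume "\<not> ?thesis"
    then obtain u v where uv: "E b u" "u \<noteq> b'" "E b' v" "v \<noteq> b" by blast
    have un: "u < n" "v < n" "u \<noteq> b" "v \<noteq> b'" using uv E_less E_irrefl by auto
    have "u \<noteq> v" using nc uv by blast
    have "m u = 0" using only[OF un(1)] un uv by (cases "m u = 0") auto
    then obtain y where y: "E u y" "E v y" using common_if_not_missing[of v u] un \<open>u \<noteq> v\<close> by auto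
    have "y \<noteq> b" using nc[of v] y uv E_sym by blast
    moreover have "y \<noteq> b'" using nc[of u] y uv E_sym by blast
    ultimately have "E b y \<or> E b' y" using adj[of y] E_less y by blast
    then show False
    proof
      assume "E b y"
      then show False using unique_common[of y b' v b] y uv b' \<open>y \<noteq> b'\<close> E_sym by blast
    next
      assume "E b' y"
      then show False using unique_common[of y b u b'] y uv b' \<open>y \<noteq> b\<close> E_sym by blast
    qed
  qed
  then show ?thesis
  proof
    assume l: "\<forall>u. E b u \<longrightarrow> u = b'"
    have "E b' v" if "v < n" "v \<noteq> b'" for v using adj[of v] that l b' E_sym by blast
    then show ?thesis using bn by blast
  next
    assume l: "\<forall>u. E b' u \<longrightarrow> u = b"
    have "E b v" if "v < n" "v \<noteq> b" for v using adj[of v] that l b' E_sym by blast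
    then show ?thesis using b by blast
  qed
qed

lemma complete_to_center: "\<exists>R. R \<subseteq> {..<n} \<and> card R = \<kappa> \<and> (\<forall>r\<in>R. \<forall>v<n. v \<notin> R \<longrightarrow> E r v)"
proof -
  obtain c where "c < n" "\<forall>v<n. v \<noteq> c \<longrightarrow> E c v" using universal_odd universal_even by blast
  then show ?thesis using \<kappa>1 by (intro exI[of _ "{c}"]) auto
qed

end

section \<open>The main theorem\<close>

text \<open>The Perron vector of one graph, moved along the bijection, is a test vector for the
  Rayleigh inequality of the other.\<close>

lemma rho_le_if_iso:
  assumes E: "simple_rel n E" "simple_rel n E'" and n: "0 < n" and f: "bij_betw f {..<n} {..<n}"
    and iff: "\<And>u v. u < n \<Longrightarrow> v < n \<Longrightarrow> E' u v \<longleftrightarrow> E (f u) (f v)"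
  shows "rho n E' \<le> rho n E"
proof -
  obtain x z where x: "\<forall>i. 0 \<le> x i" "z < n" "x z = 1" "\<And>i. i < n \<Longrightarrow> (\<Sum>j | E' i j. x j) = rho n E' * x i"
    using perron[OF E(2) n] by blast
  define y where "y i = x (the_inv_into {..<n} f i)" for i
  have yf: "y (f u) = x u" if "u < n" for u
    unfolding y_def using the_inv_into_f_f[of f "{..<n}" u] f that by (simp add: bij_betw_def)
  have re: "(\<Sum>i<n. h i) = (\<Sum>u<n. h (f u))" for h :: "nat \<Rightarrow> real" by (rule sum.reindex_bij_betw[OF f, symmetric])
  have N: "(\<Sum>i<n. (y i)\<^sup>2) = (\<Sum>u<n. (x u)\<^sup>2)" unfolding re[of "\<lambda>i. (y i)\<^sup>2"] using yf by (intro sum.cong) auto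
  have adj: "adj_sum n E y (f u) = adj_sum n E' x u" if "u < n" for u
    unfolding adj_sum_def re[of "\<lambda>j. if E (f u) j then y j else 0"] using iff[OF that] yf by (intro sum.cong) auto
  have "qform n E y = qform n E' x"
    unfolding qform_def re[of "\<lambda>i. y i * adj_sum n E y i"] using adj yf by (intro sum.cong) auto
  then have "rho n E' * (\<Sum>u<n. (x u)\<^sup>2) \<le> rho n E * (\<Sum>u<n. (x u)\<^sup>2)"
    using rayleigh[OF E(1) n, of y] qform_eigen[OF E(2) x(4)] N by simp
  moreover have "0 < (\<Sum>u<n. (x u)\<^sup>2)"
  proof -
    have "(x z)\<^sup>2 \<le> (\<Sum>u<n. (x u)\<^sup>2)" using x(2) by (intro member_le_sum) auto
    then show ?thesis using x(3) by simp
  qed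
  ultimately show ?thesis by simp
qed

lemma spectral_radius_le_if_iso:
  assumes "G \<in> graphs n" "H \<in> graphs n" "0 < n" "H \<simeq>\<^sub>g G"
  shows "spectral_radius (adjacency_matrix n H) \<le> spectral_radius (adjacency_matrix n G)"
proof -
  obtain E where E: "simple_rel n E" "G = graph_of n E" using assms(1) by (rule graphsE)
  obtain E' where E': "simple_rel n E'" "H = graph_of n E'" using assms(2) by (rule graphsE)
  obtain f where f: "inj_on f (pverts H)" "pverts G = f ` pverts H" "parcs G = map_prod f f ` parcs H"
    using assms(4) by (rule graph_isoE)
  have inj: "inj_on f {..<n}" using f(1) E'(2) by simp
  have bij: "bij_betw f {..<n} {..<n}" using f(1,2) E(2) E'(2) by (simp add: bij_betw_def)
  have "E' u v \<longleftrightarrow> E (f u) (f v)" if "u < n" "v < n" for u v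
  proof
    assume "E' u v"
    then have "(f u, f v) \<in> parcs G" unfolding f(3) E'(2) by (auto intro!: image_eqI[of _ _ "(u, v)"])
    then show "E (f u) (f v)" using E(2) by simp
  next
    assume "E (f u) (f v)"
    then have "(f u, f v) \<in> parcs G" using E(2) by simp
    then have "(f u, f v) \<in> map_prod f f ` parcs H" unfolding f(3) .
    then obtain a c where ac: "E' a c" "f u = f a" "f v = f c" using E'(2) by auto
    then have "a < n" "c < n" using simple_rel_less[OF E'(1)] by auto
    then have "u = a" "v = c" using inj_onD[OF inj ac(2)] inj_onD[OF inj ac(3)] that by simp_all
    then show "E' u v" using ac by simp
  qed
  then show ?thesis using rho_le_if_iso[OF E(1) E'(1) assms(3) bij] by (simp add: rho_def E(2) E'(2))
qed

lemma contains_subgraph_iso: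
  assumes G: "pair_wf_digraph G" and F: "pair_wf_digraph F" and iso: "H \<simeq>\<^sub>g G" and "contains_subgraph H F"
  shows "contains_subgraph G F"
proof -
  obtain f where H: "pair_wf_digraph H" and f: "inj_on f (pverts H)" "pverts G = f ` pverts H" "parcs G = map_prod f f ` parcs H"
    using iso by (rule graph_isoE)
  obtain g where g: "inj_on g (pverts F)" "g ` pverts F \<subseteq> pverts H" "\<And>a b. (a, b) \<in> parcs F \<Longrightarrow> (g a, g b) \<in> parcs H"
    using assms(4) unfolding contains_subgraph_iff[OF F H] by blast
  have "inj_on (f \<circ> g) (pverts F)" using g f by (auto intro!: comp_inj_on inj_on_subset[OF f(1)])
  moreover have "(f \<circ> g) ` pverts F \<subseteq> pverts G" using g f by auto
  moreover have "((f \<circ> g) a, (f \<circ> g) b) \<in> parcs G" if "(a, b) \<in> parcs F" for a b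
    unfolding f(3) using g(3)[OF that] by (auto intro!: image_eqI[of _ _ "(g a, g b)"])
  ultimately show ?thesis unfolding contains_subgraph_iff[OF F G] by blast
qed

lemma finite_graphs: "finite (graphs n)"
proof (rule finite_subset)
  show "graphs n \<subseteq> (\<lambda>A. \<lparr>pverts = {..<n}, parcs = A\<rparr>) ` Pow ({..<n} \<times> {..<n})"
  proof
    fix G assume "G \<in> graphs n"
    then obtain E where E: "simple_rel n E" "G = graph_of n E" by (rule graphsE)
    have "{(u, v). E u v} \<subseteq> {..<n} \<times> {..<n}" using simple_rel_less[OF E(1)] by auto
    then show "G \<in> (\<lambda>A. \<lparr>pverts = {..<n}, parcs = A\<rparr>) ` Pow ({..<n} \<times> {..<n})"
      unfolding E(2) graph_of_def by (intro image_eqI[of _ _ "{(u, v). E u v}"]) auto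
  qed
qed simp

context intersecting_even_cycles
begin

lemma SPEX_nonempty:
  assumes "\<kappa> < n" shows "SPEX n F \<noteq> {}"
proof -
  let ?S = "{G \<in> graphs n. \<not> contains_subgraph G F}" and ?r = "\<lambda>G. spectral_radius (adjacency_matrix n G)"
  have fin: "finite ?S" using finite_graphs by simp
  have "graph_of n (\<lambda>u v. u < n \<and> v < n \<and> (u < \<kappa>) \<noteq> (v < \<kappa>)) \<in> ?S"
    using rho_bipartite[OF assms] graph_of_in_graphs by blast
  then have "Max (?r ` ?S) \<in> ?r ` ?S" using fin by (intro Max_in) auto
  then obtain G where G: "G \<in> ?S" "?r G = Max (?r ` ?S)" by auto
  have "?r H \<le> ?r G" if "H \<in> ?S" for H unfolding G(2) using that fin by (intro Max_ge) auto
  then have "G \<in> SPEX n F" using G(1) by (auto simp: SPEX_def spectral_maximisers_def)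
  then show ?thesis by blast
qed

lemma pair_wf_graphs: "G \<in> graphs n \<Longrightarrow> pair_wf_digraph G"
proof -
  assume "G \<in> graphs n"
  then interpret pair_graph G by (simp add: graphs_def)
  show ?thesis by (rule pair_wf_digraph)
qed

text \<open>Minor-free graphs are in particular free. Once all extremal free graphs are minor-free,
  the two maxima coincide and with them the sets of maximisers. Nonemptiness turns uniqueness up to
  isomorphism into equality with the whole class.\<close>

lemma SPEX_eq_iso_class:
  assumes n: "\<kappa> < n" and all: "\<And>G. G \<in> SPEX n F \<Longrightarrow> G \<simeq>\<^sub>g T \<and> minor_free G F"
  shows "SPEX n F = iso_class n T \<and> SPEX_minor n F = SPEX n F"
proof
  have n0: "0 < n" using n by simp
  have in_SPEX: "H \<in> SPEX n F" if G: "G \<in> SPEX n F" and H: "H \<in> graphs n" "\<not> contains_subgraph H F"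
    and le: "spectral_radius (adjacency_matrix n G) \<le> spectral_radius (adjacency_matrix n H)" for G H
    using G H le unfolding SPEX_def spectral_maximisers_def by (auto intro: order_trans)
  obtain G0 where G0: "G0 \<in> SPEX n F" using SPEX_nonempty[OF n] by blast
  have G0g: "G0 \<in> graphs n" "\<not> contains_subgraph G0 F" using G0 by (auto simp: SPEX_def spectral_maximisers_def)
  show "SPEX n F = iso_class n T"
  proof (intro equalityI subsetI)
    fix G assume "G \<in> SPEX n F"
    then show "G \<in> iso_class n T" using all by (auto simp: iso_class_def SPEX_def spectral_maximisers_def)
  next
    fix H assume "H \<in> iso_class n T"
    then have H: "H \<in> graphs n" "H \<simeq>\<^sub>g T" by (auto simp: iso_class_def)
    have "G0 \<simeq>\<^sub>g T" using all[OF G0] by blast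
    then have HG: "H \<simeq>\<^sub>g G0" by (rule graph_iso_trans[OF H(2) graph_iso_sym])
    have "\<not> contains_subgraph H F"
      using contains_subgraph_iso[OF pair_wf_graphs[OF G0g(1)] wf_intersecting_cycles HG] G0g(2) by blast
    moreover have "spectral_radius (adjacency_matrix n G0) \<le> spectral_radius (adjacency_matrix n H)"
      by (rule spectral_radius_le_if_iso[OF H(1) G0g(1) n0 graph_iso_sym[OF HG]])
    ultimately show "H \<in> SPEX n F" by (rule in_SPEX[OF G0 H(1)])
  qed
  have mf: "\<not> contains_subgraph G F" if "G \<in> graphs n" "minor_free G F" for G
    by (rule not_contains_if_minor_free[OF _ sym_intersecting_cycles that(2)]) (use that(1) in \<open>simp add: graphs_def\<close>)
  show "SPEX_minor n F = SPEX n F"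
  proof (intro equalityI subsetI)
    fix G assume "G \<in> SPEX n F"
    then show "G \<in> SPEX_minor n F" using all[of G] mf
      by (auto simp: SPEX_minor_def SPEX_def spectral_maximisers_def)
  next
    fix G assume G: "G \<in> SPEX_minor n F"
    have "spectral_radius (adjacency_matrix n G0) \<le> spectral_radius (adjacency_matrix n G)"
      using G G0g(1) all[OF G0] by (auto simp: SPEX_minor_def spectral_maximisers_def)
    then show "G \<in> SPEX n F" using G mf by (intro in_SPEX[OF G0]) (auto simp: SPEX_minor_def spectral_maximisers_def)
  qed
qed

lemma complete_to_hubs_eventually:
  assumes "2 \<le> \<kappa>"
  shows "\<exists>n0. \<forall>n\<ge>n0. \<forall>E x z. extremal_graph t k \<kappa> n E x z \<longrightarrow>
    (\<exists>R. R \<subseteq> {..<n} \<and> card R = \<kappa> \<and> (\<forall>r\<in>R. \<forall>v<n. v \<notin> R \<longrightarrow> E r v))"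
proof -
  define C where "C = 1000 * (real \<kappa> + 2) * (2 * real order_F + 1) + 2"
  define Q where "Q = 200 * (2 * real \<kappa> + 2)\<^sup>2 * (2 * real order_F + 1)"
  define D where "D = real (1000 * (1 + 3 * order_F + 50 * \<kappa>))"
  \<comment> \<open>Chosen to satisfy \<open>\<delta> * D \<le> 1\<close> and
    \<open>Q * (C * \<delta>) \<le> 1\<close> simultaneously; \<open>C * \<delta>\<close> is the
    \<open>e\<close> of \<open>tiny_extremal_graph\<close>.\<close>
  define \<delta> where "\<delta> = 1 / (Q * C + D)"
  define b where "b = nat \<lceil>(real \<kappa> + 1) / \<delta>\<rceil>"
  have QC: "0 \<le> Q * C" by (simp add: Q_def C_def)
  have D: "1 \<le> D" by (simp add: D_def)
  have \<delta>: "0 < \<delta>" using QC D by (simp add: \<delta>_def)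
  have \<delta>1: "\<delta> * D \<le> 1" using QC D by (simp add: \<delta>_def)
  have \<delta>2: "Q * (C * \<delta>) \<le> 1" using QC D by (simp add: \<delta>_def)
  have "(real \<kappa> + 1) / \<delta> \<le> b" unfolding b_def by (rule real_nat_ceiling_ge)
  then have b: "real \<kappa> + 1 \<le> b * \<delta>" using \<delta> by (simp add: pos_divide_le_eq)
  \<comment> \<open>\<open>N1\<close>, \<open>N2\<close> and \<open>N3\<close> are the three
    \<open>large\<close> assumptions solved for \<open>n\<close>.\<close>
  define N1 where "N1 = 16 * (real b)\<^sup>2 * (2 * real order_F + 1) / \<delta>\<^sup>2"
  define N2 where "N2 = 4 * real ((b + 1) * (2 ^ b * order_F)) / \<delta>"
  define N3 where "N3 = 4 * real (\<kappa>\<^sup>2 + 4 * order_F + 8) / \<delta>"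
  obtain n0 :: nat where n0: "N1 + N2 + N3 \<le> n0" using real_arch_simple by blast
  have N: "0 \<le> N1" "0 \<le> N2" "0 \<le> N3" using \<delta> by (simp_all add: N1_def N2_def N3_def)
  show ?thesis
  proof (intro exI[of _ n0] allI impI)
    fix n E x z assume n: "n0 \<le> n" and ex: "extremal_graph t k \<kappa> n E x z"
    have nr: "N1 \<le> n" "N2 \<le> n" "N3 \<le> n" using n0 N n of_nat_mono[OF n, where 'a = real] by linarith+
    have l2: "real ((b + 1) * (2 ^ b * order_F)) \<le> \<delta> * n / 4" using nr(2) \<delta> by (simp add: N2_def pos_divide_le_eq algebra_simps)
    have l3: "real (\<kappa>\<^sup>2 + 4 * order_F + 8) \<le> \<delta> * n / 4" using nr(3) \<delta> by (simp add: N3_def pos_divide_le_eq algebra_simps)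
    have "b * sqrt ((2 * real order_F + 1) * n) = sqrt ((real b)\<^sup>2 * ((2 * real order_F + 1) * n))" by (simp add: real_sqrt_mult)
    also have "\<dots> \<le> \<delta> * n / 4"
    proof (rule real_le_lsqrt)
      have "16 * (real b)\<^sup>2 * (2 * real order_F + 1) \<le> n * \<delta>\<^sup>2" using nr(1) \<delta> by (simp add: N1_def pos_divide_le_eq)
      then have "16 * (real b)\<^sup>2 * (2 * real order_F + 1) * n \<le> n * \<delta>\<^sup>2 * n" by (rule mult_right_mono) simp
      then show "(real b)\<^sup>2 * ((2 * real order_F + 1) * n) \<le> (\<delta> * n / 4)\<^sup>2" by (simp add: power_divide power2_eq_square algebra_simps)
    qed (use \<delta> in auto)
    finally have l1: "b * sqrt ((2 * real order_F + 1) * n) \<le> \<delta> * n / 4" .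
    interpret extremal_graph t k \<kappa> n E x z by fact
    interpret tiny_extremal_graph t k \<kappa> n E x z \<delta> b "C * \<delta>"
    proof unfold_locales
      show "2 \<le> \<kappa>" by fact
      show "0 < \<delta>" by fact
    qed (use \<delta>1 \<delta>2 b l1 l2 l3 in \<open>simp_all add: C_def D_def Q_def algebra_simps\<close>)
    show "\<exists>R. R \<subseteq> {..<n} \<and> card R = \<kappa> \<and> (\<forall>r\<in>R. \<forall>v<n. v \<notin> R \<longrightarrow> E r v)" by (rule complete_to_hubs)
  qed
qed

lemma extremal_structure:
  "\<exists>n0. \<forall>n\<ge>n0. \<forall>E x z. extremal_graph t k \<kappa> n E x z \<longrightarrow> (\<exists>R. hub_graph t k \<kappa> n E x z R)"
proof -
  have "\<exists>n0. \<forall>n\<ge>n0. \<forall>E x z. extremal_graph t k \<kappa> n E x z \<longrightarrow>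
    (\<exists>R. R \<subseteq> {..<n} \<and> card R = \<kappa> \<and> (\<forall>r\<in>R. \<forall>v<n. v \<notin> R \<longrightarrow> E r v))"
  proof (cases "\<kappa> = 1")
    case True
    show ?thesis
    proof (intro exI[of _ 5] allI impI)
      fix n E x z assume n: "5 \<le> n" and ex: "extremal_graph t k \<kappa> n E x z"
      interpret extremal_graph t k \<kappa> n E x z by fact
      interpret c4_graph t k \<kappa> n E x z by unfold_locales fact+
      show "\<exists>R. R \<subseteq> {..<n} \<and> card R = \<kappa> \<and> (\<forall>r\<in>R. \<forall>v<n. v \<notin> R \<longrightarrow> E r v)" by (rule complete_to_center)
    qed
  next
    case False
    then show ?thesis using complete_to_hubs_eventually \<kappa>_pos by simp
  qed
  then obtain n0 where n0: "\<And>n E x z. n0 \<le> n \<Longrightarrow> extremal_graph t k \<kappa> n E x z \<Longrightarrow>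
    \<exists>R. R \<subseteq> {..<n} \<and> card R = \<kappa> \<and> (\<forall>r\<in>R. \<forall>v<n. v \<notin> R \<longrightarrow> E r v)" by blast
  show ?thesis
  proof (intro exI[of _ "n0 + \<kappa> + order_F"] allI impI)
    fix n E x z assume n: "n0 + \<kappa> + order_F \<le> n" and ex: "extremal_graph t k \<kappa> n E x z"
    have "n0 \<le> n" using n by simp
    then obtain R where R: "R \<subseteq> {..<n}" "card R = \<kappa>" "\<forall>r\<in>R. \<forall>v<n. v \<notin> R \<longrightarrow> E r v" using n0[OF _ ex] by blast
    interpret extremal_graph t k \<kappa> n E x z by fact
    have "hub_graph t k \<kappa> n E x z R" by unfold_locales (use R n in auto)
    then show "\<exists>R. hub_graph t k \<kappa> n E x z R" by blast
  qed
qed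

lemma SPEX_extremal_graph:
  assumes "0 < n" "G \<in> SPEX n F"
  obtains E x z where "G = graph_of n E" "extremal_graph t k \<kappa> n E x z"
proof -
  have G: "G \<in> graphs n" "\<not> contains_subgraph G F"
    and max: "\<And>H. H \<in> graphs n \<Longrightarrow> \<not> contains_subgraph H F \<Longrightarrow>
      spectral_radius (adjacency_matrix n H) \<le> spectral_radius (adjacency_matrix n G)"
    using assms(2) by (auto simp: SPEX_def spectral_maximisers_def)
  obtain E where E: "simple_rel n E" "G = graph_of n E" using G(1) by (rule graphsE)
  obtain x z where x: "\<forall>i. 0 \<le> x i" "\<forall>i<n. x i \<le> 1" "z < n" "x z = 1" "\<forall>i<n. (\<Sum>j | E i j. x j) = rho n E * x i"
    using perron[OF E(1) assms(1)] by blast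
  have "extremal_graph t k \<kappa> n E x z"
  proof unfold_locales
    show "rho n E' \<le> rho n E" if "simple_rel n E'" "\<not> contains_subgraph (graph_of n E') F" for E'
      using max[OF graph_of_in_graphs[OF that(1)] that(2)] by (simp add: rho_def E(2))
  qed (use E G x in auto)
  then show thesis using that E(2) by blast
qed

end

theorem theorem6p1:
  fixes t :: nat and k :: "nat \<Rightarrow> nat" and \<kappa> :: nat
  assumes "t \<ge> 1"
    and "2 \<le> k 1"
    and "\<And>i j. 1 \<le> i \<Longrightarrow> i \<le> j \<Longrightarrow> j \<le> t \<Longrightarrow> k i \<le> k j"
    and "\<kappa> = (\<Sum>i = 1..t. k i - 1)"
  shows "\<exists>n0. \<forall>n \<ge> n0.
    SPEX_minor n (intersecting_cycles t (\<lambda>i. 2 * k i)) = SPEX n (intersecting_cycles t (\<lambda>i. 2 * k i)) \<and>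
    (k t = 2 \<longrightarrow> SPEX n (intersecting_cycles t (\<lambda>i. 2 * k i)) = iso_class n (F_graph n t)) \<and>
    (k t \<ge> 3 \<longrightarrow> SPEX n (intersecting_cycles t (\<lambda>i. 2 * k i)) = iso_class n (S_plus_graph n \<kappa>))"
proof -
  have k2: "2 \<le> k i" if "i \<in> {1..t}" for i using assms(3)[of 1 i] assms(2) that by auto
  interpret intersecting_even_cycles t k \<kappa> by unfold_locales (use assms k2 in auto)
  obtain n0 where n0: "\<And>n E x z. n0 \<le> n \<Longrightarrow> extremal_graph t k \<kappa> n E x z \<Longrightarrow> \<exists>R. hub_graph t k \<kappa> n E x z R"
    using extremal_structure by blast
  have hub: "\<exists>E x z R. G = graph_of n E \<and> hub_graph t k \<kappa> n E x z R"
    if n: "n0 + \<kappa> + 1 \<le> n" and G: "G \<in> SPEX n F" for n G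
  proof -
    have "0 < n" using n by simp
    then obtain E x z where E: "G = graph_of n E" "extremal_graph t k \<kappa> n E x z" using SPEX_extremal_graph[OF _ G] by blast
    have "n0 \<le> n" using n by simp
    then show ?thesis using n0[OF _ E(2)] E(1) by blast
  qed
  show ?thesis
  proof (intro exI[of _ "n0 + \<kappa> + 1"] allI impI)
    fix n assume n: "n0 + \<kappa> + 1 \<le> n"
    have \<kappa>n: "\<kappa> < n" using n by simp
    have tt: "t \<in> {1..t}" using assms(1) by simp
    consider "k t = 2" | "3 \<le> k t" using k2[OF tt] by linarith
    then show "SPEX_minor n F = SPEX n F \<and> (k t = 2 \<longrightarrow> SPEX n F = iso_class n (F_graph n t)) \<and>
      (k t \<ge> 3 \<longrightarrow> SPEX n F = iso_class n (S_plus_graph n \<kappa>))"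
    proof cases
      case 1
      have all2: "\<forall>i\<in>{1..t}. k i = 2"
      proof
        fix i assume i: "i \<in> {1..t}"
        have "k i \<le> k t" using assms(3)[of i t] i by simp
        then show "k i = 2" using k2[OF i] 1 by simp
      qed
      then have "\<kappa> = (\<Sum>i = 1..t. 1)" unfolding assms(4) by (intro sum.cong) auto
      then have \<kappa>t: "\<kappa> = t" by simp
      have "SPEX n F = iso_class n (F_graph n t) \<and> SPEX_minor n F = SPEX n F"
      proof (rule SPEX_eq_iso_class[OF \<kappa>n])
        fix G assume G: "G \<in> SPEX n F"
        obtain E x z R where E: "G = graph_of n E" "hub_graph t k \<kappa> n E x z R" using hub[OF n G] by blast
        then show "G \<simeq>\<^sub>g F_graph n t \<and> minor_free G F" using hub_graph.iso_F[OF E(2) all2] \<kappa>t by simp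
      qed
      then show ?thesis using 1 by simp
    next
      case 2
      have "SPEX n F = iso_class n (S_plus_graph n \<kappa>) \<and> SPEX_minor n F = SPEX n F"
      proof (rule SPEX_eq_iso_class[OF \<kappa>n])
        fix G assume G: "G \<in> SPEX n F"
        obtain E x z R where E: "G = graph_of n E" "hub_graph t k \<kappa> n E x z R" using hub[OF n G] by blast
        then show "G \<simeq>\<^sub>g S_plus_graph n \<kappa> \<and> minor_free G F" using hub_graph.iso_S_plus[OF E(2) tt 2] by simp
      qed
      then show ?thesis using 2 by simp
    qed
  qed
qed

end
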